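(* Let $\Omega\subset\mathbb{R}^d$, $d\ge1$, be a bounded Lipschitz domain, let $T>0$, and let $\mathcal{E}(\Omega)=\{x+\mathrm{i}y\in\mathbb{C}^d : x\in\Omega,\ y\in\mathbb{R}^d,\ |y|<\mathrm{dist}(x,\partial\Omega)\}$. Let $u\in H^{1,1/2}((0,T)\times\Omega)$ be a solution of the heat equation $$\partial_tu=\Delta u\ \text{ in }(0,T)\times\Omega,\qquad u|_{t=0}=u_0\ \text{ in }\Omega,\qquad u|_{(0,T)\times\partial\Omega}=h,$$ with some boundary data $h\in H^{1/2,1/4}((0,T)\times\partial\Omega)$ and with initial data $u_0\in H^1_0(\Omega)$ such that $u_0\in\mathcal{O}(\mathcal{E}(\Omega))$, i.e. $u_0$ is the restriction to $\Omega$ of a holomorphic function on $\mathcal{E}(\Omega)$. Then (the holomorphic extension to $\mathcal{E}(\Omega)$ of) $u(t,\cdot)$ converges to (the holomorphic extension of) $u_0$ as $t\to0_+$, uniformly on compact subsets of $\mathcal{E}(\Omega)$.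
   Context: A domain is a non-empty open connected set. A bounded Lipschitz domain is a bounded domain whose boundary is locally congruent to the graph of a Lipschitz function on $\mathbb{R}^{d-1}$, with $\Omega$ located on exactly one side of it. $\mathbb{R}^d$ is regarded as a subset of $\mathbb{C}^d$. For open $U\subset\mathbb{C}^d$, $\mathcal{O}(U)$ is the set of holomorphic functions on $U$; a function in $\mathcal{O}(\mathcal{E}(\Omega))$ is determined by its restriction to $\Omega$, and $\mathcal{O}(\mathcal{E}(\Omega))$ is viewed as a subset of $C^\infty(\Omega)$. Put $Q=(0,T)\times\Omega$ and $\Sigma=(0,T)\times\partial\Omega$. For $r,s\ge0$, $H^{r,s}(\mathbb{R}\times\mathbb{R}^d)=L^2(\mathbb{R};H^r(\mathbb{R}^d))\cap H^s(\mathbb{R};L^2(\mathbb{R}^d))$; $H^{r,s}(Q)$ is the space of restrictions of its elements to $Q$ with the quotient norm. For $0\le r\le1$, $H^{r,s}(\mathbb{R}\times\partial\Omega)$ and $H^{r,s}(\Sigma)$ are defined analogously. The boundary condition is understood via the continuous trace map $H^{1,1/2}(Q)\to H^{1/2,1/4}(\Sigma)$. An element $u\in H^{1,1/2}(Q)$ with $(\partial_t-\Delta)u\in L^2(Q)$ lies in $C([0,T],H^{-1}(\Omega))$, which gives meaning to $u|_{t=0}$. The solution $u$ is in $C^\infty((0,T]\times\Omega)$, and for each $t\in(0,T]$ the function $u(t,\cdot)$ extends uniquely to a holomorphic function on $\mathcal{E}(\Omega)$. *)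

theory Defs
  imports "HOL-Analysis.Analysis"
begin

section \<open>Bounded Lipschitz domains\<close>

text \<open>
  A coordinate-free rendering of local congruence to the graph of a Lipschitz function:
  \<open>\<nu>\<close> is the unit vector in the direction of the graph axis, the hyperplane
  orthogonal to \<open>\<nu>\<close> is the copy of \<open>\<real>\<close> to the power \<open>d - 1\<close>
  on which the Lipschitz function \<open>\<gamma>\<close> lives (a single point if \<open>d = 1\<close>), and
  the translation part of the congruence is absorbed into \<open>\<gamma>\<close>.
\<close>

definition bounded_lipschitz_domain :: "'a::euclidean_space set \<Rightarrow> bool" where
  "bounded_lipschitz_domain \<Omega> \<longleftrightarrow>
     \<Omega> \<noteq> {} \<and> open \<Omega> \<and> connected \<Omega> \<and> bounded \<Omega> \<and>
     (\<forall>p\<in>frontier \<Omega>. \<exists>V \<nu> \<gamma> L.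
        open V \<and> p \<in> V \<and> norm \<nu> = 1 \<and> L-lipschitz_on {y. y \<bullet> \<nu> = 0} \<gamma> \<and>
        frontier \<Omega> \<inter> V = {x \<in> V. x \<bullet> \<nu> = \<gamma> (x - (x \<bullet> \<nu>) *\<^sub>R \<nu>)} \<and>
        \<Omega> \<inter> V = {x \<in> V. x \<bullet> \<nu> > \<gamma> (x - (x \<bullet> \<nu>) *\<^sub>R \<nu>)})"


section \<open>Holomorphic functions of several variables\<close>

definition cvec :: "real ^ 'n \<Rightarrow> real ^ 'n \<Rightarrow> complex ^ 'n" where
  "cvec x y = (\<chi> i. Complex (x $ i) (y $ i))"

definition tube :: "(real ^ 'n) set \<Rightarrow> (complex ^ 'n) set" where
  "tube \<Omega> = {cvec x y | x y. x \<in> \<Omega> \<and> norm y < infdist x (frontier \<Omega>)}"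

definition holomorphic_several_on :: "(complex ^ 'n \<Rightarrow> complex) \<Rightarrow> (complex ^ 'n) set \<Rightarrow> bool" where
  "holomorphic_several_on F U \<longleftrightarrow>
     (\<forall>z\<in>U. \<exists>L. (F has_derivative L) (at z) \<and> (\<forall>c v. L (c *s v) = c * L v))"

definition holomorphic_extension ::
    "(real ^ 'n) set \<Rightarrow> (real ^ 'n \<Rightarrow> complex) \<Rightarrow> (complex ^ 'n \<Rightarrow> complex) \<Rightarrow> bool" where
  "holomorphic_extension \<Omega> f F \<longleftrightarrow>
     holomorphic_several_on F (tube \<Omega>) \<and> (\<forall>x\<in>\<Omega>. F (cvec x 0) = f x)"


section \<open>Test functions\<close>

definition dderiv :: "'a::euclidean_space \<Rightarrow> ('a \<Rightarrow> complex) \<Rightarrow> 'a \<Rightarrow> complex" where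
  "dderiv b f x = frechet_derivative f (at x) b"

primrec Ck :: "nat \<Rightarrow> ('a::euclidean_space \<Rightarrow> complex) \<Rightarrow> bool" where
  "Ck 0 f \<longleftrightarrow> continuous_on UNIV f"
| "Ck (Suc k) f \<longleftrightarrow> (\<forall>x. f differentiable (at x)) \<and> (\<forall>b\<in>Basis. Ck k (dderiv b f))"

definition test_function :: "'a::euclidean_space set \<Rightarrow> ('a \<Rightarrow> complex) \<Rightarrow> bool" where
  "test_function \<Omega> \<phi> \<longleftrightarrow>
     (\<forall>k. Ck k \<phi>) \<and> compact (closure {x. \<phi> x \<noteq> 0}) \<and> closure {x. \<phi> x \<noteq> 0} \<subseteq> \<Omega>"


section \<open>Sobolev spaces\<close>

text \<open>
  All functions below are representatives of classes modulo equality almost everywhere. Norms are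
  given through their squares, with values in \<open>ennreal\<close>; the value \<open>\<infinity>\<close> means that a
  (measurable) function does not belong to the space.
\<close>

definition L2_norm2 :: "'a measure \<Rightarrow> ('a \<Rightarrow> complex) \<Rightarrow> ennreal" where
  "L2_norm2 M f = (\<integral>\<^sup>+x. ennreal ((cmod (f x))\<^sup>2) \<partial>M)"

definition weak_gradient ::
    "'a::euclidean_space set \<Rightarrow> ('a \<Rightarrow> complex) \<Rightarrow> ('a \<Rightarrow> 'a \<Rightarrow> complex) \<Rightarrow> bool" where
  "weak_gradient \<Omega> f g \<longleftrightarrow>
     (\<forall>b\<in>Basis. set_borel_measurable lborel \<Omega> (g b) \<and>
        (\<forall>\<phi>. test_function \<Omega> \<phi> \<longrightarrow>
           (LINT x:\<Omega>|lborel. f x * dderiv b \<phi> x) = - (LINT x:\<Omega>|lborel. g b x * \<phi> x)))"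

text \<open>
  The infimum ranges over the versions of the weak gradient; it is \<open>\<infinity>\<close> if there is none.
\<close>

definition H1_norm2 :: "'a::euclidean_space set \<Rightarrow> ('a \<Rightarrow> complex) \<Rightarrow> ennreal" where
  "H1_norm2 \<Omega> f =
     (\<integral>\<^sup>+x\<in>\<Omega>. ennreal ((cmod (f x))\<^sup>2) \<partial>lborel) +
     (INF g\<in>{g. weak_gradient \<Omega> f g}. \<Sum>b\<in>Basis. \<integral>\<^sup>+x\<in>\<Omega>. ennreal ((cmod (g b x))\<^sup>2) \<partial>lborel)"

definition H1_0 :: "'a::euclidean_space set \<Rightarrow> ('a \<Rightarrow> complex) set" where
  "H1_0 \<Omega> = {f. set_borel_measurable lborel \<Omega> f \<and>
     (\<exists>\<phi>. (\<forall>k::nat. test_function \<Omega> (\<phi> k)) \<and>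
        (\<lambda>k. H1_norm2 \<Omega> (\<lambda>x. \<phi> k x - f x)) \<longlonglongrightarrow> 0)}"

text \<open>
  The dual of \<open>H1_0 \<Omega>\<close>, as the space of linear functionals on the (dense) subspace of test
  functions that are bounded for the \<open>H\<^sup>1\<close> norm.
\<close>

definition Hm1_norm :: "'a::euclidean_space set \<Rightarrow> (('a \<Rightarrow> complex) \<Rightarrow> complex) \<Rightarrow> ennreal" where
  "Hm1_norm \<Omega> w = (SUP \<phi>\<in>{\<phi>. test_function \<Omega> \<phi> \<and> H1_norm2 \<Omega> \<phi> \<le> 1}. ennreal (cmod (w \<phi>)))"

definition Hm1 :: "'a::euclidean_space set \<Rightarrow> (('a \<Rightarrow> complex) \<Rightarrow> complex) set" where
  "Hm1 \<Omega> = {w.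
     (\<forall>\<phi> \<psi>. test_function \<Omega> \<phi> \<longrightarrow> test_function \<Omega> \<psi> \<longrightarrow> w (\<lambda>x. \<phi> x + \<psi> x) = w \<phi> + w \<psi>) \<and>
     (\<forall>c \<phi>. test_function \<Omega> \<phi> \<longrightarrow> w (\<lambda>x. c * \<phi> x) = c * w \<phi>) \<and>
     Hm1_norm \<Omega> w < \<infinity>}"

text \<open>
  Sobolev--Slobodeckij norm of order \<open>0 < r < 1\<close> on a set of dimension \<open>m\<close> carrying the
  measure \<open>M\<close>. The diagonal contributes nothing, since \<open>0 / 0 = 0\<close>.
\<close>

definition slobodeckij_norm2 ::
    "'a::euclidean_space measure \<Rightarrow> nat \<Rightarrow> real \<Rightarrow> ('a \<Rightarrow> complex) \<Rightarrow> ennreal" where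
  "slobodeckij_norm2 M m r f = L2_norm2 M f +
     (\<integral>\<^sup>+x. \<integral>\<^sup>+y. ennreal ((cmod (f x - f y))\<^sup>2 / dist x y powr (real m + 2 * r)) \<partial>M \<partial>M)"

text \<open>
  Normalised so that the measure of dimension \<open>DIM('a)\<close> is the Lebesgue measure; covering
  sets of diameter \<open>0\<close> count in dimension \<open>0\<close> unless they are empty.
\<close>

definition hausdorff_outer :: "nat \<Rightarrow> 'a::euclidean_space set \<Rightarrow> ennreal" where
  "hausdorff_outer m A = (SUP \<delta>\<in>{0<..}.
     INF C\<in>{C :: nat \<Rightarrow> 'a set. A \<subseteq> (\<Union>i. C i) \<and> (\<forall>i. bounded (C i) \<and> diameter (C i) \<le> \<delta>)}.
       \<Sum>i. ennreal (if C i = {} then 0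
                    else unit_ball_vol (real m) * (diameter (C i) / 2) ^ m))"

definition hausdorff_measure :: "nat \<Rightarrow> 'a::euclidean_space measure" where
  "hausdorff_measure m = measure_of UNIV (sets borel) (hausdorff_outer m)"

definition surface_measure :: "'a::euclidean_space set \<Rightarrow> 'a measure" where
  "surface_measure \<Omega> = density (hausdorff_measure (DIM('a) - 1)) (indicator (frontier \<Omega>))"


section \<open>Anisotropic Sobolev spaces\<close>

text \<open>
  The sum of the squared norms of \<open>L\<^sup>2(\<real>; X)\<close> and of \<open>H\<^sup>s(\<real>; L\<^sup>2(M))\<close>, \<open>0 < s < 1\<close>,
  where \<open>N\<close> is the squared norm of the space \<open>X\<close>.
\<close>

definition aniso_norm2 ::
    "(('a \<Rightarrow> complex) \<Rightarrow> ennreal) \<Rightarrow> 'a measure \<Rightarrow> real \<Rightarrow> (real \<times> 'a \<Rightarrow> complex) \<Rightarrow> ennreal" where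
  "aniso_norm2 N M s U =
     (\<integral>\<^sup>+t. N (\<lambda>x. U (t, x)) \<partial>lborel) +
     ((\<integral>\<^sup>+t. L2_norm2 M (\<lambda>x. U (t, x)) \<partial>lborel) +
      (\<integral>\<^sup>+t. \<integral>\<^sup>+t'. L2_norm2 M (\<lambda>x. U (t, x) - U (t', x)) / ennreal (\<bar>t - t'\<bar> powr (1 + 2 * s))
         \<partial>lborel \<partial>lborel))"

text \<open>
  The quotient norm on restrictions to \<open>(0,T) \<times> A\<close>, and the space of such restrictions.
\<close>

definition aniso_restr_norm2 ::
    "(('a \<Rightarrow> complex) \<Rightarrow> ennreal) \<Rightarrow> 'a measure \<Rightarrow> real \<Rightarrow> real \<Rightarrow> 'a set
      \<Rightarrow> (real \<times> 'a \<Rightarrow> complex) \<Rightarrow> ennreal" where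
  "aniso_restr_norm2 N M s T A u =
     (INF U\<in>{U \<in> borel_measurable (lborel \<Otimes>\<^sub>M M).
               AE z in lborel \<Otimes>\<^sub>M M. z \<in> {0<..<T} \<times> A \<longrightarrow> U z = u z}.
        aniso_norm2 N M s U)"

definition aniso_restr_space ::
    "(('a \<Rightarrow> complex) \<Rightarrow> ennreal) \<Rightarrow> 'a measure \<Rightarrow> real \<Rightarrow> real \<Rightarrow> 'a set
      \<Rightarrow> (real \<times> 'a \<Rightarrow> complex) set" where
  "aniso_restr_space N M s T A =
     {u. set_borel_measurable (lborel \<Otimes>\<^sub>M M) ({0<..<T} \<times> A) u \<and>
         aniso_restr_norm2 N M s T A u < \<infinity>}"

text \<open>
  \<open>HQ T \<Omega>\<close> is the space with indices \<open>(r, s) = (1, 1/2)\<close> on \<open>(0,T) \<times> \<Omega>\<close>, and \<open>HSigma T \<Omega>\<close> the one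
  with indices \<open>(r, s) = (1/2, 1/4)\<close> on \<open>(0,T) \<times> frontier \<Omega>\<close>.
\<close>

definition HQ_norm2 ::
    "real \<Rightarrow> 'a::euclidean_space set \<Rightarrow> (real \<times> 'a \<Rightarrow> complex) \<Rightarrow> ennreal" where
  "HQ_norm2 T \<Omega> = aniso_restr_norm2 (H1_norm2 UNIV) lborel (1/2) T \<Omega>"

definition HQ :: "real \<Rightarrow> 'a::euclidean_space set \<Rightarrow> (real \<times> 'a \<Rightarrow> complex) set" where
  "HQ T \<Omega> = aniso_restr_space (H1_norm2 UNIV) lborel (1/2) T \<Omega>"

definition HSigma_norm2 ::
    "real \<Rightarrow> 'a::euclidean_space set \<Rightarrow> (real \<times> 'a \<Rightarrow> complex) \<Rightarrow> ennreal" where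
  "HSigma_norm2 T \<Omega> =
     aniso_restr_norm2 (slobodeckij_norm2 (surface_measure \<Omega>) (DIM('a) - 1) (1/2))
       (surface_measure \<Omega>) (1/4) T (frontier \<Omega>)"

definition HSigma :: "real \<Rightarrow> 'a::euclidean_space set \<Rightarrow> (real \<times> 'a \<Rightarrow> complex) set" where
  "HSigma T \<Omega> =
     aniso_restr_space (slobodeckij_norm2 (surface_measure \<Omega>) (DIM('a) - 1) (1/2))
       (surface_measure \<Omega>) (1/4) T (frontier \<Omega>)"

text \<open>
  The graph of the trace map from \<open>HQ T \<Omega>\<close> to \<open>HSigma T \<Omega>\<close>, which is the continuous extension of
  the pointwise restriction to \<open>(0,T) \<times> frontier \<Omega>\<close> from the dense subspace of (restrictions of)
  smooth compactly supported functions on \<open>\<real> \<times> \<real>\<^sup>d\<close>.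
\<close>

definition has_trace ::
    "real \<Rightarrow> 'a::euclidean_space set \<Rightarrow> (real \<times> 'a \<Rightarrow> complex) \<Rightarrow> (real \<times> 'a \<Rightarrow> complex) \<Rightarrow> bool"
  where
  "has_trace T \<Omega> u h \<longleftrightarrow>
     (\<exists>\<phi>. (\<forall>k::nat. test_function UNIV (\<phi> k)) \<and>
        (\<lambda>k. HQ_norm2 T \<Omega> (\<lambda>z. \<phi> k z - u z)) \<longlonglongrightarrow> 0 \<and>
        (\<lambda>k. HSigma_norm2 T \<Omega> (\<lambda>z. \<phi> k z - h z)) \<longlonglongrightarrow> 0)"


section \<open>The heat equation\<close>

text \<open>The equation in \<open>(0,T) \<times> \<Omega>\<close>, in the sense of distributions.\<close>

definition heat_equation ::
    "real \<Rightarrow> 'a::euclidean_space set \<Rightarrow> (real \<times> 'a \<Rightarrow> complex) \<Rightarrow> bool" where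
  "heat_equation T \<Omega> u \<longleftrightarrow>
     (\<forall>\<phi>. test_function ({0<..<T} \<times> \<Omega>) \<phi> \<longrightarrow>
        - (LINT z:{0<..<T} \<times> \<Omega>|lborel. u z * dderiv (1, 0) \<phi> z) =
        (LINT z:{0<..<T} \<times> \<Omega>|lborel. u z * (\<Sum>b\<in>Basis. dderiv (0, b) (dderiv (0, b) \<phi>) z)))"

text \<open>
  The initial condition: the representative \<open>w\<close> of \<open>u\<close> in \<open>C([0,T], Hm1 \<Omega>)\<close> has the value \<open>u0\<close> at
  \<open>t = 0\<close>.
\<close>

definition initial_value ::
    "real \<Rightarrow> 'a::euclidean_space set \<Rightarrow> (real \<times> 'a \<Rightarrow> complex) \<Rightarrow> ('a \<Rightarrow> complex) \<Rightarrow> bool" where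
  "initial_value T \<Omega> u u0 \<longleftrightarrow>
     (\<exists>w. (\<forall>t\<in>{0..T}. w t \<in> Hm1 \<Omega>) \<and>
        (\<forall>t\<in>{0..T}. ((\<lambda>s. Hm1_norm \<Omega> (\<lambda>\<phi>. w s \<phi> - w t \<phi>)) \<longlongrightarrow> 0) (at t within {0..T})) \<and>
        (AE t in lborel. t \<in> {0<..<T} \<longrightarrow>
           (\<forall>\<phi>. test_function \<Omega> \<phi> \<longrightarrow> w t \<phi> = (LINT x:\<Omega>|lborel. u (t, x) * \<phi> x))) \<and>
        (\<forall>\<phi>. test_function \<Omega> \<phi> \<longrightarrow> w 0 \<phi> = (LINT x:\<Omega>|lborel. u0 x * \<phi> x)))"

end

theory Submission
  imports Defs "HOL-Complex_Analysis.Complex_Analysis" "HOL-Probability.Probability"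
begin

text \<open>
  Only the interior of \<open>\<Omega>\<close> matters. Fix a point \<open>x\<^sub>0\<close> of \<open>\<Omega>\<close> and multiply \<open>u\<close> by a cutoff function that is 1 on
  a ball around \<open>x\<^sub>0\<close> whose radius is close to the distance \<open>D\<close> of \<open>x\<^sub>0\<close> to the boundary. By Duhamel's formula,
  near \<open>x\<^sub>0\<close> the solution is the convolution of the heat kernel with the localised initial data plus a term in which
  \<open>u\<close> is integrated against the heat kernel and its gradient over the region where the cutoff is not constant.
  For \<open>z = x + \<i>y\<close> and \<open>\<xi>\<close> in that region the real part of \<open>(z - \<xi>)\<^sup>2\<close> is bounded below by a positive constant if
  \<open>x\<close> is close to \<open>x\<^sub>0\<close> and \<open>|y| < a < D\<close>, so the second term extends holomorphically to such \<open>z\<close> and tends to 0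
  uniformly as \<open>t\<close> tends to 0. In the first term the domain of integration is shifted into the complex domain,
  through the point \<open>z\<close>, in such a way that the kernel is again dominated by a real Gaussian centred at \<open>z\<close>; hence it
  converges to the value of the holomorphic initial data at \<open>z\<close>. The local extensions agree by the identity theorem.
\<close>

section \<open>Smooth functions\<close>

text \<open>At a point \<open>z = x + \<i> \<eta>\<close> the modulus of the kernel carries the
  factor exp(|\<eta>|^2 / 4t), so absolute values under a real integral are useless near
  \<open>x\<close>. The shifted domain of integration meets two opposed demands: its height must
  descend with slope less than 1, for the Gaussian bound, and yet be back at 0 before |Re z - x0| +
  |Im z| leaves the set where the data are holomorphic and before the cutoff, which is not
  holomorphic, starts to vary. The room for both comes from \<open>a < D\<close>; the unit of all
  radii is \<open>\<nu> = (D - a) / 8\<close>. A second obstacle is that \<open>u\<close> is only a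
  class of functions and attains \<open>u0\<close> only in a negative norm. The equation is
  therefore first integrated in time, which gives an identity valid for almost every time and all
  spatial test functions at once. Evaluating the kernel \<open>\<epsilon>\<close> later keeps it an
  admissible test function, and letting \<open>\<epsilon>\<close> tend to 0 recovers
  \<open>u\<close> almost everywhere.\<close>

lemma dderiv_eq: "(f has_derivative D) (at x) \<Longrightarrow> dderiv b f x = D b"
  unfolding dderiv_def using frechet_derivative_at by metis

lemma dderiv_works: "f differentiable (at x) \<Longrightarrow> (f has_derivative (\<lambda>b. dderiv b f x)) (at x)"
  unfolding dderiv_def using frechet_derivative_works by fastforce

lemma Ck_imp_continuous: "Ck k f \<Longrightarrow> continuous_on UNIV f"
  by (cases k) (auto simp: continuous_on_eq_continuous_at differentiable_imp_continuous_within)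

lemma Ck_SucD: "Ck (Suc k) f \<Longrightarrow> Ck k f"
proof (induction k arbitrary: f)
  case 0
  then show ?case using Ck_imp_continuous by (metis Ck.simps(1))
next
  case (Suc k)
  then show ?case by (metis Ck.simps(2))
qed

lemma Ck_const: "Ck k (\<lambda>x. c)"
proof (induction k arbitrary: c)
  case (Suc k)
  have "dderiv b (\<lambda>x::'a. c) = (\<lambda>x. 0)" for b
    by (rule ext) (rule dderiv_eq[OF has_derivative_const])
  with Suc show ?case by simp
qed simp

lemma Ck_add: "Ck k f \<Longrightarrow> Ck k g \<Longrightarrow> Ck k (\<lambda>x. f x + g x)"
proof (induction k arbitrary: f g)
  case (Suc k)
  have "dderiv b (\<lambda>x. f x + g x) = (\<lambda>x. dderiv b f x + dderiv b g x)" for b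
    using Suc.prems by (intro ext dderiv_eq has_derivative_add dderiv_works) auto
  with Suc show ?case by auto
qed (auto intro: continuous_intros)

lemma Ck_mult: "Ck k f \<Longrightarrow> Ck k g \<Longrightarrow> Ck k (\<lambda>x. f x * g x)"
proof (induction k arbitrary: f g)
  case (Suc k)
  have "dderiv b (\<lambda>x. f x * g x) = (\<lambda>x. f x * dderiv b g x + dderiv b f x * g x)" for b
    using Suc.prems by (intro ext dderiv_eq has_derivative_mult dderiv_works) auto
  moreover have "Ck k f" "Ck k g" using Suc.prems Ck_SucD by blast+
  ultimately show ?case using Suc by (auto intro!: Ck_add)
qed (auto intro: continuous_intros)

lemma Ck_inverse:
  assumes "\<And>x. f x \<noteq> 0"
  shows "Ck k f \<Longrightarrow> Ck k (\<lambda>x. inverse (f x))"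
proof (induction k)
  case (Suc k)
  have d: "((\<lambda>x. inverse (f x)) has_derivative
      (\<lambda>b. - (inverse (f x) * dderiv b f x * inverse (f x)))) (at x)" for x
    using Suc.prems assms by (intro Deriv.has_derivative_inverse dderiv_works) auto
  have "dderiv b (\<lambda>x. inverse (f x)) = (\<lambda>x. - 1 * (inverse (f x) * dderiv b f x * inverse (f x)))" for b
    using dderiv_eq[OF d] by auto
  moreover have "Ck k (\<lambda>x. inverse (f x))" using Suc Ck_SucD by blast
  ultimately have "Ck k (dderiv b (\<lambda>x. inverse (f x)))" if "b \<in> Basis" for b
    using Suc.prems that by (simp only: Ck.simps) (intro Ck_mult Ck_const, auto)
  then show ?case using d by (auto simp: differentiable_def)
qed (use assms in \<open>auto intro: continuous_intros\<close>)

text \<open>The chain rule replaces the outer function by its derivative and keeps the inner one, so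
  the induction generalises over \<open>g\<close> only. The real-valued \<open>p\<close> enters
  through its complex copy because \<open>Ck\<close> is about complex-valued functions.\<close>

lemma Ck_compose_real:
  fixes g :: "real \<Rightarrow> complex" and p :: "'a::euclidean_space \<Rightarrow> real"
  shows "Ck k g \<Longrightarrow> Ck k (\<lambda>x. complex_of_real (p x)) \<Longrightarrow> Ck k (\<lambda>x. g (p x))"
proof (induction k arbitrary: g)
  case 0
  have "continuous_on UNIV (\<lambda>x. Re (complex_of_real (p x)))"
    using 0 by (intro continuous_intros) auto
  then have "continuous_on UNIV p" by simp
  then show ?case using 0
    by (auto intro: continuous_on_compose2[of UNIV g])
next
  case (Suc k)
  have p: "(p has_derivative (\<lambda>b. Re (dderiv b (\<lambda>x. complex_of_real (p x)) x))) (at x)" for x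
    using Suc.prems(2) has_derivative_Re[OF dderiv_works, of "\<lambda>x. complex_of_real (p x)"] by auto
  have eq: "complex_of_real (Re (dderiv b (\<lambda>x. complex_of_real (p x)) x)) = dderiv b (\<lambda>x. complex_of_real (p x)) x" for b x
    using dderiv_eq[OF has_derivative_of_real[OF p]] by metis
  have d: "((\<lambda>x. g (p x)) has_derivative
      (\<lambda>b. dderiv (Re (dderiv b (\<lambda>x. complex_of_real (p x)) x)) g (p x))) (at x)" for x
    using has_derivative_compose[OF p dderiv_works, of g] Suc.prems(1) by simp
  have lin: "dderiv r g y = of_real r * dderiv 1 g y" for r y
  proof -
    have "linear (\<lambda>b. dderiv b g y)"
      using Suc.prems(1) by (intro has_derivative_linear[OF dderiv_works]) auto
    from linear_scale[OF this, of r 1] show ?thesis by (simp add: scaleR_conv_of_real)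
  qed
  have "dderiv b (\<lambda>x. g (p x)) = (\<lambda>x. dderiv b (\<lambda>x. complex_of_real (p x)) x * dderiv 1 g (p x))" for b
    by (rule ext) (subst dderiv_eq[OF d], subst lin, simp only: eq)
  moreover have "Ck k (\<lambda>x. dderiv 1 g (p x))"
  proof (rule Suc.IH)
    show "Ck k (dderiv 1 g)" using Suc.prems(1) by simp
    show "Ck k (\<lambda>x. complex_of_real (p x))" using Suc.prems(2) by (rule Ck_SucD)
  qed
  ultimately show ?case using Suc.prems d by (auto simp: differentiable_def intro!: Ck_mult)
qed

lemma Ck_snd:
  fixes g :: "'b::euclidean_space \<Rightarrow> complex"
  shows "Ck k g \<Longrightarrow> Ck k (\<lambda>z::'a::euclidean_space \<times> 'b. g (snd z))"
proof (induction k arbitrary: g)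
  case 0
  then show ?case by (auto intro!: continuous_intros continuous_on_compose2[of UNIV g])
next
  case (Suc k)
  have d: "((\<lambda>z::'a\<times>'b. g (snd z)) has_derivative (\<lambda>b. dderiv (snd b) g (snd z))) (at z)" for z
    by (rule has_derivative_compose[OF has_derivative_snd[OF has_derivative_ident] dderiv_works])
      (use Suc.prems in auto)
  have e: "dderiv b (\<lambda>z::'a\<times>'b. g (snd z)) = (\<lambda>z. dderiv (snd b) g (snd z))" for b
    by (rule ext) (rule dderiv_eq[OF d])
  \<comment> \<open>The basis vectors of the first factor have second component 0; the derivative in
    such a direction must be recognised as the zero function.\<close>
  have z: "dderiv 0 g y = 0" for y
    by (rule linear_0[OF has_derivative_linear[OF dderiv_works]]) (use Suc.prems in auto)
  show ?case using Suc d by (auto simp: differentiable_def e Basis_prod_def z Ck_const)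
qed

lemma Ck_fst:
  fixes g :: "'a::euclidean_space \<Rightarrow> complex"
  shows "Ck k g \<Longrightarrow> Ck k (\<lambda>z::'a \<times> 'b::euclidean_space. g (fst z))"
proof (induction k arbitrary: g)
  case 0
  then show ?case by (auto intro!: continuous_intros continuous_on_compose2[of UNIV g])
next
  case (Suc k)
  have d: "((\<lambda>z::'a\<times>'b. g (fst z)) has_derivative (\<lambda>b. dderiv (fst b) g (fst z))) (at z)" for z
    by (rule has_derivative_compose[OF has_derivative_fst[OF has_derivative_ident] dderiv_works])
      (use Suc.prems in auto)
  have e: "dderiv b (\<lambda>z::'a\<times>'b. g (fst z)) = (\<lambda>z. dderiv (fst b) g (fst z))" for b
    by (rule ext) (rule dderiv_eq[OF d])
  have z: "dderiv 0 g y = 0" for y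
    by (rule linear_0[OF has_derivative_linear[OF dderiv_works]]) (use Suc.prems in auto)
  show ?case using Suc d by (auto simp: differentiable_def e Basis_prod_def z Ck_const)
qed

definition smooth :: "('a::euclidean_space \<Rightarrow> complex) \<Rightarrow> bool" where
  "smooth f \<longleftrightarrow> (\<forall>k. Ck k f)"

lemma smooth_const: "smooth (\<lambda>x. c)"
  and smooth_add: "smooth f \<Longrightarrow> smooth g \<Longrightarrow> smooth (\<lambda>x. f x + g x)"
  and smooth_mult: "smooth f \<Longrightarrow> smooth g \<Longrightarrow> smooth (\<lambda>x. f x * g x)"
  and smooth_compose_real: "smooth h \<Longrightarrow> smooth (\<lambda>x. complex_of_real (p x)) \<Longrightarrow> smooth (\<lambda>x. h (p x))"
  and smooth_fst: "smooth f' \<Longrightarrow> smooth (\<lambda>z. f' (fst z))"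
  and smooth_snd: "smooth f' \<Longrightarrow> smooth (\<lambda>z. f' (snd z))"
  by (auto simp: smooth_def Ck_const Ck_add Ck_mult Ck_compose_real Ck_fst Ck_snd)

lemma smooth_inverse: "smooth f \<Longrightarrow> (\<And>x. f x \<noteq> 0) \<Longrightarrow> smooth (\<lambda>x. inverse (f x))"
  by (simp add: smooth_def Ck_inverse)

lemma smooth_imp_continuous: "smooth f \<Longrightarrow> continuous_on S f"
  using Ck_imp_continuous continuous_on_subset unfolding smooth_def by blast

lemma smooth_has_derivative: "smooth f \<Longrightarrow> (f has_derivative (\<lambda>b. dderiv b f x)) (at x)"
  using dderiv_works unfolding smooth_def by (metis Ck.simps(2))

lemma smooth_dderiv: "smooth f \<Longrightarrow> b \<in> Basis \<Longrightarrow> smooth (dderiv b f)"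
  unfolding smooth_def by (metis Ck.simps(2))

lemma smooth_sum: "(\<And>i. i \<in> A \<Longrightarrow> smooth (f i)) \<Longrightarrow> smooth (\<lambda>x. \<Sum>i\<in>A. f i x)"
proof (induction A rule: infinite_finite_induct)
  case (insert x F)
  then show ?case by (auto intro!: smooth_add)
qed (auto intro: smooth_const)

text \<open>Membership in a family closed under all partial derivatives replaces the computation of
  higher derivatives; it is applied to the multiples of a fixed exponential.\<close>

lemma smooth_coinduct:
  assumes "f \<in> S" and "\<And>f x. f \<in> S \<Longrightarrow> f differentiable (at x)"
    and "\<And>f b. f \<in> S \<Longrightarrow> b \<in> Basis \<Longrightarrow> dderiv b f \<in> S"
  shows "smooth f"
proof -
  have "Ck k f" if "f \<in> S" for k f using that
    by (induction k arbitrary: f)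
       (auto simp: assms continuous_on_eq_continuous_at differentiable_imp_continuous_within)
  then show ?thesis using assms(1) by (simp add: smooth_def)
qed

lemma smooth_inner: "smooth (\<lambda>x. complex_of_real (x \<bullet> c))"
proof -
  have "Ck (Suc k) (\<lambda>x. complex_of_real (x \<bullet> c))" for k
  proof -
    have d: "((\<lambda>x. complex_of_real (x \<bullet> c)) has_derivative (\<lambda>b. complex_of_real (b \<bullet> c))) (at x)" for x
      by (auto intro!: derivative_eq_intros)
    have "dderiv b (\<lambda>x. complex_of_real (x \<bullet> c)) = (\<lambda>x. complex_of_real (b \<bullet> c))" for b
      using dderiv_eq[OF d] by auto
    then show ?thesis using d by (auto simp: differentiable_def Ck_const)
  qed
  then show ?thesis unfolding smooth_def using Ck_SucD by blast
qed

lemma smooth_diff: "smooth f \<Longrightarrow> smooth g \<Longrightarrow> smooth (\<lambda>x. f x - g x)"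
  using smooth_add[of f "\<lambda>x. (-1) * g x"] smooth_mult[OF smooth_const[of "-1"], of g] by simp

lemma smooth_norm_power2: "smooth (\<lambda>x. complex_of_real ((norm (x - c))\<^sup>2))"
proof -
  have "complex_of_real ((norm (x - c))\<^sup>2)
      = (\<Sum>b\<in>Basis. (complex_of_real (x \<bullet> b) - complex_of_real (c \<bullet> b)) * (complex_of_real (x \<bullet> b) - complex_of_real (c \<bullet> b)))" for x
    by (subst power2_norm_eq_inner, subst euclidean_inner) (simp add: inner_diff_left)
  then show ?thesis
    by (simp only:) (intro smooth_sum smooth_mult smooth_diff smooth_inner smooth_const)
qed

section \<open>Smooth steps and bump functions\<close>

definition flat_exp :: "nat \<Rightarrow> real \<Rightarrow> complex" where
  "flat_exp j x = (if x > 0 then of_real (exp (- inverse x) * inverse x ^ j) else 0)"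

lemma flat_exp_tendsto_0: "((\<lambda>x. exp (- inverse x) * inverse x ^ j) \<longlongrightarrow> 0) (at_right (0::real))"
proof -
  have "((\<lambda>x. x ^ j / exp x) \<longlongrightarrow> 0) (at_top :: real filter)"
    by (rule tendsto_power_div_exp_0)
  from filterlim_compose[OF this filterlim_inverse_at_top_right]
  show ?thesis by (simp add: exp_minus field_simps)
qed

text \<open>The factors \<open>inverse x ^ j\<close> close the family under differentiation, which
  reduces smoothness to a simple induction. At 0 the left difference quotients vanish and the right
  ones are values of \<open>flat_exp (j + 1)\<close>, which tend to 0.\<close>

lemma flat_exp_has_derivative:
  "(flat_exp j has_vector_derivative (flat_exp (j + 2) x - of_nat j * flat_exp (j + 1) x)) (at x)"
proof (cases x "0::real" rule: linorder_cases)
  case less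
  have "((\<lambda>x. 0) has_vector_derivative 0) (at x)" by simp
  then have "(flat_exp j has_vector_derivative 0) (at x)"
    by (rule has_vector_derivative_transform_within_open[of _ _ _ "{..<0}"])
       (use less in \<open>auto simp: flat_exp_def\<close>)
  then show ?thesis using less by (simp add: flat_exp_def)
next
  case greater
  have "((\<lambda>x. exp (- inverse x) * inverse x ^ j) has_real_derivative
      (exp (- inverse x) * inverse x ^ (j + 2) - of_nat j * (exp (- inverse x) * inverse x ^ (j + 1)))) (at x)"
  proof (cases j)
    case 0
    then show ?thesis using greater
      by (auto intro!: derivative_eq_intros simp: field_simps power2_eq_square)
  next
    case (Suc i)
    have "((\<lambda>x. exp (- inverse x) * inverse x ^ Suc i) has_real_derivative
      (exp (- inverse x) * (inverse x ^ 2) * inverse x ^ Suc i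
        + exp (- inverse x) * (of_nat (Suc i) * inverse x ^ i * (- (inverse x ^ 2))))) (at x)"
    proof -
      have "((\<lambda>x. exp (- inverse x)) has_real_derivative exp (- inverse x) * (inverse x)\<^sup>2) (at x)"
        using greater by (auto intro!: derivative_eq_intros simp: power2_eq_square)
      moreover have "((\<lambda>x. inverse x ^ Suc i) has_real_derivative
          of_nat (Suc i) * (- (inverse x ^ 2) * inverse x ^ i)) (at x)"
        using DERIV_power_Suc[of inverse "- (inverse x ^ 2)" x UNIV i] DERIV_inverse[of x UNIV] greater
        by (auto simp: power2_eq_square mult_ac)
      ultimately show ?thesis
        by (rule DERIV_cong[OF DERIV_mult]) (simp add: mult_ac)
    qed
    then show ?thesis unfolding Suc
      by (rule DERIV_cong) (simp add: algebra_simps power2_eq_square)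
  qed
  then have "((\<lambda>x. complex_of_real (exp (- inverse x) * inverse x ^ j)) has_vector_derivative
      of_real (exp (- inverse x) * inverse x ^ (j + 2) - of_nat j * (exp (- inverse x) * inverse x ^ (j + 1)))) (at x)"
    by (rule has_vector_derivative_of_real[unfolded has_real_derivative_iff_has_vector_derivative[symmetric]])
  then have "(flat_exp j has_vector_derivative
      of_real (exp (- inverse x) * inverse x ^ (j + 2) - of_nat j * (exp (- inverse x) * inverse x ^ (j + 1)))) (at x)"
    by (rule has_vector_derivative_transform_within_open[of _ _ _ "{0<..}"])
       (use greater in \<open>auto simp: flat_exp_def\<close>)
  then show ?thesis using greater by (simp add: flat_exp_def)
next
  case equal
  have "((\<lambda>y. norm (flat_exp j y - flat_exp j 0) / norm (y - 0)) \<longlongrightarrow> 0) (at 0)"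
  proof (rule filterlim_split_at_real)
    show "((\<lambda>y. norm (flat_exp j y - flat_exp j 0) / norm (y - 0)) \<longlongrightarrow> 0) (at_left 0)"
      by (rule tendsto_eventually) (auto simp: flat_exp_def eventually_at_filter)
    show "((\<lambda>y. norm (flat_exp j y - flat_exp j 0) / norm (y - 0)) \<longlongrightarrow> 0) (at_right 0)"
      by (rule Lim_transform_eventually[OF flat_exp_tendsto_0[of "j + 1"]])
         (auto simp: flat_exp_def eventually_at_filter norm_mult norm_power norm_divide field_simps simp del: of_real_mult)
  qed
  then have "(flat_exp j has_vector_derivative 0) (at 0)"
    by (simp add: has_vector_derivative_def has_derivative_at2 bounded_linear_zero
        has_derivative_iff_norm divide_inverse mult.commute)
  then show ?thesis using equal by (simp add: flat_exp_def)
qed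

lemma smooth_flat_exp: "smooth (flat_exp j)"
proof -
  have "Ck k (flat_exp j)" for k
  proof (induction k arbitrary: j)
    case 0
    then show ?case
      using flat_exp_has_derivative by (auto simp: continuous_on_eq_continuous_at intro: has_vector_derivative_continuous)
  next
    case (Suc k)
    have "dderiv 1 (flat_exp j) = (\<lambda>x. flat_exp (j + 2) x + (- of_nat j) * flat_exp (j + 1) x)"
      using dderiv_eq[OF flat_exp_has_derivative[unfolded has_vector_derivative_def]] by auto
    moreover have "Ck k (\<lambda>x. flat_exp (j + 2) x + (- of_nat j) * flat_exp (j + 1) x)"
      by (intro Ck_add Ck_mult Ck_const Suc)
    ultimately show ?case using flat_exp_has_derivative[of j]
      by (auto simp: differentiable_def has_vector_derivative_def)
  qed
  then show ?thesis by (simp add: smooth_def)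
qed

definition smooth_step :: "real \<Rightarrow> complex" where
  "smooth_step x = flat_exp 0 x * inverse (flat_exp 0 x + flat_exp 0 (1 - x))"

text \<open>The numbers \<open>x\<close> and \<open>1 - x\<close> are never both nonpositive, so one
  of the two nonnegative summands is positive.\<close>

lemma smooth_step_pos: "flat_exp 0 x + flat_exp 0 (1 - x) \<noteq> 0"
proof -
  have "exp a + exp b \<noteq> (0::real)" for a b
    using exp_gt_zero[of a] exp_gt_zero[of b] by linarith
  then show ?thesis unfolding flat_exp_def by (auto simp flip: of_real_add)
qed

lemma smooth_smooth_step: "smooth smooth_step"
proof -
  have "smooth (\<lambda>x::real. complex_of_real (1 - x))"
    using smooth_diff[OF smooth_const[of 1] smooth_inner[of "1::real"]] by simp
  then show ?thesis unfolding smooth_step_def[abs_def]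
    by (intro smooth_mult smooth_inverse smooth_add smooth_flat_exp smooth_compose_real[of "flat_exp 0"] smooth_step_pos)
qed

lemma smooth_step_0: "x \<le> 0 \<Longrightarrow> smooth_step x = 0"
  and smooth_step_1: "x \<ge> 1 \<Longrightarrow> smooth_step x = 1"
  by (auto simp: smooth_step_def flat_exp_def)

text \<open>The squared norm, unlike the norm, is smooth at the centre. For
  \<open>0 \<le> r < R\<close> the quotient is at least 1 inside radius \<open>r\<close> and at most
  0 outside radius \<open>R\<close>.\<close>

definition bump :: "'a::euclidean_space \<Rightarrow> real \<Rightarrow> real \<Rightarrow> 'a \<Rightarrow> complex" where
  "bump c r R y = smooth_step ((R\<^sup>2 - (norm (y - c))\<^sup>2) / (R\<^sup>2 - r\<^sup>2))"

lemma smooth_bump: "smooth (bump c r R)"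
proof -
  have "smooth (\<lambda>y. (of_real (R\<^sup>2) - of_real ((norm (y - c))\<^sup>2)) * complex_of_real (inverse (R\<^sup>2 - r\<^sup>2)))"
    by (intro smooth_mult smooth_diff smooth_const smooth_norm_power2)
  then have "smooth (\<lambda>y. complex_of_real ((R\<^sup>2 - (norm (y - c))\<^sup>2) / (R\<^sup>2 - r\<^sup>2)))"
    by (simp only: of_real_diff of_real_mult divide_inverse)
  then show ?thesis unfolding bump_def[abs_def]
    by (rule smooth_compose_real[OF smooth_smooth_step])
qed

lemma bump_eq_1:
  assumes "0 \<le> r" "r < R" "norm (y - c) \<le> r"
  shows "bump c r R y = 1"
proof -
  have "(norm (y - c))\<^sup>2 \<le> r\<^sup>2" "r\<^sup>2 < R\<^sup>2"
    using assms by (auto intro: power_mono power_strict_mono)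
  then show ?thesis unfolding bump_def by (intro smooth_step_1) (subst le_divide_eq_1_pos; simp)
qed

lemma bump_eq_0:
  assumes "0 \<le> r" "r < R" "R \<le> norm (y - c)"
  shows "bump c r R y = 0"
proof -
  have "R\<^sup>2 \<le> (norm (y - c))\<^sup>2" "r\<^sup>2 < R\<^sup>2"
    using assms by (auto intro: power_mono power_strict_mono)
  then show ?thesis unfolding bump_def by (intro smooth_step_0) (auto intro!: divide_nonpos_nonneg)
qed

lemma test_function_bump:
  assumes "0 \<le> r" "r < R" "cball c R \<subseteq> \<Omega>"
  shows "test_function \<Omega> (bump c r R)"
proof -
  have "{x. bump c r R x \<noteq> 0} \<subseteq> cball c R"
    using bump_eq_0[OF assms(1,2)] by (force simp: dist_norm norm_minus_commute)
  then have cl: "closure {x. bump c r R x \<noteq> 0} \<subseteq> cball c R"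
    by (rule closure_minimal) simp
  then have "compact (closure {x. bump c r R x \<noteq> 0})"
    by (metis bounded_cball bounded_subset closed_closure compact_eq_bounded_closed)
  then show ?thesis using cl assms(3) smooth_bump unfolding test_function_def smooth_def by blast
qed

section \<open>Integration\<close>

lemma integrable_mult_bounded:
  fixes f g :: "'a \<Rightarrow> complex"
  assumes "integrable M f" "g \<in> borel_measurable M" "AE x in M. cmod (g x) \<le> B"
  shows "integrable M (\<lambda>x. f x * g x)"
proof (rule Bochner_Integration.integrable_bound)
  show "integrable M (\<lambda>x. B *\<^sub>R f x)" using assms by auto
  show "(\<lambda>x. f x * g x) \<in> borel_measurable M" using assms by auto
  show "AE x in M. norm (f x * g x) \<le> norm (B *\<^sub>R f x)"
    using assms(3)
  proof (rule AE_mp, intro AE_I2 impI)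
    fix x assume "cmod (g x) \<le> B"
    then show "norm (f x * g x) \<le> norm (B *\<^sub>R f x)"
      using mult_right_mono[of "cmod (g x)" "\<bar>B\<bar>" "cmod (f x)"] by (simp add: norm_mult mult.commute)
  qed
qed

text \<open>Dominated convergence with majorant \<open>B * cmod (f x)\<close>, in the form that
  recurs below: one integrable density against uniformly bounded kernels.\<close>

lemma tendsto_integral_mult_bounded:
  fixes f :: "'a \<Rightarrow> complex" and k :: "nat \<Rightarrow> 'a \<Rightarrow> complex"
  assumes f: "integrable M f" and k: "\<And>n. k n \<in> borel_measurable M" and k': "k' \<in> borel_measurable M"
    and B: "\<And>n. AE x in M. cmod (k n x) \<le> B"
    and lim: "AE x in M. (\<lambda>n. k n x) \<longlonglongrightarrow> k' x"
  shows "(\<lambda>n. \<integral>x. f x * k n x \<partial>M) \<longlonglongrightarrow> (\<integral>x. f x * k' x \<partial>M)"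
proof (rule integral_dominated_convergence[where w = "\<lambda>x. B * cmod (f x)"])
  have [measurable]: "f \<in> borel_measurable M" using f by auto
  note [measurable] = k k'
  show "(\<lambda>x. f x * k' x) \<in> borel_measurable M" "(\<lambda>x. f x * k i x) \<in> borel_measurable M" for i
    by measurable
  show "integrable M (\<lambda>x. B * cmod (f x))" using f by auto
  show "AE x in M. (\<lambda>n. f x * k n x) \<longlonglongrightarrow> f x * k' x"
    using lim by (auto intro!: tendsto_intros)
  fix n
  show "AE x in M. norm (f x * k n x) \<le> B * cmod (f x)"
    using B[of n] by (rule AE_mp) (auto intro!: AE_I2 mult_right_mono simp: norm_mult mult.commute[of "cmod (f _)"])
qed

lemma tendsto_integral_mult_bounded_at:
  fixes f :: "'a \<Rightarrow> complex" and k :: "'b::{first_countable_topology,t2_space} \<Rightarrow> 'a \<Rightarrow> complex"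
  assumes f: "integrable M f" and k: "\<And>p. p \<in> S \<Longrightarrow> k p \<in> borel_measurable M" and k': "k' \<in> borel_measurable M"
    and B: "\<And>p. p \<in> S \<Longrightarrow> AE x in M. cmod (k p x) \<le> B"
    and lim: "AE x in M. ((\<lambda>p. k p x) \<longlongrightarrow> k' x) (at q within S)"
  shows "((\<lambda>p. \<integral>x. f x * k p x \<partial>M) \<longlongrightarrow> (\<integral>x. f x * k' x \<partial>M)) (at q within S)"
  unfolding tendsto_at_iff_sequentially
proof (intro allI impI)
  fix X assume X: "\<forall>i. X i \<in> S - {q}" "X \<longlonglongrightarrow> q"
  show "((\<lambda>p. \<integral>x. f x * k p x \<partial>M) \<circ> X) \<longlonglongrightarrow> (\<integral>x. f x * k' x \<partial>M)"
    unfolding o_def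
  proof (rule tendsto_integral_mult_bounded[OF f _ k', of _ B])
    show "k (X n) \<in> borel_measurable M" "AE x in M. cmod (k (X n) x) \<le> B" for n
      using k B X by auto
    show "AE x in M. (\<lambda>n. k (X n) x) \<longlonglongrightarrow> k' x"
      using lim
    proof (rule AE_mp, intro AE_I2 impI)
      fix x assume "((\<lambda>p. k p x) \<longlongrightarrow> k' x) (at q within S)"
      then show "(\<lambda>n. k (X n) x) \<longlonglongrightarrow> k' x"
        using X unfolding tendsto_at_iff_sequentially by (auto simp: o_def)
    qed
  qed
qed

lemma continuous_on_integral_mult:
  fixes f :: "'a \<Rightarrow> complex" and k :: "'b::{first_countable_topology,t2_space} \<Rightarrow> 'a \<Rightarrow> complex"
  assumes "integrable M f" "\<And>p. p \<in> S \<Longrightarrow> k p \<in> borel_measurable M"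
    and "\<And>p. p \<in> S \<Longrightarrow> AE x in M. cmod (k p x) \<le> B"
    and "\<And>q. q \<in> S \<Longrightarrow> AE x in M. ((\<lambda>p. k p x) \<longlongrightarrow> k q x) (at q within S)"
  shows "continuous_on S (\<lambda>p. \<integral>x. f x * k p x \<partial>M)"
  unfolding continuous_on_def using assms by (blast intro: tendsto_integral_mult_bounded_at)

lemma integrable_continuous_compact_support:
  fixes f :: "'a::euclidean_space \<Rightarrow> complex"
  assumes "continuous_on UNIV f" "\<And>y. norm y > r \<Longrightarrow> f y = 0"
  shows "integrable lborel f"
proof -
  have "integrable lborel (\<lambda>x. indicator (cball 0 r) x *\<^sub>R f x)"
    by (rule borel_integrable_compact) (use assms in \<open>auto intro: continuous_on_subset\<close>)
  moreover have "(\<lambda>x. indicator (cball 0 r) x *\<^sub>R f x) = f"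
    using assms(2) by (auto simp: indicator_def fun_eq_iff)
  ultimately show ?thesis by simp
qed

lemma bounded_continuous_compact_support:
  fixes f :: "'a::euclidean_space \<Rightarrow> complex"
  assumes "continuous_on UNIV f" "\<And>y. norm y > r \<Longrightarrow> f y = 0"
  obtains B where "B \<ge> 0" "\<And>y. cmod (f y) \<le> B"
proof -
  have "compact (f ` cball 0 r)"
    by (rule compact_continuous_image) (use assms in \<open>auto intro: continuous_on_subset\<close>)
  then obtain B where B: "\<forall>w\<in>f ` cball 0 r. norm w \<le> B"
    using compact_imp_bounded bounded_iff by blast
  have "cmod (f y) \<le> max B 0" for y
    using B assms(2)[of y] by (cases "norm y \<le> r") (auto simp: le_max_iff_disj)
  then show ?thesis using that[of "max B 0"] by auto
qed

lemma integral_lborel_translate: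
  fixes f :: "'a::euclidean_space \<Rightarrow> complex" and c :: 'a
  assumes "f \<in> borel_measurable borel"
  shows "(\<integral>y. f (c + y) \<partial>lborel) = (\<integral>y. f y \<partial>lborel)"
  by (subst (2) lborel_distr_plus[symmetric, of c]) (simp add: integral_distr assms)

lemma has_vector_derivative_imp_tendsto:
  fixes f :: "real \<Rightarrow> 'a::real_normed_vector"
  assumes "(f has_vector_derivative D) (at 0)"
  shows "((\<lambda>h. inverse h *\<^sub>R (f h - f 0)) \<longlongrightarrow> D) (at 0)"
proof (rule LIM_zero_cancel, rule tendsto_norm_zero_cancel)
  have "((\<lambda>h. norm (f h - f 0 - h *\<^sub>R D) / norm h) \<longlongrightarrow> 0) (at 0)"
    using assms unfolding has_vector_derivative_def has_derivative_at by simp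
  then show "((\<lambda>h. norm (inverse h *\<^sub>R (f h - f 0) - D)) \<longlongrightarrow> 0) (at 0)"
  proof (rule Lim_transform_eventually)
    show "\<forall>\<^sub>F h in at 0. norm (f h - f 0 - h *\<^sub>R D) / norm h = norm (inverse h *\<^sub>R (f h - f 0) - D)"
    proof (subst eventually_at_filter, intro always_eventually allI impI)
      fix h :: real assume "h \<noteq> 0"
      then have "inverse h *\<^sub>R (f h - f 0) - D = inverse h *\<^sub>R (f h - f 0 - h *\<^sub>R D)"
        by (simp add: scaleR_diff_right)
      then show "norm (f h - f 0 - h *\<^sub>R D) / norm h = norm (inverse h *\<^sub>R (f h - f 0) - D)"
        by (simp add: divide_inverse mult.commute)
    qed
  qed
qed

text \<open>The difference quotients of \<open>\<Psi>\<close> have integral zero by translation invariance.\<close>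

lemma integral_directional_derivative_eq_0:
  fixes \<Psi> D :: "'a::euclidean_space \<Rightarrow> complex"
  assumes "continuous_on UNIV \<Psi>" "continuous_on UNIV D"
    and deriv: "\<And>y. ((\<lambda>s. \<Psi> (y + s *\<^sub>R \<eta>)) has_vector_derivative D y) (at 0)"
    and supp: "\<And>y. norm y > r \<Longrightarrow> \<Psi> y = 0"
  shows "integrable lborel D" "(\<integral>y. D y \<partial>lborel) = 0"
proof -
  have D0: "D y = 0" if "norm y > r" for y
  proof -
    have "open {s. norm (y + s *\<^sub>R \<eta>) > r}"
      by (intro open_Collect_less continuous_intros)
    moreover have "((\<lambda>s::real. 0) has_vector_derivative 0) (at 0)" by simp
    ultimately have "((\<lambda>s. \<Psi> (y + s *\<^sub>R \<eta>)) has_vector_derivative 0) (at 0)"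
      using has_vector_derivative_transform_within_open[of "\<lambda>s. 0" 0 0 "{s. norm (y + s *\<^sub>R \<eta>) > r}"
        "\<lambda>s. \<Psi> (y + s *\<^sub>R \<eta>)"] that supp by simp
    then show ?thesis using deriv vector_derivative_unique_at by blast
  qed
  then show int: "integrable lborel D"
    using assms(2) integrable_continuous_compact_support by blast
  obtain B where B: "B \<ge> 0" "\<And>y. cmod (D y) \<le> B"
    using bounded_continuous_compact_support[OF assms(2) D0] by metis
  have deriv': "((\<lambda>s. \<Psi> (y + s *\<^sub>R \<eta>)) has_vector_derivative D (y + t *\<^sub>R \<eta>)) (at t)" for y t
  proof -
    have "((\<lambda>s. \<Psi> (y + t *\<^sub>R \<eta> + s *\<^sub>R \<eta>)) \<circ> (\<lambda>s. s - t) has_vector_derivative 1 *\<^sub>R D (y + t *\<^sub>R \<eta>)) (at t)"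
      by (rule vector_diff_chain_at) (auto intro!: derivative_eq_intros deriv)
    then show ?thesis by (simp add: o_def algebra_simps)
  qed
  \<comment> \<open>A bounded derivative gives a Lipschitz bound along the direction
    \<open>\<eta>\<close>, hence a constant bound for the difference quotients.\<close>
  have lip: "cmod (\<Psi> (y + s *\<^sub>R \<eta>) - \<Psi> y) \<le> B * \<bar>s\<bar>" for y s
  proof -
    have "norm (\<Psi> (y + s *\<^sub>R \<eta>) - \<Psi> (y + 0 *\<^sub>R \<eta>)) \<le> B * norm (s - 0)"
    proof (rule differentiable_bound[of UNIV "\<lambda>s. \<Psi> (y + s *\<^sub>R \<eta>)" "\<lambda>t h. h *\<^sub>R D (y + t *\<^sub>R \<eta>)"])
      show "((\<lambda>s. \<Psi> (y + s *\<^sub>R \<eta>)) has_derivative (\<lambda>h. h *\<^sub>R D (y + t *\<^sub>R \<eta>))) (at t within UNIV)" for t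
        using deriv' by (simp add: has_vector_derivative_def)
      show "onorm (\<lambda>h. h *\<^sub>R D (y + t *\<^sub>R \<eta>)) \<le> B" for t
        by (rule onorm_bound) (use B in \<open>auto simp: mult.commute[of B] mult_left_mono\<close>)
    qed auto
    then show ?thesis by simp
  qed
  define f where "f n y = of_nat (Suc n) * (\<Psi> (inverse (of_nat (Suc n)) *\<^sub>R \<eta> + y) - \<Psi> y)" for n and y :: 'a
  have [measurable]: "\<Psi> \<in> borel_measurable borel" "D \<in> borel_measurable borel"
    using assms(1,2) by (auto intro: borel_measurable_continuous_onI)
  have i\<Psi>: "integrable lborel \<Psi>" using assms(1) supp integrable_continuous_compact_support by blast
  have i\<Psi>': "integrable lborel (\<lambda>y. \<Psi> (c + y))" for c :: 'a
  proof (rule integrable_continuous_compact_support[of _ "r + norm c"])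
    show "continuous_on UNIV (\<lambda>y. \<Psi> (c + y))"
      by (intro continuous_on_compose2[OF assms(1)] continuous_intros) auto
    fix y :: 'a assume "r + norm c < norm y"
    then have "norm (c + y) > r" using norm_triangle_ineq2[of y "- c"] by (simp add: add.commute)
    then show "\<Psi> (c + y) = 0" by (rule supp)
  qed
  have "(\<integral>y. f n y \<partial>lborel) = 0" for n
    unfolding f_def using i\<Psi> i\<Psi>'
    by (subst integral_mult_right_zero, subst Bochner_Integration.integral_diff) (auto simp: integral_lborel_translate)
  \<comment> \<open>The step lengths are at most 1, so every difference quotient vanishes outside
    the ball of radius \<open>r + norm \<eta>\<close>; this makes the constant bound an integrable
    majorant.\<close>
  moreover have "(\<lambda>n. (\<integral>y. f n y \<partial>lborel)) \<longlonglongrightarrow> (\<integral>y. D y \<partial>lborel)"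
  proof (rule integral_dominated_convergence[where w = "\<lambda>y. B * indicator (cball 0 (r + norm \<eta>)) y"])
    show "AE y in lborel. (\<lambda>n. f n y) \<longlonglongrightarrow> D y"
    proof (intro AE_I2)
      fix y
      from has_vector_derivative_imp_tendsto[OF deriv[of y]]
      have "((\<lambda>h. inverse h *\<^sub>R (\<Psi> (y + h *\<^sub>R \<eta>) - \<Psi> y)) \<longlongrightarrow> D y) (at 0)"
        by simp
      then have "(\<lambda>n. inverse (inverse (real (Suc n))) *\<^sub>R (\<Psi> (y + inverse (real (Suc n)) *\<^sub>R \<eta>) - \<Psi> y)) \<longlonglongrightarrow> D y"
        by (rule filterlim_compose)
           (auto simp: filterlim_at LIMSEQ_inverse_real_of_nat simp del: of_nat_Suc)
      then show "(\<lambda>n. f n y) \<longlonglongrightarrow> D y"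
        by (simp add: f_def scaleR_conv_of_real add.commute)
    qed
    show "AE y in lborel. norm (f n y) \<le> B * indicator (cball 0 (r + norm \<eta>)) y" for n
    proof (intro AE_I2)
      fix y
      let ?s = "inverse (real (Suc n))"
      show "norm (f n y) \<le> B * indicator (cball 0 (r + norm \<eta>)) y"
      proof (cases "norm y \<le> r + norm \<eta>")
        case True
        have "norm (f n y) = real (Suc n) * cmod (\<Psi> (y + ?s *\<^sub>R \<eta>) - \<Psi> y)"
          unfolding f_def norm_mult by (simp only: norm_of_nat add.commute)
        also have "\<dots> \<le> real (Suc n) * (B * \<bar>?s\<bar>)"
          by (intro mult_left_mono lip) auto
        also have "\<dots> = B" by (simp add: field_simps)
        finally show ?thesis using True by simp
      next
        case False
        have "\<bar>?s\<bar> \<le> 1" by (simp add: inverse_le_1_iff)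
        then have "norm (?s *\<^sub>R \<eta>) \<le> norm \<eta>"
          unfolding norm_scaleR by (rule mult_left_le_one_le[rotated 2]) auto
        then have "norm (?s *\<^sub>R \<eta> + y) > r"
          using False norm_triangle_ineq2[of y "- (?s *\<^sub>R \<eta>)"] by (simp add: add.commute)
        moreover have "norm y > r" using False norm_ge_zero[of \<eta>] by linarith
        ultimately show ?thesis using supp B by (simp add: f_def)
      qed
    qed
    show "integrable lborel (\<lambda>y. B * indicator (cball 0 (r + norm \<eta>)) y)"
      by (intro integrable_mult_right integrable_real_indicator) (auto intro!: emeasure_bounded_finite[unfolded infinity_ennreal_def] bounded_cball)
  qed (auto simp: f_def[abs_def])
  ultimately show "(\<integral>y. D y \<partial>lborel) = 0" by (simp add: LIMSEQ_const_iff)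
qed

section \<open>The Gaussian\<close>

definition gcoef :: "nat \<Rightarrow> real \<Rightarrow> real" where
  "gcoef d s = (1 / sqrt (4 * pi * s)) ^ d"

lemma gcoef_pos: "s > 0 \<Longrightarrow> gcoef d s > 0"
  by (simp add: gcoef_def)

definition hk :: "real \<Rightarrow> 'a::euclidean_space \<Rightarrow> real" where
  "hk s v = gcoef DIM('a) s * exp (- (norm v)\<^sup>2 / (4 * s))"

lemma hk_pos: "s > 0 \<Longrightarrow> hk s v > 0"
  by (simp add: hk_def gcoef_pos)

lemma hk_measurable [measurable]: "hk s \<in> borel_measurable borel"
  unfolding hk_def[abs_def] by measurable

text \<open>The kernel at time \<open>s\<close> is the product over the coordinates of normal
  densities of variance \<open>2 * s\<close>, each of total mass 1.\<close>

lemma has_bochner_integral_hk: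
  fixes s :: real
  assumes "s > 0"
  shows "has_bochner_integral lborel (hk s :: 'a::euclidean_space \<Rightarrow> real) 1"
proof (rule has_bochner_integral_nn_integral)
  have eq: "hk s v = (\<Prod>b\<in>Basis. normal_density 0 (sqrt (2 * s)) (v \<bullet> b))" for v :: 'a
  proof -
    have "(norm v)\<^sup>2 = (\<Sum>b\<in>Basis. (v \<bullet> b)\<^sup>2)"
      by (subst power2_norm_eq_inner, subst euclidean_inner) (simp add: power2_eq_square)
    then show ?thesis using assms unfolding hk_def gcoef_def normal_density_def
      by (simp only: prod.distrib prod_constant flip: exp_sum[OF finite_Basis])
        (simp add: sum_negf sum_divide_distrib mult.assoc)
  qed
  have "(\<integral>\<^sup>+v. ennreal (hk s (v::'a)) \<partial>lborel)
      = (\<integral>\<^sup>+v. (\<Prod>b\<in>Basis. ennreal (normal_density 0 (sqrt (2 * s)) ((v::'a) \<bullet> b))) \<partial>lborel)"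
    by (subst prod_ennreal) (auto simp: normal_density_nonneg eq)
  also have "\<dots> = (\<Prod>b\<in>(Basis::'a set). \<integral>\<^sup>+x. ennreal (normal_density 0 (sqrt (2 * s)) x) \<partial>lborel)"
    by (rule nn_integral_lborel_prod) auto
  also have "\<dots> = 1"
  proof -
    have "(\<integral>\<^sup>+x. ennreal (normal_density 0 (sqrt (2 * s)) x) \<partial>lborel) = ennreal 1"
      using assms by (subst nn_integral_eq_integral) (auto simp: normal_density_nonneg)
    then show ?thesis by simp
  qed
  finally show "(\<integral>\<^sup>+v. ennreal (hk s (v::'a)) \<partial>lborel) = ennreal 1" by simp
qed (auto intro!: AE_I2 less_imp_le hk_pos assms)

lemma integrable_hk: "s > 0 \<Longrightarrow> integrable lborel (hk s :: 'a::euclidean_space \<Rightarrow> real)"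
  and integral_hk: "s > 0 \<Longrightarrow> (\<integral>v. hk s (v::'a) \<partial>lborel) = 1"
  using has_bochner_integral_hk has_bochner_integral_iff by blast+

lemma sqrt_8: "sqrt 8 = 2 * sqrt 2"
  using real_sqrt_mult[of 4 2] by simp

lemma gcoef_double: "s > 0 \<Longrightarrow> gcoef d s = sqrt 2 ^ d * gcoef d (2 * s)"
  unfolding gcoef_def power_mult_distrib[symmetric]
  by (rule arg_cong[where f = "\<lambda>x. x ^ d"]) (simp add: real_sqrt_divide real_sqrt_mult field_simps real_sqrt_eq_iff sqrt_8)

text \<open>Half of the exponent is spent on the constant
  \<open>exp (- \<delta>\<^sup>2 / (8 * s))\<close>; what remains is the exponential of the kernel
  at time \<open>2 * s\<close>, and \<open>sqrt 2 ^ DIM('a)\<close> is the ratio of the two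
  normalisations.\<close>

lemma hk_tail:
  fixes v :: "'a::euclidean_space"
  assumes "s > 0" "\<delta> \<ge> 0" "norm v \<ge> \<delta>"
  shows "hk s v \<le> sqrt 2 ^ DIM('a) * exp (- \<delta>\<^sup>2 / (8 * s)) * hk (2 * s) v"
proof -
  have "\<delta>\<^sup>2 \<le> (norm v)\<^sup>2" using assms by (auto intro: power_mono)
  then have "- (norm v)\<^sup>2 / (4 * s) \<le> - \<delta>\<^sup>2 / (8 * s) + - (norm v)\<^sup>2 / (4 * (2 * s))"
    using assms(1) by (simp add: field_simps)
  then have "exp (- (norm v)\<^sup>2 / (4 * s)) \<le> exp (- \<delta>\<^sup>2 / (8 * s)) * exp (- (norm v)\<^sup>2 / (4 * (2 * s)))"
    unfolding exp_add[symmetric] by simp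
  then have "gcoef DIM('a) s * exp (- (norm v)\<^sup>2 / (4 * s))
      \<le> gcoef DIM('a) s * (exp (- \<delta>\<^sup>2 / (8 * s)) * exp (- (norm v)\<^sup>2 / (4 * (2 * s))))"
    using gcoef_pos[OF assms(1)] by (intro mult_left_mono) (auto simp: less_imp_le)
  then show ?thesis unfolding hk_def gcoef_double[OF assms(1)] by (simp add: mult_ac)
qed

text \<open>An explicit error instead of a limit, so that the estimate stays uniform when
  \<open>g\<close> varies with the point of the complex domain. The tail beyond
  \<open>\<delta>\<close> is integrated against the kernel at time \<open>2 * s\<close>, whose mass
  is again 1.\<close>

lemma integral_hk_approx:
  fixes g :: "'a::euclidean_space \<Rightarrow> complex"
  assumes s: "s > 0" and \<delta>: "\<delta> > 0" and [measurable]: "g \<in> borel_measurable borel"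
    and B: "\<And>v. cmod (g v - c) \<le> B" and e: "\<And>v. norm v < \<delta> \<Longrightarrow> cmod (g v - c) \<le> e"
  shows "integrable lborel (\<lambda>v. of_real (hk s v) * g v)"
    and "cmod ((\<integral>v. of_real (hk s v) * g v \<partial>lborel) - c) \<le> e + B * (sqrt 2 ^ DIM('a) * exp (- \<delta>\<^sup>2 / (8 * s)))"
proof -
  let ?C = "B * (sqrt 2 ^ DIM('a) * exp (- \<delta>\<^sup>2 / (8 * s)))"
  have B0: "B \<ge> 0" using B[of 0] norm_ge_zero order_trans by blast
  have i1: "integrable lborel (\<lambda>v::'a. complex_of_real (hk s v))"
    using integrable_hk[OF s] by auto
  show i2: "integrable lborel (\<lambda>v. of_real (hk s v) * g v)"
  proof (rule integrable_mult_bounded[OF i1, of _ "B + cmod c"])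
    show "AE x in lborel. cmod (g x) \<le> B + cmod c"
      using B norm_triangle_sub[of "g _" c] by (intro AE_I2) (smt (verit))
  qed simp
  have i3: "integrable lborel (\<lambda>v. of_real (hk s v) * (g v - c))"
    using Bochner_Integration.integrable_diff[OF i2 integrable_mult_left[OF i1, of c]]
    by (simp add: algebra_simps)
  have "(\<integral>v. of_real (hk s (v::'a)) * c \<partial>lborel) = c"
    using integral_hk[OF s, where 'a='a] by (subst integral_mult_left_zero) (simp add: integral_complex_of_real)
  then have "(\<integral>v. of_real (hk s v) * g v \<partial>lborel) - c = (\<integral>v. of_real (hk s v) * (g v - c) \<partial>lborel)"
    using Bochner_Integration.integral_diff[OF i2 integrable_mult_left[OF i1, of c]]
    by (simp only: right_diff_distrib)
  also have "cmod \<dots> \<le> (\<integral>v. e * hk s v + ?C * hk (2 * s) (v::'a) \<partial>lborel)"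
  proof (rule Bochner_Integration.integral_norm_bound_integral[OF i3])
    show "integrable lborel (\<lambda>v. e * hk s v + ?C * hk (2 * s) (v::'a))"
      using integrable_hk[of s] integrable_hk[of "2 * s"] s by auto
    fix v :: 'a
    show "norm (of_real (hk s v) * (g v - c)) \<le> e * hk s v + ?C * hk (2 * s) v"
    proof (cases "norm v < \<delta>")
      case True
      have "norm (of_real (hk s v) * (g v - c)) \<le> hk s v * e"
        using e[OF True] hk_pos[OF s, of v] by (simp add: norm_mult)
      moreover have "?C * hk (2 * s) v \<ge> 0" using B0 hk_pos[of "2 * s" v] s by simp
      ultimately show ?thesis by (simp add: mult.commute)
    next
      case False
      have "norm (of_real (hk s v) * (g v - c)) \<le> hk s v * B"
        using B[of v] hk_pos[OF s, of v] by (simp add: norm_mult)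
      also have "\<dots> \<le> (sqrt 2 ^ DIM('a) * exp (- \<delta>\<^sup>2 / (8 * s)) * hk (2 * s) v) * B"
        using False B0 by (intro mult_right_mono hk_tail s less_imp_le[OF \<delta>]) auto
      finally have *: "norm (of_real (hk s v) * (g v - c)) \<le> ?C * hk (2 * s) v" by (simp add: mult_ac)
      show ?thesis
      proof -
        have "0 \<le> e" using order_trans[OF norm_ge_zero e[of 0]] \<delta> by simp
        then have "e * hk s v \<ge> 0" using hk_pos[OF s, of v] by simp
        then show ?thesis using * by linarith
      qed
    qed
  qed
  also have "\<dots> = e + ?C"
    using s by (subst Bochner_Integration.integral_add) (simp_all add: integrable_hk integral_hk)
  finally show "cmod ((\<integral>v. of_real (hk s v) * g v \<partial>lborel) - c) \<le> e + ?C" .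
qed

text \<open>For \<open>s \<ge> 1\<close> all factors are at most 1. For smaller \<open>s\<close> the
  normalisation is at most \<open>inverse s ^ d\<close>, because
  \<open>sqrt (4 * pi * s) \<ge> s\<close>, and a single term of the exponential series, of order
  \<open>d + k\<close>, cancels the powers of \<open>inverse s\<close>.\<close>

lemma gcoef_exp_bounded:
  assumes "c > 0"
  obtains M where "M > 0" "\<And>s. s > 0 \<Longrightarrow> inverse s ^ k * gcoef d s * exp (- c / (4 * s)) \<le> M"
proof -
  define m where "m = d + k"
  define M where "M = max 1 (fact m * (4 / c) ^ m)"
  have "inverse s ^ k * gcoef d s * exp (- c / (4 * s)) \<le> M" if s: "s > 0" for s
  proof (cases "s \<ge> 1")
    case True
    have "gcoef d s \<le> 1" unfolding gcoef_def
    proof (rule power_le_one)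
      have "1 \<le> 4 * pi * s" using True pi_ge_two mult_mono[of 1 "4 * pi" 1 s] by linarith
      then show "1 / sqrt (4 * pi * s) \<le> 1" by simp
    qed (use s in auto)
    moreover have "inverse s ^ k \<le> 1" using True s by (intro power_le_one) (auto simp: inverse_le_1_iff)
    moreover have "exp (- c / (4 * s)) \<le> 1" using s assms by simp
    ultimately have "inverse s ^ k * gcoef d s * exp (- c / (4 * s)) \<le> 1 * 1 * 1"
      using s gcoef_pos[OF s, of d] by (intro mult_mono) (auto simp: less_imp_le)
    then show ?thesis by (simp add: M_def)
  next
    case False
    have "sqrt (4 * pi * s) \<ge> s"
    proof (rule real_le_rsqrt)
      have "s * s \<le> 1 * s" using False s by (intro mult_right_mono) auto
      also have "\<dots> \<le> (4 * pi) * s" using s pi_ge_two by (intro mult_right_mono) auto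
      finally show "s\<^sup>2 \<le> 4 * pi * s" by (simp add: power2_eq_square)
    qed
    then have "1 / sqrt (4 * pi * s) \<le> inverse s" using s by (simp add: field_simps)
    then have g: "gcoef d s \<le> inverse s ^ d" unfolding gcoef_def
      by (intro power_mono) (use s in auto)
    define x where "x = c / (4 * s)"
    have x: "x > 0" using s assms by (simp add: x_def)
    have "x ^ m / fact m \<le> exp x" 
      using sum_le_suminf[of "\<lambda>n. x ^ n /\<^sub>R fact n" "{m}"] x
        summable_exp_generic[of x]
      by (simp add: exp_def divide_inverse mult.commute)
    then have ex: "exp (- x) \<le> fact m / x ^ m" using x by (simp add: exp_minus field_simps)
    have "inverse s ^ k * gcoef d s * exp (- c / (4 * s)) \<le> inverse s ^ k * inverse s ^ d * (fact m / x ^ m)"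
      using g ex s gcoef_pos[OF s, of d] x by (intro mult_mono) (auto simp: x_def less_imp_le)
    also have "\<dots> = inverse s ^ m * (fact m / x ^ m)"
      by (simp add: m_def power_add mult.commute)
    also have "\<dots> = fact m * (4 / c) ^ m"
      using s assms by (simp add: x_def field_simps power_mult_distrib power_divide)
    finally show ?thesis by (simp add: M_def)
  qed
  then show ?thesis using that[of M] by (auto simp: M_def)
qed

text \<open>Half of the exponent absorbs the singular factors by \<open>gcoef_exp_bounded\<close>;
  the other half tends to 0.\<close>

lemma gcoef_exp_tendsto_0:
  assumes "c > 0"
  shows "((\<lambda>s. inverse s ^ k * gcoef d s * exp (- c / (4 * s))) \<longlongrightarrow> 0) (at_right 0)"
proof -
  obtain M where M: "M > 0" "\<And>s. s > 0 \<Longrightarrow> inverse s ^ k * gcoef d s * exp (- (c/2) / (4 * s)) \<le> M"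
    using gcoef_exp_bounded[of "c/2" k d] assms by auto
  have lim: "((\<lambda>s. M * exp (- (c/8) * inverse s)) \<longlongrightarrow> 0) (at_right 0)"
    using assms by (intro tendsto_mult_right_zero filterlim_compose[OF exp_at_bot]
        filterlim_tendsto_neg_mult_at_bot[OF tendsto_const _ filterlim_inverse_at_top_right]) auto
  show ?thesis
  proof (rule tendsto_sandwich[OF _ _ tendsto_const lim])
    show "\<forall>\<^sub>F s in at_right 0. 0 \<le> inverse s ^ k * gcoef d s * exp (- c / (4 * s))"
      by (auto simp: eventually_at_filter gcoef_def)
    show "\<forall>\<^sub>F s in at_right 0. inverse s ^ k * gcoef d s * exp (- c / (4 * s)) \<le> M * exp (- (c/8) * inverse s)"
    proof (rule eventually_mono[OF eventually_at_right_less])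
      fix s :: real assume s: "0 < s"
      have "exp (- c / (4 * s)) = exp (- (c/2) / (4 * s)) * exp (- (c/8) * inverse s)"
        unfolding exp_add[symmetric] using s by (simp add: field_simps)
      then have "inverse s ^ k * gcoef d s * exp (- c / (4 * s))
          = (inverse s ^ k * gcoef d s * exp (- (c/2) / (4 * s))) * exp (- (c/8) * inverse s)" by simp
      also have "\<dots> \<le> M * exp (- (c/8) * inverse s)" using M(2)[OF s] by (intro mult_right_mono) auto
      finally show "inverse s ^ k * gcoef d s * exp (- c / (4 * s)) \<le> M * exp (- (c/8) * inverse s)" .
    qed
  qed
qed

section \<open>Holomorphic functions of several variables\<close>

definition Rev :: "complex ^ 'n \<Rightarrow> real ^ 'n" where "Rev z = (\<chi> i. Re (z $ i))"
definition Imv :: "complex ^ 'n \<Rightarrow> real ^ 'n" where "Imv z = (\<chi> i. Im (z $ i))"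

lemma cvec_Rev_Imv [simp]: "cvec (Rev z) (Imv z) = z"
  by (simp add: cvec_def Rev_def Imv_def vec_eq_iff)

lemma Rev_cvec [simp]: "Rev (cvec x y) = x" and Imv_cvec [simp]: "Imv (cvec x y) = y"
  by (simp_all add: cvec_def Rev_def Imv_def vec_eq_iff)

lemma cvec_nth: "cvec x y $ i = Complex (x $ i) (y $ i)"
  by (simp add: cvec_def)

lemma cvec_add: "cvec x y + cvec x' y' = cvec (x + x') (y + y')"
  and cvec_diff: "cvec x y - cvec x' y' = cvec (x - x') (y - y')"
  and cvec_scale: "c *s cvec v 0 = cvec (Re c *\<^sub>R v) (Im c *\<^sub>R v)"
  by (simp_all add: vec_eq_iff cvec_nth complex_eq_iff)

lemma linear_Rev: "linear Rev" and linear_Imv: "linear Imv"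
  by (auto intro!: linearI simp: Rev_def Imv_def vec_eq_iff)

lemma continuous_on_Rev: "continuous_on S f \<Longrightarrow> continuous_on S (\<lambda>x. Rev (f x))"
  and continuous_on_Imv: "continuous_on S f \<Longrightarrow> continuous_on S (\<lambda>x. Imv (f x))"
  unfolding Rev_def Imv_def by (intro continuous_intros; assumption)+

lemma continuous_on_cvec:
  "continuous_on S f \<Longrightarrow> continuous_on S g \<Longrightarrow> continuous_on S (\<lambda>x. cvec (f x) (g x))"
  unfolding cvec_def complex_eq by (intro continuous_intros)

lemma norm_vec_scale: "norm (c *s (v :: complex ^ 'n)) = cmod c * norm v"
  by (simp add: norm_vec_def L2_set_def norm_mult power_mult_distrib real_sqrt_mult flip: sum_distrib_left)

lemma bounded_linear_vec_scale: "bounded_linear (\<lambda>c. c *s (v :: complex ^ 'n))"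
  by (rule bounded_linear_intro[where K = "norm v"])
     (auto simp: vec_eq_iff algebra_simps norm_vec_scale mult.commute)

lemma holomorphic_several_imp_continuous:
  "holomorphic_several_on F U \<Longrightarrow> continuous_on U F"
  unfolding holomorphic_several_on_def
  by (meson continuous_at_imp_continuous_on has_derivative_continuous)

lemma holomorphic_several_subset:
  "holomorphic_several_on F U \<Longrightarrow> V \<subseteq> U \<Longrightarrow> holomorphic_several_on F V"
  unfolding holomorphic_several_on_def by blast

lemma holomorphic_several_transform:
  assumes F: "holomorphic_several_on F U" and "open U" and eq: "\<And>z. z \<in> U \<Longrightarrow> F z = G z"
  shows "holomorphic_several_on G U"
  unfolding holomorphic_several_on_def
proof
  fix z assume z: "z \<in> U"
  then obtain L where "(F has_derivative L) (at z)" "\<forall>c v. L (c *s v) = c * L v"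
    using F unfolding holomorphic_several_on_def by blast
  then show "\<exists>L. (G has_derivative L) (at z) \<and> (\<forall>c v. L (c *s v) = c * L v)"
    using has_derivative_transform_within_open[OF _ \<open>open U\<close> z] eq by blast
qed

section \<open>Closure properties of holomorphic functions\<close>

lemma holomorphic_several_const: "holomorphic_several_on (\<lambda>z. c) U"
  unfolding holomorphic_several_on_def by (auto intro!: exI[of _ "\<lambda>h. 0"])

lemma holomorphic_several_nth: "holomorphic_several_on (\<lambda>z. z $ i) U"
  unfolding holomorphic_several_on_def
  by (auto intro!: exI[of _ "\<lambda>h. h $ i"] bounded_linear_imp_has_derivative bounded_linear_vec_nth)

lemma holomorphic_several_add:
  assumes "holomorphic_several_on F U" "holomorphic_several_on G U"
  shows "holomorphic_several_on (\<lambda>z. F z + G z) U"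
  unfolding holomorphic_several_on_def
proof
  fix z assume "z \<in> U"
  then obtain L M where "(F has_derivative L) (at z)" "\<forall>c v. L (c *s v) = c * L v"
      "(G has_derivative M) (at z)" "\<forall>c v. M (c *s v) = c * M v"
    using assms unfolding holomorphic_several_on_def by meson
  then show "\<exists>L. ((\<lambda>z. F z + G z) has_derivative L) (at z) \<and> (\<forall>c v. L (c *s v) = c * L v)"
    by (intro exI[of _ "\<lambda>h. L h + M h"]) (auto intro: has_derivative_add simp: algebra_simps)
qed

lemma holomorphic_several_mult:
  assumes "holomorphic_several_on F U" "holomorphic_several_on G U"
  shows "holomorphic_several_on (\<lambda>z. F z * G z) U"
  unfolding holomorphic_several_on_def
proof
  fix z assume "z \<in> U"
  then obtain L M where "(F has_derivative L) (at z)" "\<forall>c v. L (c *s v) = c * L v"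
      "(G has_derivative M) (at z)" "\<forall>c v. M (c *s v) = c * M v"
    using assms unfolding holomorphic_several_on_def by meson
  then show "\<exists>L. ((\<lambda>z. F z * G z) has_derivative L) (at z) \<and> (\<forall>c v. L (c *s v) = c * L v)"
    by (intro exI[of _ "\<lambda>h. F z * M h + L h * G z"] conjI has_derivative_mult)
      (simp_all add: algebra_simps)
qed

lemma holomorphic_several_sum:
  "(\<And>i. i \<in> A \<Longrightarrow> holomorphic_several_on (F i) U) \<Longrightarrow> holomorphic_several_on (\<lambda>z. \<Sum>i\<in>A. F i z) U"
  by (induction A rule: infinite_finite_induct)
     (auto intro: holomorphic_several_const holomorphic_several_add)

lemma holomorphic_several_diff:
  "holomorphic_several_on F U \<Longrightarrow> holomorphic_several_on G U \<Longrightarrow> holomorphic_several_on (\<lambda>z. F z - G z) U"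
  using holomorphic_several_add[of F U "\<lambda>z. (-1) * G z"]
    holomorphic_several_mult[OF holomorphic_several_const[of "-1"], of G U] by simp

lemma holomorphic_several_exp:
  assumes "holomorphic_several_on F U"
  shows "holomorphic_several_on (\<lambda>z. exp (F z)) U"
  unfolding holomorphic_several_on_def
proof
  fix z assume "z \<in> U"
  then obtain L where L: "(F has_derivative L) (at z)" "\<forall>c v. L (c *s v) = c * L v"
    using assms unfolding holomorphic_several_on_def by meson
  have "((\<lambda>z. exp (F z)) has_derivative (\<lambda>h. exp (F z) * L h)) (at z)"
    using has_derivative_compose[OF L(1) DERIV_exp[of "F z", unfolded has_field_derivative_def]] .
  with L(2) show "\<exists>L. ((\<lambda>z. exp (F z)) has_derivative L) (at z) \<and> (\<forall>c v. L (c *s v) = c * L v)"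
    by (intro exI[of _ "\<lambda>h. exp (F z) * L h"]) simp
qed

section \<open>Restriction to complex lines\<close>

lemma has_field_derivative_line:
  fixes z v :: "complex ^ 'n"
  assumes "(F has_derivative L) (at (z + c *s v))" "\<And>c v. L (c *s v) = c * L v"
  shows "((\<lambda>c. F (z + c *s v)) has_field_derivative L v) (at c)"
proof -
  have "((\<lambda>c. z + c *s v) has_derivative (\<lambda>h. h *s v)) (at c)"
    using has_derivative_add[OF has_derivative_const[of z]
        bounded_linear_imp_has_derivative[OF bounded_linear_vec_scale[of v]]]
    by simp
  from has_derivative_compose[OF this assms(1)] show ?thesis
    by (simp add: has_field_derivative_def assms(2) mult.commute[of _ "L v"])
qed

lemma continuous_on_line: "continuous_on S (\<lambda>c. z + c *s (v :: complex ^ 'n))"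
  by (intro continuous_intros linear_continuous_on bounded_linear_vec_scale)

lemma open_line_vimage: "open U \<Longrightarrow> open {c. z + c *s (v :: complex ^ 'n) \<in> U}"
  using continuous_open_vimage[of U "\<lambda>c. z + c *s v"] continuous_on_line[of UNIV z v]
  by (simp add: vimage_def continuous_on_eq_continuous_at)

lemma convex_line_vimage:
  assumes "convex U"
  shows "convex {c. z + c *s (v :: complex ^ 'n) \<in> U}"
proof -
  have "{c. z + c *s v \<in> U} = (\<lambda>c. c *s v) -` ((\<lambda>w. w + (- z)) ` U)"
    by (force simp: image_iff)
  moreover have "convex ((\<lambda>w. w + (- z)) ` U)"
    using convex_translation[OF assms, of "- z"] by (simp add: add.commute)
  ultimately show ?thesis
    using bounded_linear_vec_scale[THEN bounded_linear.linear] by (auto intro!: convex_linear_vimage)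
qed

lemma holomorphic_on_line:
  assumes "holomorphic_several_on F U" "open U"
  shows "(\<lambda>c. F (z + c *s v)) holomorphic_on {c. z + c *s v \<in> U}"
proof (subst holomorphic_on_open[OF open_line_vimage[OF assms(2)]], intro ballI)
  fix c assume "c \<in> {c. z + c *s v \<in> U}"
  then obtain L where "(F has_derivative L) (at (z + c *s v))" "\<And>c v. L (c *s v) = c * L v"
    using assms(1) unfolding holomorphic_several_on_def by blast
  then show "\<exists>f'. ((\<lambda>c. F (z + c *s v)) has_field_derivative f') (at c)"
    using has_field_derivative_line by blast
qed

text \<open>
  The Cauchy estimate on complex lines makes the integrands uniformly Lipschitz, so that dominated
  convergence applies to the difference quotients.
\<close>

lemma holomorphic_several_integral:
  fixes k :: "complex ^ 'n \<Rightarrow> 'w \<Rightarrow> complex"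
  assumes "open U" and f: "integrable M f"
    and meas: "\<And>z. z \<in> U \<Longrightarrow> k z \<in> borel_measurable M"
    and hol: "\<And>w. w \<in> space M \<Longrightarrow> holomorphic_several_on (\<lambda>z. k z w) U"
    and B: "\<And>z w. z \<in> U \<Longrightarrow> w \<in> space M \<Longrightarrow> cmod (k z w) \<le> B"
  shows "holomorphic_several_on (\<lambda>z. \<integral>w. f w * k z w \<partial>M) U"
  unfolding holomorphic_several_on_def
proof
  fix z assume z: "z \<in> U"
  \<comment> \<open>The factor 2 leaves a ball of radius \<open>r\<close> inside \<open>U\<close>
    around each point of \<open>ball z r\<close>, so that the Cauchy estimate holds at all of them
    with one constant.\<close>
  then obtain r where r: "r > 0" "ball z (2 * r) \<subseteq> U"
    using \<open>open U\<close> openE by (metis field_sum_of_halves half_gt_zero mult_2)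
  have B0: "B \<ge> 0" if "w \<in> space M" for w using B[OF z that] norm_ge_zero order_trans by blast
  have "\<forall>w\<in>space M. \<forall>y\<in>U. \<exists>L. ((\<lambda>z. k z w) has_derivative L) (at y) \<and> (\<forall>c v. L (c *s v) = c * L v)"
    using hol unfolding holomorphic_several_on_def by blast
  then obtain L where L: "\<And>w y. w \<in> space M \<Longrightarrow> y \<in> U \<Longrightarrow> ((\<lambda>z. k z w) has_derivative L w y) (at y)"
      "\<And>w y c v. w \<in> space M \<Longrightarrow> y \<in> U \<Longrightarrow> L w y (c *s v) = c * L w y v"
    by metis
  \<comment> \<open>This is Cauchy's inequality on the circle of radius \<open>R / 2\<close>, where
    \<open>R = r / norm v\<close>; the half keeps the closed disc inside the set where the function
    is defined.\<close>
  define C where "C = 2 * B / r"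
  have Lb: "cmod (L w y v) \<le> C * norm v" if w: "w \<in> space M" and y: "y \<in> ball z r" for w y v
  proof (cases "v = 0")
    case True
    then show ?thesis
      using linear_0[OF has_derivative_linear[OF L(1)[OF w, of y]]] y r by (auto simp: C_def subset_iff)
  next
    case False
    define R where "R = r / norm v"
    have R: "R > 0" using r False by (simp add: R_def)
    have in_U: "y + c *s v \<in> U" if "cmod c < R" for c
    proof -
      have "dist z (y + c *s v) \<le> dist z y + norm (c *s v)"
        by (metis dist_triangle dist_norm add_diff_cancel_left' dist_commute)
      also have "\<dots> < r + r"
        using y that False by (intro add_strict_mono) (auto simp: norm_vec_scale R_def field_simps)
      finally show ?thesis using r by auto
    qed
    have hol: "(\<lambda>c. k (y + c *s v) w) holomorphic_on {c. y + c *s v \<in> U}"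
      using holomorphic_on_line[OF hol[OF w] \<open>open U\<close>] .
    have "norm ((deriv ^^ 1) (\<lambda>c. k (y + c *s v) w) 0) \<le> fact 1 * B / (R / 2) ^ 1"
    proof (rule Cauchy_inequality)
      show "(\<lambda>c. k (y + c *s v) w) holomorphic_on ball 0 (R / 2)"
        by (rule holomorphic_on_subset[OF hol]) (use in_U R in auto)
      show "continuous_on (cball 0 (R / 2)) (\<lambda>c. k (y + c *s v) w)"
        by (rule continuous_on_subset[OF holomorphic_on_imp_continuous_on[OF hol]]) (use in_U R in auto)
      show "cmod (k (y + x *s v) w) \<le> B" if "cmod (0 - x) = R / 2" for x
        using that R by (intro B in_U w) auto
    qed (use R in auto)
    moreover have "deriv (\<lambda>c. k (y + c *s v) w) 0 = L w y v"
    proof (rule DERIV_imp_deriv, rule has_field_derivative_line)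
      show "((\<lambda>z. k z w) has_derivative L w y) (at (y + 0 *s v))"
        using L(1)[OF w] in_U[of 0] R by simp
    qed (use L(2)[OF w] in_U[of 0] R in simp)
    ultimately show ?thesis using False r by (simp add: R_def C_def field_simps)
  qed
  have lip: "cmod (k (z + h) w - k z w) \<le> C * norm h" if w: "w \<in> space M" and h: "norm h < r" for w h
  proof -
    have "norm (k (z + h) w - k z w) \<le> C * norm (z + h - z)"
    proof (rule differentiable_bound[of "ball z r" "\<lambda>z. k z w" "L w"])
      show "((\<lambda>z. k z w) has_derivative L w y) (at y within ball z r)" if "y \<in> ball z r" for y
      proof (rule has_derivative_at_withinI, rule L(1)[OF w])
        show "y \<in> U" using that r by (intro subsetD[OF r(2)]) auto
      qed
      show "onorm (L w y) \<le> C" if "y \<in> ball z r" for y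
        using Lb[OF w that] B0[OF w] r by (intro onorm_bound) (auto simp: C_def)
    qed (use h r in \<open>auto simp: dist_norm\<close>)
    then show ?thesis by simp
  qed
  have inU: "z + h \<in> U" if "norm h < r" for h
    using that r by (intro subsetD[OF r(2)]) (simp add: dist_norm)
  \<comment> \<open>The derivative is measurable as a limit of difference quotients. The offset
    \<open>N\<close> makes the step shorter than \<open>r\<close> from the start, since
    measurability of the kernels is given only at points of \<open>U\<close>.\<close>
  have LM: "(\<lambda>w. L w z h) \<in> borel_measurable M" for h
  proof -
    define N where "N = nat \<lceil>norm h / r\<rceil> + 1"
    have N: "norm (inverse (real (n + N)) *\<^sub>R h) < r" for n
    proof -
      have "norm h / r < real (n + N)" unfolding N_def by linarith
      moreover have "real (n + N) > 0" by (simp add: N_def)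
      ultimately show ?thesis using r by (simp add: field_simps)
    qed
    show ?thesis
    proof (rule borel_measurable_LIMSEQ_metric)
      show "(\<lambda>w. real (n + N) *\<^sub>R (k (z + inverse (real (n + N)) *\<^sub>R h) w - k z w)) \<in> borel_measurable M" for n
        using meas[OF inU[OF N]] meas[OF z] by measurable
      fix w assume w: "w \<in> space M"
      have "((\<lambda>s. k (z + s *\<^sub>R h) w) has_vector_derivative L w z h) (at 0)"
      proof -
        have "((\<lambda>s. z + s *\<^sub>R h) has_derivative (\<lambda>s. s *\<^sub>R h)) (at 0)"
          by (auto intro!: derivative_eq_intros)
        moreover have "((\<lambda>z. k z w) has_derivative L w z) (at (z + 0 *\<^sub>R h))" using L(1)[OF w z] by simp
        ultimately have "((\<lambda>s. k (z + s *\<^sub>R h) w) has_derivative (\<lambda>s. L w z (s *\<^sub>R h))) (at 0)"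
          by (rule has_derivative_compose)
        then show ?thesis
          using linear_scale[OF has_derivative_linear[OF L(1)[OF w z]]] by (simp add: has_vector_derivative_def)
      qed
      then have "((\<lambda>s. inverse s *\<^sub>R (k (z + s *\<^sub>R h) w - k z w)) \<longlongrightarrow> L w z h) (at 0)"
        using has_vector_derivative_imp_tendsto by fastforce
      then have "(\<lambda>n. inverse (inverse (real (n + N))) *\<^sub>R (k (z + inverse (real (n + N)) *\<^sub>R h) w - k z w)) \<longlonglongrightarrow> L w z h"
      proof (rule filterlim_compose)
        have "(\<lambda>n. inverse (real (n + N))) \<longlonglongrightarrow> 0"
          using LIMSEQ_ignore_initial_segment[OF lim_inverse_n] .
        then show "filterlim (\<lambda>n. inverse (real (n + N))) (at 0) sequentially"
          by (auto simp: filterlim_at N_def)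
      qed
      then show "(\<lambda>n. real (n + N) *\<^sub>R (k (z + inverse (real (n + N)) *\<^sub>R h) w - k z w)) \<longlonglongrightarrow> L w z h"
        by simp
    qed
  qed
  have zr: "z \<in> ball z r" using r by simp
  have iL: "integrable M (\<lambda>w. f w * L w z h)" for h
    by (rule integrable_mult_bounded[OF f LM]) (use Lb[OF _ zr] in \<open>auto intro: AE_I2\<close>)
  have ik: "integrable M (\<lambda>w. f w * k y w)" if "y \<in> U" for y
    by (rule integrable_mult_bounded[OF f meas[OF that]]) (use B[OF that] in \<open>auto intro: AE_I2\<close>)
  define \<Lambda> where "\<Lambda> h = (\<integral>w. f w * L w z h \<partial>M)" for h
  have Llin: "linear (L w z)" if "w \<in> space M" for w
    using L(1)[OF that z] by (rule has_derivative_linear)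
  have "linear \<Lambda>"
  proof (rule linearI)
    fix a b :: "complex ^ 'n" and c :: real
    have "\<Lambda> (a + b) = (\<integral>w. f w * L w z a + f w * L w z b \<partial>M)" unfolding \<Lambda>_def
      by (rule Bochner_Integration.integral_cong) (simp_all add: linear_add[OF Llin] algebra_simps)
    then show "\<Lambda> (a + b) = \<Lambda> a + \<Lambda> b" using iL by (simp add: \<Lambda>_def)
    have "\<Lambda> (c *\<^sub>R a) = (\<integral>w. c *\<^sub>R (f w * L w z a) \<partial>M)" unfolding \<Lambda>_def
      by (rule Bochner_Integration.integral_cong) (simp_all add: linear_scale[OF Llin])
    then show "\<Lambda> (c *\<^sub>R a) = c *\<^sub>R \<Lambda> a" by (simp add: \<Lambda>_def)
  qed
  then have bl: "bounded_linear \<Lambda>" by (rule linear_conv_bounded_linear[THEN iffD1])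
  have cl: "\<Lambda> (c *s v) = c * \<Lambda> v" for c v
  proof -
    have "\<Lambda> (c *s v) = (\<integral>w. c * (f w * L w z v) \<partial>M)" unfolding \<Lambda>_def
      by (rule Bochner_Integration.integral_cong) (simp_all add: L(2)[OF _ z])
    then show ?thesis by (simp add: \<Lambda>_def)
  qed
  have "((\<lambda>z. \<integral>w. f w * k z w \<partial>M) has_derivative \<Lambda>) (at z)"
    unfolding has_derivative_at
  proof (intro conjI bl)
    \<comment> \<open>The remainder quotient is cut off at \<open>r\<close> because
      \<open>z + h\<close> is known to lie in \<open>U\<close> only for shorter \<open>h\<close>; at
      \<open>h = 0\<close> its value is 0, as the inverse of 0 is 0.\<close>
    let ?q = "\<lambda>h w. (if norm h < r then (k (z + h) w - k z w - L w z h) /\<^sub>R norm h else 0)"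
    have lim: "((\<lambda>h. \<integral>w. f w * ?q h w \<partial>M) \<longlongrightarrow> (\<integral>w. f w * 0 \<partial>M)) (at 0 within UNIV)"
    proof (rule tendsto_integral_mult_bounded_at[OF f, of _ _ _ "2 * C"])
      fix h
      show "?q h \<in> borel_measurable M"
        using meas[OF inU, of h] meas[OF z] LM by (cases "norm h < r") simp_all
      show "AE w in M. cmod (?q h w) \<le> 2 * C"
      proof (intro AE_I2)
        fix w assume w: "w \<in> space M"
        show "cmod (?q h w) \<le> 2 * C"
        proof (cases "norm h < r \<and> h \<noteq> 0")
          case True
          have "norm (k (z + h) w - k z w - L w z h) \<le> C * norm h + C * norm h"
            using lip[OF w, of h] Lb[OF w zr, of h] True
            by (intro order_trans[OF norm_triangle_ineq4[of "k (z + h) w - k z w"]]) linarith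
          then have "norm (k (z + h) w - k z w - L w z h) / norm h \<le> 2 * C"
            using True by (subst pos_divide_le_eq) (auto simp: mult_ac)
          then show ?thesis using True by (simp add: divide_inverse mult.commute)
        next
          case False
          then show ?thesis using B0[OF w] r by (auto simp: C_def)
        qed
      qed
    next
      show "AE w in M. ((\<lambda>h. ?q h w) \<longlongrightarrow> 0) (at 0 within UNIV)"
      proof (intro AE_I2)
        fix w assume w: "w \<in> space M"
        have "((\<lambda>h. norm (k (z + h) w - k z w - L w z h) / norm h) \<longlongrightarrow> 0) (at 0)"
          using L(1)[OF w z] unfolding has_derivative_at by simp
        then have "((\<lambda>h. norm (?q h w)) \<longlongrightarrow> 0) (at 0)"
        proof (rule Lim_transform_eventually)
          have "\<forall>\<^sub>F h in at 0. norm (h :: complex ^ 'n) < r"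
            using r eventually_at_ball[of r 0 UNIV] by (auto elim: eventually_mono)
          then show "\<forall>\<^sub>F h in at 0. norm (k (z + h) w - k z w - L w z h) / norm h = norm (?q h w)"
            by eventually_elim (simp add: divide_inverse mult.commute)
        qed
        then show "((\<lambda>h. ?q h w) \<longlongrightarrow> 0) (at 0 within UNIV)" by (simp add: tendsto_norm_zero_iff)
      qed
    qed simp
    have "((\<lambda>h. norm (\<integral>w. f w * ?q h w \<partial>M)) \<longlongrightarrow> 0) (at 0)"
      using tendsto_norm[OF lim] by simp
    then show "(\<lambda>h. norm ((\<integral>w. f w * k (z + h) w \<partial>M) - (\<integral>w. f w * k z w \<partial>M) - \<Lambda> h) / norm h) \<midarrow>0\<rightarrow> 0"
    proof (rule Lim_transform_eventually)
      have "\<forall>\<^sub>F h in at 0. norm (h :: complex ^ 'n) < r"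
        using r eventually_at_ball[of r 0 UNIV] by (auto elim: eventually_mono)
      then show "\<forall>\<^sub>F h in at 0. norm (\<integral>w. f w * ?q h w \<partial>M)
          = norm ((\<integral>w. f w * k (z + h) w \<partial>M) - (\<integral>w. f w * k z w \<partial>M) - \<Lambda> h) / norm h"
      proof eventually_elim
        fix h :: "complex ^ 'n" assume h: "norm h < r"
        have "(\<integral>w. f w * ?q h w \<partial>M) = (\<integral>w. (f w * k (z + h) w - f w * k z w - f w * L w z h) /\<^sub>R norm h \<partial>M)"
          using h by (intro Bochner_Integration.integral_cong) (simp_all add: algebra_simps)
        also have "\<dots> = ((\<integral>w. f w * k (z + h) w \<partial>M) - (\<integral>w. f w * k z w \<partial>M) - \<Lambda> h) /\<^sub>R norm h"
          using ik[OF inU[OF h]] ik[OF z] iL[of h] by (simp add: \<Lambda>_def)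
        finally show "norm (\<integral>w. f w * ?q h w \<partial>M)
          = norm ((\<integral>w. f w * k (z + h) w \<partial>M) - (\<integral>w. f w * k z w \<partial>M) - \<Lambda> h) / norm h"
          by (simp add: divide_inverse mult.commute)
      qed
    qed
  qed
  with cl show "\<exists>L. ((\<lambda>z. \<integral>w. f w * k z w \<partial>M) has_derivative L) (at z) \<and> (\<forall>c v. L (c *s v) = c * L v)"
    by blast
qed

text \<open>On the complex line \<open>c \<mapsto> x + c y\<close> real parameters give real points
  and \<open>c = \<i>\<close> gives \<open>x + \<i> y\<close>. Convexity makes the slice of
  \<open>U\<close> connected, so the identity theorem in one variable applies with accumulation
  point 0.\<close>

lemma holomorphic_several_eq_on_real:
  assumes "open U" "convex U" "cvec x y \<in> U" "cvec x 0 \<in> U"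
    and F: "holomorphic_several_on F U" and G: "holomorphic_several_on G U"
    and eq: "\<And>x. cvec x 0 \<in> U \<Longrightarrow> F (cvec x 0) = G (cvec x 0)"
  shows "F (cvec x y) = G (cvec x y)"
proof -
  define A where "A = {c. cvec x 0 + c *s cvec y 0 \<in> U}"
  have A: "open A" "connected A" "0 \<in> A" "\<i> \<in> A"
    unfolding A_def using assms(1-4)
    by (simp_all only: open_line_vimage convex_connected[OF convex_line_vimage] mem_Collect_eq)
       (simp_all add: cvec_scale cvec_add)
  let ?f = "\<lambda>c. F (cvec x 0 + c *s cvec y 0) - G (cvec x 0 + c *s cvec y 0)"
  have "?f \<i> = 0"
  proof (rule analytic_continuation[where f = ?f and S = A and U = "A \<inter> \<real>" and \<xi> = 0])
    show "?f holomorphic_on A" unfolding A_def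
      by (intro holomorphic_on_diff holomorphic_on_line F G assms(1))
    show "?f c = 0" if "c \<in> A \<inter> \<real>" for c
      using that by (auto simp: A_def cvec_scale cvec_add eq elim!: Reals_cases)
    obtain e where e: "e > 0" "ball 0 e \<subseteq> A" using A openE by blast
    show "0 islimpt (A \<inter> \<real>)"
      unfolding islimpt_approachable
    proof (intro allI impI)
      fix d :: real assume d: "d > 0"
      show "\<exists>c\<in>A \<inter> \<real>. c \<noteq> 0 \<and> dist c 0 < d"
        using e d by (intro bexI[of _ "of_real (min d e / 2)"]) (auto simp: subset_iff)
    qed
  qed (use A in auto)
  then show ?thesis by (simp add: cvec_scale cvec_add)
qed


text \<open>Separate bounds on the real and the imaginary part are what the kernel estimates use;
  intersections of such sets stay convex, as the identity theorem requires.\<close>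

definition cylinder :: "real ^ 'n \<Rightarrow> real \<Rightarrow> real \<Rightarrow> (complex ^ 'n) set" where
  "cylinder x \<rho> a = {z. norm (Rev z - x) < \<rho> \<and> norm (Imv z) < a}"

lemma open_cylinder: "open (cylinder x \<rho> a)"
  unfolding cylinder_def
  by (intro open_Collect_conj open_Collect_less continuous_intros continuous_on_Rev continuous_on_Imv)

lemma convex_cylinder: "convex (cylinder x \<rho> a)"
proof -
  have "cylinder x \<rho> a = Rev -` ball x \<rho> \<inter> Imv -` ball 0 a"
    by (auto simp: cylinder_def dist_norm norm_minus_commute)
  then show ?thesis
    by (auto intro!: convex_Int convex_linear_vimage linear_Rev linear_Imv)
qed

section \<open>The complexified heat kernel\<close>

text \<open>The bilinear square, without conjugation, is the holomorphic continuation of the squared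
  norm. Its real part can be negative, and then the Gaussian is exponentially large for small
  times.\<close>

definition csq :: "complex ^ 'n \<Rightarrow> complex" where
  "csq z = (\<Sum>i\<in>UNIV. (z $ i)\<^sup>2)"

definition hkc :: "real \<Rightarrow> complex ^ 'n \<Rightarrow> complex" where
  "hkc s z = of_real (gcoef CARD('n) s) * exp (- csq z / of_real (4 * s))"

lemma norm_power2_vec: "(norm (x :: real ^ 'n))\<^sup>2 = (\<Sum>i\<in>UNIV. (x $ i)\<^sup>2)"
  by (simp add: norm_vec_def L2_set_def sum_nonneg)

lemma csq_cvec: "Re (csq (cvec x y)) = (norm x)\<^sup>2 - (norm y)\<^sup>2"
  unfolding norm_power2_vec by (simp add: csq_def cvec_nth sum_subtractf power2_eq_square)

lemma csq_cvec_0: "csq (cvec x 0) = of_real ((norm x)\<^sup>2)"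
  unfolding norm_power2_vec by (simp add: csq_def cvec_nth complex_eq_iff power2_eq_square)

lemma hkc_cvec_0: "hkc s (cvec x 0) = of_real (hk s x)"
  by (simp add: hkc_def hk_def csq_cvec_0 flip: exp_of_real)

lemma cmod_hkc:
  "s > 0 \<Longrightarrow> cmod (hkc s (cvec (x :: real ^ 'n) y))
    = gcoef CARD('n) s * exp (- ((norm x)\<^sup>2 - (norm y)\<^sup>2) / (4 * s))"
  unfolding hkc_def norm_mult norm_exp_eq_Re Re_divide_of_real
  by (simp only: uminus_complex.sel csq_cvec norm_of_real)
     (simp add: gcoef_def)

lemma holomorphic_several_csq: "holomorphic_several_on (\<lambda>z. csq (z - w)) U"
  unfolding csq_def power2_eq_square vector_minus_component
  by (intro holomorphic_several_sum holomorphic_several_mult holomorphic_several_diff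
      holomorphic_several_nth holomorphic_several_const)

lemma holomorphic_several_hkc: "holomorphic_several_on (\<lambda>z. hkc s (z - w)) U"
proof -
  have "(\<lambda>z. hkc s (z - w)) = (\<lambda>z. of_real (gcoef CARD('a) s) * exp (csq (z - w) * (- 1 / of_real (4 * s))))"
    by (simp add: hkc_def fun_eq_iff)
  then show ?thesis
    by (simp only:) (intro holomorphic_several_mult holomorphic_several_exp holomorphic_several_csq
        holomorphic_several_const)
qed

lemma continuous_on_csq: "continuous_on S f \<Longrightarrow> continuous_on S (\<lambda>x. csq (f x))"
  unfolding csq_def by (intro continuous_intros)

lemma continuous_on_hkc:
  assumes "continuous_on S f" "continuous_on S g" "\<And>x. x \<in> S \<Longrightarrow> g x > 0"
  shows "continuous_on S (\<lambda>x. hkc (g x) (f x))"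
  unfolding hkc_def gcoef_def
  by (intro continuous_intros continuous_on_csq assms)
     (use assms(3) in \<open>auto simp: less_imp_neq[OF assms(3), symmetric]\<close>)

section \<open>Shifting the domain of integration into the complex domain\<close>

text \<open>
  Along each line in direction \<open>\<eta>\<close> the function \<open>F\<close> has a primitive \<open>P\<close>, and the difference of the two
  integrands is the derivative of \<open>P\<close> evaluated at the shifted point minus \<open>P\<close> evaluated at the real point.
\<close>

lemma integral_complex_shift:
  fixes F :: "complex ^ 'n \<Rightarrow> complex" and R :: "real ^ 'n \<Rightarrow> complex"
  assumes W: "open W" "convex W" and V: "open V" and C: "closed C" "C \<subseteq> V" "C \<subseteq> cball 0 r"
    and F: "holomorphic_several_on F W"
    and R: "integrable lborel R" "\<And>y. y \<in> V \<Longrightarrow> F (cvec y 0) = R y"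
    and \<tau>: "continuous_on UNIV \<tau>" "continuous_on UNIV \<tau>'" "\<And>y. y \<notin> C \<Longrightarrow> \<tau> y = 0"
      "\<And>y. ((\<lambda>s. \<tau> (y + s *\<^sub>R \<eta>)) has_real_derivative \<tau>' y) (at 0)"
    and inW: "\<And>y \<theta>. y \<in> V \<Longrightarrow> 0 \<le> \<theta> \<Longrightarrow> \<theta> \<le> 1 \<Longrightarrow> cvec y ((\<theta> * \<tau> y) *\<^sub>R \<eta>) \<in> W"
  defines "N \<equiv> \<lambda>y. if y \<in> V then F (cvec y (\<tau> y *\<^sub>R \<eta>)) * (1 + \<i> * of_real (\<tau>' y)) else R y"
  shows "integrable lborel N" "(\<integral>y. N y \<partial>lborel) = (\<integral>y. R y \<partial>lborel)"
proof -
  have contF: "continuous_on W F" using F by (rule holomorphic_several_imp_continuous)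
  have \<tau>'0: "\<tau>' y = 0" if "y \<notin> C" for y
  proof -
    have op: "open {s. y + s *\<^sub>R \<eta> \<in> - C}"
      using continuous_open_vimage[of "- C" "\<lambda>s. y + s *\<^sub>R \<eta>"] C(1)
      by (simp add: vimage_def continuous_intros)
    have "((\<lambda>s. \<tau> (y + s *\<^sub>R \<eta>)) has_real_derivative 0) (at 0)"
      by (rule has_field_derivative_transform_within_open[OF _ op, of "\<lambda>s. 0"]) (use that \<tau>(3) in auto)
    then show ?thesis using \<tau>(4) DERIV_unique by blast
  qed
  define D where "D y = (if y \<in> V then F (cvec y (\<tau> y *\<^sub>R \<eta>)) * (1 + \<i> * of_real (\<tau>' y)) - F (cvec y 0) else 0)" for y
  \<comment> \<open>The primitive \<open>P\<close> used below depends on the chosen line. This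
    integral over the segment from the real to the shifted point is the same increment written
    without \<open>P\<close>, so that its continuity in \<open>y\<close> can be read off.\<close>
  define \<Psi> where "\<Psi> y = (if y \<in> V then integral {0..1} (\<lambda>\<theta>. \<i> * of_real (\<tau> y) * F (cvec y ((\<theta> * \<tau> y) *\<^sub>R \<eta>))) else 0)" for y
  \<comment> \<open>Over \<open>V\<close> the formulas with \<open>F\<close> are available, and off
    the closed set \<open>C\<close> the shift vanishes. These two open sets cover the space, so
    continuity can be checked on each.\<close>
  have UN: "UNIV = V \<union> (- C)" using C by auto
  have W1: "cvec y (\<tau> y *\<^sub>R \<eta>) \<in> W" "cvec y 0 \<in> W" if "y \<in> V" for y
    using inW[OF that, of 1] inW[OF that, of 0] by auto
  have D0: "D y = 0" if "y \<notin> C" for y using that \<tau>(3) \<tau>'0 by (simp add: D_def)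
  have \<Psi>0: "\<Psi> y = 0" if "y \<notin> C" for y using that \<tau>(3) by (simp add: \<Psi>_def)
  have cD: "continuous_on UNIV D" unfolding UN
  proof (rule continuous_on_open_Un[OF V])
    have "continuous_on V (\<lambda>y. F (cvec y (\<tau> y *\<^sub>R \<eta>)) * (1 + \<i> * of_real (\<tau>' y)) - F (cvec y 0))"
      by (intro continuous_intros continuous_on_compose2[OF contF] continuous_on_cvec
          continuous_on_subset[OF \<tau>(1)] continuous_on_subset[OF \<tau>(2)]) (use W1 in auto)
    then show "continuous_on V D" by (rule continuous_on_eq) (simp add: D_def)
    show "continuous_on (- C) D" by (rule continuous_on_eq[OF continuous_on_const[of _ 0]]) (simp add: D0)
  qed (use C in auto)
  have c\<Psi>: "continuous_on UNIV \<Psi>" unfolding UN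
  proof (rule continuous_on_open_Un[OF V])
    have "continuous_on (V \<times> cbox 0 1) (\<lambda>(y, \<theta>). \<i> * of_real (\<tau> y) * F (cvec y ((\<theta> * \<tau> y) *\<^sub>R \<eta>)))"
      unfolding case_prod_beta
      by (intro continuous_intros continuous_on_compose2[OF contF] continuous_on_cvec
          continuous_on_compose2[OF \<tau>(1)]) (use inW in \<open>auto simp: cbox_interval\<close>)
    from integral_continuous_on_param[OF this]
    have "continuous_on V (\<lambda>y. integral {0..1} (\<lambda>\<theta>. \<i> * of_real (\<tau> y) * F (cvec y ((\<theta> * \<tau> y) *\<^sub>R \<eta>))))"
      by (simp add: cbox_interval)
    then show "continuous_on V \<Psi>" by (rule continuous_on_eq) (simp add: \<Psi>_def)
    show "continuous_on (- C) \<Psi>" by (rule continuous_on_eq[OF continuous_on_const[of _ 0]]) (simp add: \<Psi>0)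
  qed (use C in auto)
  have deriv: "((\<lambda>s. \<Psi> (y + s *\<^sub>R \<eta>)) has_vector_derivative D y) (at 0)" for y
  proof (cases "y \<in> V")
    case False
    then have y: "y \<in> - C" using C by auto
    have op: "open {s. y + s *\<^sub>R \<eta> \<in> - C}"
      using continuous_open_vimage[of "- C" "\<lambda>s. y + s *\<^sub>R \<eta>"] C(1)
      by (simp add: vimage_def continuous_intros)
    have "((\<lambda>s. \<Psi> (y + s *\<^sub>R \<eta>)) has_vector_derivative 0) (at 0)"
      by (rule has_vector_derivative_transform_within_open[OF _ op, of "\<lambda>s. 0"]) (use y \<Psi>0 in auto)
    then show ?thesis using D0 y by simp
  next
    case True
    \<comment> \<open>The slice of \<open>W\<close> by the complex line through \<open>y\<close> in
      direction \<open>\<eta>\<close>; being convex, it carries a primitive of the restricted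
      function.\<close>
    define A where "A = {c. cvec y 0 + c *s cvec \<eta> 0 \<in> W}"
    have A: "open A" "convex A" unfolding A_def by (simp_all add: open_line_vimage convex_line_vimage W)
    define f where "f c = F (cvec y 0 + c *s cvec \<eta> 0)" for c
    have f: "f holomorphic_on A" unfolding f_def[abs_def] A_def by (rule holomorphic_on_line[OF F W(1)])
    obtain P where P: "\<And>c. c \<in> A \<Longrightarrow> (P has_field_derivative f c) (at c within A)"
      using holomorphic_convex_primitive'[OF A(2,1) f] by blast
    then have P: "(P has_field_derivative f c) (at c)" if "c \<in> A" for c
      using that A(1) at_within_open[of c A] by metis
    have op: "open {s. y + s *\<^sub>R \<eta> \<in> V}"
      using continuous_open_vimage[of V "\<lambda>s. y + s *\<^sub>R \<eta>"] V
      by (simp add: vimage_def continuous_intros)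
    have inA: "of_real s + \<i> * of_real (\<theta> * \<tau> (y + s *\<^sub>R \<eta>)) \<in> A" if "y + s *\<^sub>R \<eta> \<in> V" "0 \<le> \<theta>" "\<theta> \<le> 1" for s \<theta>
      using inW[OF that] by (simp add: A_def cvec_scale cvec_add)
    have \<Psi>P: "P (of_real s + \<i> * of_real (\<tau> (y + s *\<^sub>R \<eta>))) - P (of_real s) = \<Psi> (y + s *\<^sub>R \<eta>)"
      if s: "y + s *\<^sub>R \<eta> \<in> V" for s
    proof -
      let ?t = "\<tau> (y + s *\<^sub>R \<eta>)"
      have "((\<lambda>\<theta>. \<i> * of_real ?t * f (of_real s + \<i> * of_real (\<theta> * ?t))) has_integral
          (P (of_real s + \<i> * of_real (1 * ?t)) - P (of_real s + \<i> * of_real (0 * ?t)))) {0..1}"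
      proof (rule fundamental_theorem_of_calculus)
        fix \<theta> :: real assume \<theta>: "\<theta> \<in> {0..1}"
        have in_A: "of_real s + \<i> * of_real (\<theta> * ?t) \<in> A" using inA[OF s, of \<theta>] \<theta> by simp
        have "((\<lambda>\<theta>. of_real s + \<i> * of_real (\<theta> * ?t)) has_vector_derivative \<i> * of_real ?t) (at \<theta> within {0..1})"
          by (auto intro!: derivative_eq_intros simp: has_vector_derivative_def scaleR_conv_of_real fun_eq_iff)
        then show "((\<lambda>\<theta>. P (of_real s + \<i> * of_real (\<theta> * ?t))) has_vector_derivative
            \<i> * of_real ?t * f (of_real s + \<i> * of_real (\<theta> * ?t))) (at \<theta> within {0..1})"
          using field_vector_diff_chain_within[where f = "\<lambda>\<theta>. of_real s + \<i> * of_real (\<theta> * ?t)" and g = P,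
              OF _ has_field_derivative_at_within[OF P[OF in_A]]]
          by (simp add: o_def)
      qed simp
      moreover have "f (of_real s + \<i> * of_real (\<theta> * ?t)) = F (cvec (y + s *\<^sub>R \<eta>) ((\<theta> * ?t) *\<^sub>R \<eta>))" for \<theta>
        by (simp add: f_def cvec_scale cvec_add)
      ultimately have "((\<lambda>\<theta>. \<i> * of_real ?t * F (cvec (y + s *\<^sub>R \<eta>) ((\<theta> * ?t) *\<^sub>R \<eta>))) has_integral
          (P (of_real s + \<i> * of_real ?t) - P (of_real s))) {0..1}"
        by simp
      from integral_unique[OF this] s show ?thesis by (simp only: \<Psi>_def if_True)
    qed
    have "((\<lambda>s. P (of_real s + \<i> * of_real (\<tau> (y + s *\<^sub>R \<eta>))) - P (of_real s)) has_vector_derivative D y) (at 0)"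
    proof -

      have r: "((\<lambda>s. complex_of_real s) has_vector_derivative 1) (at 0)"
        using has_vector_derivative_of_real[of "\<lambda>s. s" 1] by (simp add: DERIV_ident)
      \<comment> \<open>The path \<open>s + \<i> \<tau>\<close> has velocity
        \<open>1 + \<i> \<tau>'\<close>. Since all points move in the single direction
        \<open>\<eta>\<close>, this is the full Jacobian determinant of the shift, and hence the
        factor in \<open>N\<close>.\<close>
      have d1: "((\<lambda>s. of_real s + \<i> * of_real (\<tau> (y + s *\<^sub>R \<eta>))) has_vector_derivative (1 + \<i> * of_real (\<tau>' y))) (at 0)"
        by (intro has_vector_derivative_add r has_vector_derivative_mult_right has_vector_derivative_of_real \<tau>(4))
      have "((\<lambda>s. P (of_real s + \<i> * of_real (\<tau> (y + s *\<^sub>R \<eta>)))) has_vector_derivative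
          (1 + \<i> * of_real (\<tau>' y)) * f (\<i> * of_real (\<tau> y))) (at 0)"
        using field_vector_diff_chain_at[OF d1, of P "f (\<i> * of_real (\<tau> y))"] P[OF inA[of 0 1]] True
        by (simp add: o_def)
      moreover have "((\<lambda>s. P (of_real s)) has_vector_derivative 1 * f 0) (at 0)"
        using field_vector_diff_chain_at[OF r, of P "f 0"] P[OF inA[of 0 0]] True
        by (simp add: o_def)
      ultimately have "((\<lambda>s. P (of_real s + \<i> * of_real (\<tau> (y + s *\<^sub>R \<eta>))) - P (of_real s)) has_vector_derivative
          (1 + \<i> * of_real (\<tau>' y)) * f (\<i> * of_real (\<tau> y)) - 1 * f 0) (at 0)"
        by (rule has_vector_derivative_diff)
      moreover have "D y = (1 + \<i> * of_real (\<tau>' y)) * f (\<i> * of_real (\<tau> y)) - 1 * f 0"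
        using True by (simp add: D_def f_def cvec_scale cvec_add mult.commute)
      ultimately show ?thesis by simp
    qed
    then show ?thesis
      by (rule has_vector_derivative_transform_within_open[OF _ op]) (use True \<Psi>P in auto)
  qed
  have "\<Psi> y = 0" if "norm y > r" for y using that C(3) by (intro \<Psi>0) auto
  note z = integral_directional_derivative_eq_0[OF c\<Psi> cD deriv this]
  have N: "N = (\<lambda>y. R y + D y)"
    using R(2) by (auto simp: N_def D_def fun_eq_iff)
  show "integrable lborel N" "(\<integral>y. N y \<partial>lborel) = (\<integral>y. R y \<partial>lborel)"
    unfolding N using z R(1) by simp_all
qed

section \<open>Test functions\<close>

lemma test_function_smooth: "test_function \<Omega> \<phi> \<Longrightarrow> smooth \<phi>"
  by (simp add: test_function_def smooth_def)

lemma test_function_nonzero: "test_function \<Omega> \<phi> \<Longrightarrow> \<phi> x \<noteq> 0 \<Longrightarrow> x \<in> \<Omega>"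
  unfolding test_function_def using closure_subset by fastforce

lemma test_function_vanishes:
  assumes "test_function \<Omega> \<phi>"
  obtains r where "\<And>y. norm y > r \<Longrightarrow> \<phi> y = 0"
proof -
  have "bounded {x. \<phi> x \<noteq> 0}"
    using assms compact_imp_bounded bounded_subset closure_subset unfolding test_function_def by metis
  then obtain r where "\<forall>x\<in>{x. \<phi> x \<noteq> 0}. norm x \<le> r" using bounded_iff by blast
  then show ?thesis using that[of r] by force
qed

lemma test_function_support_mono:
  assumes "test_function \<Omega> \<phi>" "smooth \<psi>" "{x. \<psi> x \<noteq> 0} \<subseteq> closure {x. \<phi> x \<noteq> 0}"
  shows "test_function \<Omega> \<psi>"
proof -
  have "closure {x. \<psi> x \<noteq> 0} \<subseteq> closure {x. \<phi> x \<noteq> 0}" using assms(3) by (simp add: closure_minimal)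
  then show ?thesis
    using assms compact_Int_closed[of "closure {x. \<phi> x \<noteq> 0}" "closure {x. \<psi> x \<noteq> 0}"]
    unfolding test_function_def smooth_def by (auto simp: Int_absorb1)
qed

lemma dderiv_mult:
  "smooth f \<Longrightarrow> smooth g \<Longrightarrow> dderiv b (\<lambda>x. f x * g x) = (\<lambda>x. f x * dderiv b g x + dderiv b f x * g x)"
  by (intro ext dderiv_eq has_derivative_mult smooth_has_derivative)

lemma dderiv_add:
  "smooth f \<Longrightarrow> smooth g \<Longrightarrow> dderiv b (\<lambda>x. f x + g x) = (\<lambda>x. dderiv b f x + dderiv b g x)"
  by (intro ext dderiv_eq has_derivative_add smooth_has_derivative)

lemma dderiv_const: "dderiv b (\<lambda>x. c) = (\<lambda>x. 0)"
  by (intro ext dderiv_eq has_derivative_const)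

lemma dderiv_zero: "smooth f \<Longrightarrow> dderiv 0 f x = 0"
  by (rule linear_0[OF has_derivative_linear[OF smooth_has_derivative]])

lemma dderiv_fst: "smooth f \<Longrightarrow> dderiv b (\<lambda>z. f (fst z)) = (\<lambda>z. dderiv (fst b) f (fst z))"
  by (intro ext dderiv_eq has_derivative_compose[OF has_derivative_fst[OF has_derivative_ident] smooth_has_derivative])

lemma dderiv_snd: "smooth f \<Longrightarrow> dderiv b (\<lambda>z. f (snd z)) = (\<lambda>z. dderiv (snd b) f (snd z))"
  by (intro ext dderiv_eq has_derivative_compose[OF has_derivative_snd[OF has_derivative_ident] smooth_has_derivative])

lemma dderiv_eq_0_outside:
  assumes "x \<notin> closure {x. f x \<noteq> 0}"
  shows "dderiv b f x = 0"
proof -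
  have "(f has_derivative (\<lambda>h. 0)) (at x)"
    by (rule has_derivative_transform_within_open[of "\<lambda>x. 0" _ x UNIV "- closure {x. f x \<noteq> 0}"])
       (use assms closure_subset[of "{x. f x \<noteq> 0}"] in auto)
  then show ?thesis by (rule dderiv_eq)
qed

lemma test_function_dderiv: "test_function \<Omega> \<phi> \<Longrightarrow> b \<in> Basis \<Longrightarrow> test_function \<Omega> (dderiv b \<phi>)"
  using dderiv_eq_0_outside[of _ \<phi> b]
  by (rule_tac test_function_support_mono[of \<Omega> \<phi>]) (auto intro: smooth_dderiv test_function_smooth)

lemma test_function_mult: "test_function \<Omega> \<phi> \<Longrightarrow> smooth g \<Longrightarrow> test_function \<Omega> (\<lambda>x. \<phi> x * g x)"
  using closure_subset[of "{x. \<phi> x \<noteq> 0}"]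
  by (rule_tac test_function_support_mono[of \<Omega> \<phi>]) (auto intro!: smooth_mult dest: test_function_smooth)

lemma test_function_product:
  assumes a: "test_function A a" and \<psi>: "test_function B \<psi>"
  shows "test_function (A \<times> B) (\<lambda>z. a (fst z) * \<psi> (snd z))"
proof -
  let ?K = "closure {x. a x \<noteq> 0} \<times> closure {x. \<psi> x \<noteq> 0}"
  have "closure {z. a (fst z) * \<psi> (snd z) \<noteq> 0} \<subseteq> ?K"
  proof (rule closure_minimal)
    show "{z. a (fst z) * \<psi> (snd z) \<noteq> 0} \<subseteq> ?K"
      using closure_subset[of "{x. a x \<noteq> 0}"] closure_subset[of "{x. \<psi> x \<noteq> 0}"] by auto
  qed (intro closed_Times closed_closure)
  moreover have "compact ?K" "?K \<subseteq> A \<times> B"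
    using a \<psi> unfolding test_function_def by (auto intro: compact_Times)
  ultimately have "compact (closure {z. a (fst z) * \<psi> (snd z) \<noteq> 0})"
      "closure {z. a (fst z) * \<psi> (snd z) \<noteq> 0} \<subseteq> A \<times> B"
    using compact_Int_closed[of ?K "closure {z. a (fst z) * \<psi> (snd z) \<noteq> 0}"] by (auto simp: Int_absorb1)
  moreover have "smooth (\<lambda>z. a (fst z) * \<psi> (snd z))"
    using a \<psi> by (intro smooth_mult smooth_fst smooth_snd test_function_smooth)
  ultimately show ?thesis by (simp add: test_function_def smooth_def)
qed

lemma test_function_integrable: "test_function \<Omega> \<phi> \<Longrightarrow> integrable lborel \<phi>"
  by (metis integrable_continuous_compact_support smooth_imp_continuous test_function_smooth test_function_vanishes)

lemma test_function_bounded: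
  assumes "test_function \<Omega> \<phi>"
  obtains B where "B \<ge> 0" "\<And>y. cmod (\<phi> y) \<le> B"
  by (metis assms bounded_continuous_compact_support smooth_imp_continuous test_function_smooth test_function_vanishes)

lemma smooth_borel: "smooth \<phi> \<Longrightarrow> \<phi> \<in> borel_measurable borel"
  by (simp add: borel_measurable_continuous_onI smooth_imp_continuous)

lemma integral_dderiv_eq_0:
  assumes "test_function \<Omega> \<phi>" "b \<in> Basis"
  shows "(\<integral>y. dderiv b \<phi> y \<partial>lborel) = 0"
proof -
  obtain r where r: "\<And>y. norm y > r \<Longrightarrow> \<phi> y = 0" using test_function_vanishes assms by blast
  have s: "smooth \<phi>" using assms test_function_smooth by blast
  have "((\<lambda>s. \<phi> (y + s *\<^sub>R b)) has_vector_derivative dderiv b \<phi> y) (at 0)" for y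
  proof -
    have "((\<lambda>s. y + s *\<^sub>R b) has_derivative (\<lambda>s. s *\<^sub>R b)) (at 0)"
      by (auto intro!: derivative_eq_intros)
    moreover have "(\<phi> has_derivative (\<lambda>b. dderiv b \<phi> y)) (at (y + 0 *\<^sub>R b))"
      using smooth_has_derivative[OF s] by simp
    ultimately have "((\<lambda>s. \<phi> (y + s *\<^sub>R b)) has_derivative (\<lambda>s. dderiv (s *\<^sub>R b) \<phi> y)) (at 0)"
      by (rule has_derivative_compose)
    then show ?thesis
      using linear_scale[OF has_derivative_linear[OF smooth_has_derivative[OF s]]]
      by (simp add: has_vector_derivative_def)
  qed
  then show ?thesis
    by (rule integral_directional_derivative_eq_0(2)[rotated 2])
       (use r s assms in \<open>auto intro: smooth_imp_continuous smooth_dderiv\<close>)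
qed

section \<open>Weak gradients, the negative norm and integrability of the solution\<close>

lemma weak_gradient_test_function:
  assumes "open \<Omega>" "test_function \<Omega> \<psi>"
  shows "weak_gradient \<Omega> \<psi> (\<lambda>b. dderiv b \<psi>)"
  unfolding weak_gradient_def
proof (intro ballI conjI allI impI)
  fix b :: 'a assume b: "b \<in> Basis"
  have s: "smooth \<psi>" using assms test_function_smooth by blast
  show "set_borel_measurable lborel \<Omega> (dderiv b \<psi>)"
    unfolding set_borel_measurable_def
    using assms(1) smooth_borel[OF smooth_dderiv[OF s b]]
    by (intro borel_measurable_scaleR borel_measurable_indicator) auto
  fix \<phi> assume \<phi>: "test_function \<Omega> \<phi>"
  have sp: "smooth \<phi>" using \<phi> test_function_smooth by blast
  have t: "test_function \<Omega> (\<lambda>x. \<phi> x * \<psi> x)" by (intro test_function_mult \<phi> s)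
  have t1: "test_function \<Omega> (\<lambda>x. dderiv b \<phi> x * \<psi> x)" by (intro test_function_mult test_function_dderiv \<phi> s b)
  have t2: "test_function \<Omega> (\<lambda>x. \<phi> x * dderiv b \<psi> x)" by (intro test_function_mult smooth_dderiv \<phi> s b)
  have "0 = (\<integral>x. \<phi> x * dderiv b \<psi> x + dderiv b \<phi> x * \<psi> x \<partial>lborel)"
    using integral_dderiv_eq_0[OF t b] unfolding dderiv_mult[OF sp s] by simp
  also have "\<dots> = (\<integral>x. \<phi> x * dderiv b \<psi> x \<partial>lborel) + (\<integral>x. dderiv b \<phi> x * \<psi> x \<partial>lborel)"
    using t1 t2 by (intro Bochner_Integration.integral_add test_function_integrable)
  finally have "(\<integral>x. dderiv b \<phi> x * \<psi> x \<partial>lborel) = - (\<integral>x. \<phi> x * dderiv b \<psi> x \<partial>lborel)"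
    by (simp add: eq_neg_iff_add_eq_0 add.commute)
  moreover have "(LINT x:\<Omega>|lborel. \<psi> x * dderiv b \<phi> x) = (\<integral>x. dderiv b \<phi> x * \<psi> x \<partial>lborel)"
    unfolding set_lebesgue_integral_def
    by (rule Bochner_Integration.integral_cong) (use test_function_nonzero[OF t1] in \<open>auto simp: indicator_def mult.commute\<close>)
  moreover have "(LINT x:\<Omega>|lborel. dderiv b \<psi> x * \<phi> x) = (\<integral>x. \<phi> x * dderiv b \<psi> x \<partial>lborel)"
    unfolding set_lebesgue_integral_def
    by (rule Bochner_Integration.integral_cong) (use test_function_nonzero[OF t2] in \<open>auto simp: indicator_def mult.commute\<close>)
  ultimately show "(LINT x:\<Omega>|lborel. \<psi> x * dderiv b \<phi> x) = - (LINT x:\<Omega>|lborel. dderiv b \<psi> x * \<phi> x)" by simp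
qed

lemma test_function_L2_finite:
  assumes "test_function \<Omega> \<phi>"
  shows "(\<integral>\<^sup>+x. ennreal ((cmod (\<phi> x))\<^sup>2) \<partial>lborel) < \<infinity>"
proof -
  obtain r where r: "\<And>y. norm y > r \<Longrightarrow> \<phi> y = 0" using test_function_vanishes assms by blast
  obtain B where B: "B \<ge> 0" "\<And>y. cmod (\<phi> y) \<le> B" using test_function_bounded assms by blast
  have "ennreal ((cmod (\<phi> x))\<^sup>2) \<le> ennreal (B\<^sup>2) * indicator (cball 0 r) x" for x
    using r[of x] B(2)[of x] by (cases "norm x \<le> r") (auto intro!: ennreal_leI power_mono)
  then have "(\<integral>\<^sup>+x. ennreal ((cmod (\<phi> x))\<^sup>2) \<partial>lborel) \<le> (\<integral>\<^sup>+x. ennreal (B\<^sup>2) * indicator (cball 0 r) (x::'a) \<partial>lborel)"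
    by (intro nn_integral_mono)
  also have "\<dots> = ennreal (B\<^sup>2) * emeasure lborel (cball (0::'a) r)"
    by (rule nn_integral_cmult_indicator) simp
  also have "\<dots> < \<infinity>"
    using emeasure_bounded_finite[OF bounded_cball, of "0::'a" r] by (simp add: ennreal_mult_less_top)
  finally show ?thesis .
qed

text \<open>The negative norm is a supremum over a unit ball of test functions, so a given test
  function has to be scaled into that ball before it can be inserted. The summand 1 in
  \<open>c = 1 / sqrt (n + 1)\<close> covers the zero function.\<close>

lemma H1_norm2_scale_le_1:
  assumes "open \<Omega>" "test_function \<Omega> \<psi>"
  obtains c where "c > 0" "H1_norm2 \<Omega> (\<lambda>x. of_real c * \<psi> x) \<le> 1"
proof -
  define N where "N = (\<integral>\<^sup>+x. ennreal ((cmod (\<psi> x))\<^sup>2) \<partial>lborel)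
      + (\<Sum>b\<in>Basis. \<integral>\<^sup>+x. ennreal ((cmod (dderiv b \<psi> x))\<^sup>2) \<partial>lborel)"
  have s: "smooth \<psi>" using assms test_function_smooth by blast
  have "N < \<infinity>" unfolding N_def
    using test_function_L2_finite[OF assms(2)] test_function_L2_finite[OF test_function_dderiv[OF assms(2)]]
    by (simp add: ennreal_add_eq_top less_top)
  then obtain n where n: "N = ennreal n" "n \<ge> 0" by (cases N) auto
  define c where "c = 1 / sqrt (n + 1)"
  have c: "c > 0" using n by (simp add: c_def)
  have c2: "c\<^sup>2 = 1 / (n + 1)" using n by (simp add: c_def power_divide)
  have test: "test_function \<Omega> (\<lambda>x. of_real c * \<psi> x)"
    using test_function_mult[OF assms(2) smooth_const[of "of_real c"]] by (simp add: mult.commute)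
  have dd: "dderiv b (\<lambda>x. of_real c * \<psi> x) = (\<lambda>x. of_real c * dderiv b \<psi> x)" for b
    using dderiv_mult[OF smooth_const s] by (simp add: dderiv_const)
  have sc: "(\<integral>\<^sup>+x\<in>\<Omega>. ennreal ((cmod (of_real c * f x))\<^sup>2) \<partial>lborel)
      \<le> ennreal (c\<^sup>2) * (\<integral>\<^sup>+x. ennreal ((cmod (f x))\<^sup>2) \<partial>lborel)" if [measurable]: "f \<in> borel_measurable borel" for f
  proof -
    have "(\<integral>\<^sup>+x\<in>\<Omega>. ennreal ((cmod (of_real c * f x))\<^sup>2) \<partial>lborel) \<le> (\<integral>\<^sup>+x. ennreal (c\<^sup>2) * ennreal ((cmod (f x))\<^sup>2) \<partial>lborel)"
      by (intro nn_integral_mono) (auto simp: indicator_def norm_mult power_mult_distrib ennreal_mult)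
    also have "\<dots> = ennreal (c\<^sup>2) * (\<integral>\<^sup>+x. ennreal ((cmod (f x))\<^sup>2) \<partial>lborel)"
      by (rule nn_integral_cmult) simp
    finally show ?thesis .
  qed
  have "H1_norm2 \<Omega> (\<lambda>x. of_real c * \<psi> x) \<le> (\<integral>\<^sup>+x\<in>\<Omega>. ennreal ((cmod (of_real c * \<psi> x))\<^sup>2) \<partial>lborel) +
      (\<Sum>b\<in>Basis. \<integral>\<^sup>+x\<in>\<Omega>. ennreal ((cmod (of_real c * dderiv b \<psi> x))\<^sup>2) \<partial>lborel)"
    unfolding H1_norm2_def
    using weak_gradient_test_function[OF assms(1) test] unfolding dd
    by (intro add_left_mono INF_lower2[of "\<lambda>b x. of_real c * dderiv b \<psi> x"]) auto
  also have "\<dots> \<le> ennreal (c\<^sup>2) * N" unfolding N_def distrib_left sum_distrib_left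
    by (intro add_mono sum_mono sc smooth_borel s smooth_dderiv)
  also have "\<dots> = ennreal (c\<^sup>2 * n)" using n by (simp add: ennreal_mult)
  also have "\<dots> \<le> 1" using n by (simp add: c2 field_simps)
  finally show ?thesis using that c by blast
qed

text \<open>Evaluation at a fixed test function is bounded by a multiple of \<open>Hm1_norm\<close>,
  so continuity in the negative norm passes to every scalar function obtained in this way.\<close>

lemma Hm1_path_continuous:
  assumes "open \<Omega>" "test_function \<Omega> \<psi>"
    and w: "\<And>t. t \<in> I \<Longrightarrow> w t \<in> Hm1 \<Omega>"
    and lim: "\<And>t. t \<in> I \<Longrightarrow> ((\<lambda>s. Hm1_norm \<Omega> (\<lambda>\<phi>. w s \<phi> - w t \<phi>)) \<longlongrightarrow> 0) (at t within I)"
  shows "continuous_on I (\<lambda>t. w t \<psi>)"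
  unfolding continuous_on_def
proof
  fix t assume t: "t \<in> I"
  obtain c where c: "c > 0" "H1_norm2 \<Omega> (\<lambda>x. of_real c * \<psi> x) \<le> 1"
    using H1_norm2_scale_le_1[OF assms(1,2)] .
  have test: "test_function \<Omega> (\<lambda>x. of_real c * \<psi> x)"
    using test_function_mult[OF assms(2) smooth_const[of "of_real c"]] by (simp add: mult.commute)
  have sc: "w s (\<lambda>x. of_real c * \<psi> x) = of_real c * w s \<psi>" if "s \<in> I" for s
    using w[OF that] assms(2) unfolding Hm1_def by blast
  have le: "ennreal (c * cmod (w s \<psi> - w t \<psi>)) \<le> Hm1_norm \<Omega> (\<lambda>\<phi>. w s \<phi> - w t \<phi>)" if "s \<in> I" for s
  proof -
    have "ennreal (c * cmod (w s \<psi> - w t \<psi>)) = ennreal (cmod (w s (\<lambda>x. of_real c * \<psi> x) - w t (\<lambda>x. of_real c * \<psi> x)))"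
      using c(1) unfolding sc[OF that] sc[OF t] right_diff_distrib[symmetric] norm_mult by simp
    also have "\<dots> \<le> Hm1_norm \<Omega> (\<lambda>\<phi>. w s \<phi> - w t \<phi>)"
      unfolding Hm1_norm_def by (rule SUP_upper) (use test c in auto)
    finally show ?thesis .
  qed
  have "((\<lambda>s. ennreal (c * cmod (w s \<psi> - w t \<psi>))) \<longlongrightarrow> 0) (at t within I)"
    by (rule tendsto_sandwich[OF _ _ tendsto_const lim[OF t]]) (use le in \<open>auto simp: eventually_at_filter\<close>)
  then have "((\<lambda>s. c * cmod (w s \<psi> - w t \<psi>)) \<longlongrightarrow> 0) (at t within I)"
    using tendsto_ennrealD[of "\<lambda>s. c * cmod (w s \<psi> - w t \<psi>)" 0 "at t within I"] c(1) by simp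
  from tendsto_mult[OF tendsto_const[of "inverse c"] this]
  have "((\<lambda>s. cmod (w s \<psi> - w t \<psi>)) \<longlongrightarrow> 0) (at t within I)" using c(1) by (simp flip: mult.assoc)
  then show "((\<lambda>s. w s \<psi>) \<longlongrightarrow> w t \<psi>) (at t within I)"
    by (simp add: LIM_zero_cancel tendsto_norm_zero_iff)
qed

text \<open>Finiteness of the norm puts an extension \<open>U\<close> of \<open>u\<close> into L2;
  on the bounded set \<open>?Q\<close> the inequality \<open>a \<le> 1 + a\<^sup>2\<close> then
  gives integrability.\<close>

lemma HQ_set_integrable:
  fixes \<Omega> :: "'a::euclidean_space set"
  assumes u: "u \<in> HQ T \<Omega>" and "bounded \<Omega>" "open \<Omega>"
  shows "set_integrable lborel ({0<..<T} \<times> \<Omega>) u"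
proof -
  let ?Q = "{0<..<T} \<times> \<Omega>"
  have Q: "open ?Q" "bounded ?Q" using assms by (auto intro: open_Times bounded_Times)
  have m: "set_borel_measurable lborel ?Q u"
    and fin: "aniso_restr_norm2 (H1_norm2 UNIV) lborel (1/2) T \<Omega> u < \<infinity>"
    using u by (auto simp: HQ_def aniso_restr_space_def lborel_prod)
  obtain U where U: "U \<in> borel_measurable lborel" "AE z in lborel. z \<in> ?Q \<longrightarrow> U z = u z"
      "aniso_norm2 (H1_norm2 UNIV) lborel (1/2) U < \<infinity>"
    using fin unfolding aniso_restr_norm2_def INF_less_iff lborel_prod by auto
  have "(\<integral>\<^sup>+z. ennreal ((cmod (U z))\<^sup>2) \<partial>lborel) = (\<integral>\<^sup>+t. L2_norm2 lborel (\<lambda>x. U (t, x)) \<partial>lborel)"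
    unfolding L2_norm2_def lborel_prod[symmetric]
    by (rule lborel.nn_integral_fst[symmetric]) (use U(1) in \<open>simp add: lborel_prod\<close>)
  also have "\<dots> \<le> aniso_norm2 (H1_norm2 UNIV) lborel (1/2) U"
    unfolding aniso_norm2_def by (rule add_increasing[OF zero_le add_increasing2[OF zero_le order_refl]])
  finally have L2: "(\<integral>\<^sup>+z. ennreal ((cmod (U z))\<^sup>2) \<partial>lborel) < \<infinity>" using U(3) by simp
  have "(\<integral>\<^sup>+z. ennreal (norm (indicator ?Q z *\<^sub>R u z)) \<partial>lborel)
      \<le> (\<integral>\<^sup>+z. indicator ?Q z + ennreal ((cmod (U z))\<^sup>2) \<partial>lborel)"
  proof (rule nn_integral_mono_AE, use U(2) in eventually_elim)
    fix z assume z: "z \<in> ?Q \<longrightarrow> U z = u z"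
    have "a \<le> 1 + a\<^sup>2" if "a \<ge> 0" for a :: real
    proof -
      have "0 \<le> (a - 1)\<^sup>2" by simp
      then show ?thesis using that by (simp add: power2_eq_square algebra_simps)
    qed
    then have "cmod (U z) \<le> 1 + (cmod (U z))\<^sup>2" by simp
    then have "ennreal (cmod (U z)) \<le> 1 + ennreal ((cmod (U z))\<^sup>2)"
      by (metis ennreal_1 ennreal_leI ennreal_plus zero_le_one zero_le_power2)
    then show "ennreal (norm (indicator ?Q z *\<^sub>R u z)) \<le> indicator ?Q z + ennreal ((cmod (U z))\<^sup>2)"
      using z by (auto simp: indicator_def)
  qed
  also have "\<dots> = emeasure lborel ?Q + (\<integral>\<^sup>+z. ennreal ((cmod (U z))\<^sup>2) \<partial>lborel)"
    using U(1) Q by (subst nn_integral_add) auto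
  also have "\<dots> < \<infinity>" using L2 emeasure_bounded_finite[OF Q(2)] by simp
  finally show ?thesis
    using m unfolding set_integrable_def set_borel_measurable_def by (intro integrableI_bounded)
qed

section \<open>The heat equation tested against functions of the space variable\<close>

lemma integrable_fst_lborel:
  fixes f :: "'a::euclidean_space \<times> 'b::euclidean_space \<Rightarrow> complex"
  shows "integrable lborel f \<Longrightarrow> integrable lborel (\<lambda>x. \<integral>y. f (x, y) \<partial>lborel)"
    and integral_fst_lborel: "integrable lborel f \<Longrightarrow> (\<integral>x. \<integral>y. f (x, y) \<partial>lborel \<partial>lborel) = (\<integral>z. f z \<partial>lborel)"
    and integral_snd_lborel: "integrable lborel f \<Longrightarrow> (\<integral>y. \<integral>x. f (x, y) \<partial>lborel \<partial>lborel) = (\<integral>z. f z \<partial>lborel)"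
  using lborel_pair.integrable_fst'[of f] lborel_pair.integral_fst'[of f]
    lborel_pair.Fubini_integral[of "\<lambda>x y. f (x, y)"]
  by (simp_all add: lborel_prod)

lemma integrable_times_lborel:
  fixes a :: "'a::euclidean_space \<Rightarrow> complex" and v :: "'b::euclidean_space \<Rightarrow> complex"
  assumes "integrable lborel a" "integrable lborel v"
  shows "integrable lborel (\<lambda>z. a (fst z) * v (snd z))"
proof -
  have [measurable]: "a \<in> borel_measurable borel" "v \<in> borel_measurable borel"
    using assms by auto
  have "integrable (lborel \<Otimes>\<^sub>M lborel) (\<lambda>z. a (fst z) * v (snd z))"
  proof (rule lborel_pair.Fubini_integrable)
    show "(\<lambda>z. a (fst z) * v (snd z)) \<in> borel_measurable (lborel \<Otimes>\<^sub>M lborel)" by measurable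
    show "integrable lborel (\<lambda>x. \<integral>y. norm (a (fst (x, y)) * v (snd (x, y))) \<partial>lborel)"
      using assms(1) by (simp add: norm_mult)
    show "AE x in lborel. integrable lborel (\<lambda>y. a (fst (x, y)) * v (snd (x, y)))"
      using assms(2) by simp
  qed
  then show ?thesis by (simp add: lborel_prod)
qed

lemma test_functionI:
  assumes "smooth f" "compact K" "K \<subseteq> \<Omega>" "\<And>x. x \<notin> K \<Longrightarrow> f x = 0"
  shows "test_function \<Omega> f"
proof -
  have "closure {x. f x \<noteq> 0} \<subseteq> K"
    using assms by (intro closure_minimal) (auto intro: compact_imp_closed)
  moreover from this have "compact (closure {x. f x \<noteq> 0})"
    using assms(2) compact_Int_closed[of K "closure {x. f x \<noteq> 0}"] by (simp add: Int_absorb1)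
  ultimately show ?thesis using assms unfolding test_function_def smooth_def by blast
qed

section \<open>Mollification in time and weak derivatives in one variable\<close>

definition step' :: "real \<Rightarrow> complex" where "step' = dderiv 1 smooth_step"

lemma smooth_step': "smooth step'"
  unfolding step'_def by (intro smooth_dderiv smooth_smooth_step) simp

lemma smooth_step_has_vector_derivative: "(smooth_step has_vector_derivative step' x) (at x)"
proof -
  have "dderiv h smooth_step x = h *\<^sub>R step' x" for h
    using linear_scale[OF has_derivative_linear[OF smooth_has_derivative[OF smooth_smooth_step, of x]], of h 1]
    by (simp add: step'_def)
  then show ?thesis using smooth_has_derivative[OF smooth_smooth_step, of x]
    by (simp add: has_vector_derivative_def)
qed

lemma step'_eq_0: "x \<notin> {0..1} \<Longrightarrow> step' x = 0"
proof -
  assume x: "x \<notin> {0..1}"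
  then consider "x < 0" | "x > 1" by fastforce
  then have "(smooth_step has_vector_derivative 0) (at x)"
  proof cases
    case 1
    have "((\<lambda>x. 0) has_vector_derivative 0) (at x)" by simp
    then show ?thesis
      by (rule has_vector_derivative_transform_within_open[of _ _ _ "{..<0}"])
         (use 1 in \<open>auto simp: smooth_step_0\<close>)
  next
    case 2
    have "((\<lambda>x. 1) has_vector_derivative 0) (at x)" by simp
    then show ?thesis
      by (rule has_vector_derivative_transform_within_open[of _ _ _ "{1<..}"])
         (use 2 in \<open>auto simp: smooth_step_1\<close>)
  qed
  then show "step' x = 0" using smooth_step_has_vector_derivative vector_derivative_unique_at by blast
qed

lemma step'_integrable: "integrable lborel step'"
  by (rule integrable_continuous_compact_support[of _ 1])
     (auto intro: smooth_imp_continuous smooth_step' step'_eq_0)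

lemma integral_step': "(\<integral>x. step' x \<partial>lborel) = 1"
proof -
  have "(\<integral>x. indicator {0..1} x *\<^sub>R step' x \<partial>lborel) = smooth_step 1 - smooth_step 0"
    by (rule integral_FTC_Icc)
       (auto intro: has_vector_derivative_at_within smooth_step_has_vector_derivative smooth_imp_continuous smooth_step')
  moreover have "(\<lambda>x. indicator {0..1} x *\<^sub>R step' x) = step'"
    using step'_eq_0 by (fastforce simp: indicator_def)
  ultimately show ?thesis by (simp add: smooth_step_0 smooth_step_1)
qed

text \<open>The rescaled \<open>step'\<close> form an approximate identity at \<open>c\<close>: each
  has integral 1, and their supports shrink to \<open>c\<close> from the right.\<close>

lemma integral_step'_tendsto:
  fixes m :: "real \<Rightarrow> complex"
  assumes m: "m \<in> borel_measurable borel" "\<And>s. cmod (m s) \<le> B" "isCont m c"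
    and e: "\<And>n. e n > 0" "e \<longlonglongrightarrow> 0"
  shows "(\<lambda>n. \<integral>s. of_real (inverse (e n)) * step' ((s - c) / e n) * m s \<partial>lborel) \<longlonglongrightarrow> m c"
proof -
  have "(\<integral>s. of_real (inverse (e n)) * step' ((s - c) / e n) * m s \<partial>lborel) = (\<integral>r. step' r * m (c + e n * r) \<partial>lborel)" for n
    using e(1)[of n]
    by (subst lborel_integral_real_affine[of "e n" _ c]) (auto simp: scaleR_conv_of_real mult.assoc)
  moreover have "(\<lambda>n. \<integral>r. step' r * m (c + e n * r) \<partial>lborel) \<longlonglongrightarrow> (\<integral>r. step' r * m c \<partial>lborel)"
  proof (rule tendsto_integral_mult_bounded[OF step'_integrable, where B = B])
    show "(\<lambda>r. m (c + e n * r)) \<in> borel_measurable lborel" for n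
      using m(1) by measurable
    show "AE r in lborel. (\<lambda>n. m (c + e n * r)) \<longlonglongrightarrow> m c"
    proof (intro AE_I2 isCont_tendsto_compose[OF m(3)])
      fix r
      have "(\<lambda>n. c + e n * r) \<longlonglongrightarrow> c + 0 * r" by (intro tendsto_intros e)
      then show "(\<lambda>n. c + e n * r) \<longlonglongrightarrow> c" by simp
    qed
  qed (use m in auto)
  moreover have "(\<integral>r. step' r * m c \<partial>lborel) = m c"
    using integral_step' by (simp add: step'_integrable)
  ultimately show ?thesis by (simp only:)
qed

lemma smooth_affine: "smooth (\<lambda>s::real. complex_of_real ((s - c) / e))"
proof -
  have "smooth (\<lambda>s::real. (complex_of_real (s \<bullet> 1) - complex_of_real c) * complex_of_real (inverse e))"
    by (intro smooth_mult smooth_diff smooth_inner smooth_const)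
  then show ?thesis by (simp add: divide_inverse)
qed

lemma smooth_step_bounded: obtains B where "\<And>x. cmod (smooth_step x) \<le> B"
proof -
  have "compact (smooth_step ` {0..1})"
    by (intro compact_continuous_image smooth_imp_continuous smooth_smooth_step) auto
  then obtain B where B: "\<forall>w\<in>smooth_step ` {0..1}. norm w \<le> B" using compact_imp_bounded bounded_iff by blast
  have "cmod (smooth_step x) \<le> max B 1" for x
    using B smooth_step_0[of x] smooth_step_1[of x] by (cases "x \<in> {0..1}") (auto simp: le_max_iff_disj)
  then show ?thesis using that by blast
qed

text \<open>Here \<open>n\<close> has the weak derivative \<open>g\<close> and a version
  \<open>m\<close> that is continuous up to 0. Testing with smooth approximations of the indicator
  of \<open>{s1<..s2}\<close> gives the increment of \<open>m\<close> between interior points; the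
  endpoint 0 is then reached by continuity.\<close>

lemma weak_derivative_imp_integral:
  fixes m n g :: "real \<Rightarrow> complex"
  assumes m: "continuous_on {0..T} m" and n: "n \<in> borel_measurable borel"
    and nm: "AE s in lborel. s \<in> {0<..<T} \<longrightarrow> n s = m s" and g: "integrable lborel g"
    and eq: "\<And>a. test_function {0<..<T} a \<Longrightarrow> - (\<integral>s. dderiv 1 a s * n s \<partial>lborel) = (\<integral>s. a s * g s \<partial>lborel)"
    and s: "0 < s" "s < T"
  shows "m s - m 0 = (\<integral>r. indicator {0<..<s} r * g r \<partial>lborel)"
proof -
  have T: "T > 0" using s by simp
  obtain B where B: "\<And>x. cmod (smooth_step x) \<le> B" using smooth_step_bounded by blast
  \<comment> \<open>Extension by 0 makes the continuous function bounded and measurable on the whole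
    axis; near interior points nothing changes.\<close>
  define M where "M r = indicator {0..T} r *\<^sub>R m r" for r
  have [measurable]: "M \<in> borel_measurable borel" unfolding M_def[abs_def]
    by (rule borel_measurable_continuous_on_indicator[OF _ m]) simp
  have "compact (m ` {0..T})" by (intro compact_continuous_image m) auto
  then obtain C where C: "\<forall>w\<in>m ` {0..T}. norm w \<le> C" using compact_imp_bounded bounded_iff by blast
  then have C0: "C \<ge> 0" using T norm_ge_zero order_trans by (metis atLeastAtMost_iff imageI less_imp_le order_refl)
  have M_bd: "cmod (M r) \<le> C" for r using C C0 by (auto simp: M_def indicator_def)
  have M_cont: "isCont M r" if "0 < r" "r < T" for r
  proof -
    have "isCont m r" using continuous_on_interior[OF m, of r] that by simp
    moreover have "\<forall>\<^sub>F x in nhds r. M x = m x"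
      by (rule eventually_nhds_in_open[of "{0<..<T}", THEN eventually_mono]) (use that in \<open>auto simp: M_def\<close>)
    ultimately show ?thesis using isCont_cong by blast
  qed
  have main: "m s2 - m s1 = (\<integral>r. indicator {s1<..s2} r * g r \<partial>lborel)" if s12: "0 < s1" "s1 < s2" "s2 < T" for s1 s2
  proof -
    \<comment> \<open>The descent of the test function runs from \<open>s2\<close> to
      \<open>s2 + e k\<close> and has to end before \<open>T\<close>.\<close>
    define e where "e k = (T - s2) / 2 / real (Suc k)" for k
    have e: "e k > 0" "s2 + e k < T" for k
    proof -
      show "e k > 0" using s12 by (simp add: e_def)
      have "e k \<le> (T - s2) / 2 / 1" unfolding e_def using s12 by (intro divide_left_mono) auto
      then show "s2 + e k < T" using s12 by (simp add: field_simps)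
    qed
    have "(\<lambda>k. (T - s2) / 2 * inverse (real (Suc k))) \<longlonglongrightarrow> (T - s2) / 2 * 0"
      by (intro tendsto_mult tendsto_const LIMSEQ_inverse_real_of_nat)
    then have e0: "e \<longlonglongrightarrow> 0" by (simp only: e_def[abs_def] divide_inverse[of _ "real (Suc _)"] mult_zero_right)
    \<comment> \<open>The derivative consists of one mollifier at \<open>s1\<close> and one with the
      opposite sign at \<open>s2\<close>, so its pairing with \<open>M\<close> tends to
      \<open>M s1 - M s2\<close>.\<close>
    define a where "a k r = smooth_step ((r - s1) / e k) - smooth_step ((r - s2) / e k)" for k r
    have sm: "smooth (\<lambda>r. smooth_step ((r - c) / e k))" for c k
      by (rule smooth_compose_real[OF smooth_smooth_step smooth_affine])
    have a: "test_function {0<..<T} (a k)" for k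
    proof (rule test_functionI[of _ "{s1..s2 + e k}"])
      show "smooth (a k)" unfolding a_def[abs_def] by (intro smooth_diff sm)
      show "{s1..s2 + e k} \<subseteq> {0<..<T}" using s12 e[of k] by auto
      show "a k x = 0" if "x \<notin> {s1..s2 + e k}" for x
      proof (cases "x < s1")
        case True
        then show ?thesis using e[of k] s12 by (simp add: a_def smooth_step_0 divide_le_0_iff)
      next
        case False
        then have "1 \<le> (x - s1) / e k" "1 \<le> (x - s2) / e k" using that e[of k] s12 by (auto simp: field_simps)
        then show ?thesis by (simp add: a_def smooth_step_1)
      qed
    qed simp
    have da: "dderiv 1 (a k) r = of_real (inverse (e k)) * step' ((r - s1) / e k) - of_real (inverse (e k)) * step' ((r - s2) / e k)" for k r
    proof -
      have "((\<lambda>r. smooth_step ((r - c) / e k)) has_vector_derivative inverse (e k) *\<^sub>R step' ((r - c) / e k)) (at r)" for c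
      proof -
        have "((\<lambda>r. (r - c) / e k) has_vector_derivative inverse (e k)) (at r)"
          using e[of k] by (auto intro!: derivative_eq_intros simp: has_real_derivative_iff_has_vector_derivative[symmetric] divide_inverse)
        from vector_diff_chain_at[OF this smooth_step_has_vector_derivative] show ?thesis by (simp add: o_def)
      qed
      then have "(a k has_vector_derivative (inverse (e k) *\<^sub>R step' ((r - s1) / e k) - inverse (e k) *\<^sub>R step' ((r - s2) / e k))) (at r)"
        unfolding a_def[abs_def] by (intro has_vector_derivative_diff)
      from dderiv_eq[OF this[unfolded has_vector_derivative_def], of 1] show ?thesis
        by (simp add: scaleR_conv_of_real)
    qed
    have "(\<lambda>k. \<integral>r. dderiv 1 (a k) r * M r \<partial>lborel) \<longlonglongrightarrow> M s1 - M s2"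
    proof -
      have int: "integrable lborel (\<lambda>r. of_real (inverse (e k)) * step' ((r - c) / e k) * M r)" for c k
      proof (rule integrable_mult_bounded[where B = C])
        show "integrable lborel (\<lambda>r. of_real (inverse (e k)) * step' ((r - c) / e k))"
        proof (intro integrable_mult_right, rule integrable_continuous_compact_support[of _ "\<bar>c\<bar> + e k"])
          show "continuous_on UNIV (\<lambda>r. step' ((r - c) / e k))"
            using e[of k] by (intro continuous_on_compose2[OF smooth_imp_continuous[OF smooth_step', of UNIV]] continuous_intros) auto
          show "step' ((y - c) / e k) = 0" if "norm y > \<bar>c\<bar> + e k" for y
          proof (rule step'_eq_0)
            show "(y - c) / e k \<notin> {0..1}" using that e[of k] by (auto simp: field_simps)
          qed
        qed
      qed (use M_bd in auto)
      have "(\<integral>r. dderiv 1 (a k) r * M r \<partial>lborel) =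
          (\<integral>r. of_real (inverse (e k)) * step' ((r - s1) / e k) * M r \<partial>lborel) -
          (\<integral>r. of_real (inverse (e k)) * step' ((r - s2) / e k) * M r \<partial>lborel)" for k
        unfolding da left_diff_distrib by (rule Bochner_Integration.integral_diff[OF int int])
      then show ?thesis
        using s12 by (simp only:) (intro tendsto_diff integral_step'_tendsto[where B = C] M_bd M_cont e e0; simp)
    qed
    moreover have "(\<integral>r. dderiv 1 (a k) r * M r \<partial>lborel) = (\<integral>r. dderiv 1 (a k) r * n r \<partial>lborel)" for k
    proof (rule integral_cong_AE)
      have d: "test_function {0<..<T} (dderiv 1 (a k))" by (intro test_function_dderiv a) simp
      then have [measurable]: "dderiv 1 (a k) \<in> borel_measurable borel" using smooth_borel test_function_smooth by blast
      show "(\<lambda>r. dderiv 1 (a k) r * M r) \<in> borel_measurable lborel" "(\<lambda>r. dderiv 1 (a k) r * n r) \<in> borel_measurable lborel"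
        using n by measurable
      show "AE r in lborel. dderiv 1 (a k) r * M r = dderiv 1 (a k) r * n r"
        using nm
      proof eventually_elim
        case (elim r)
        then show ?case
        proof (cases "r \<in> {0<..<T}")
          case False
          then have "dderiv 1 (a k) r = 0" using test_function_nonzero[OF d, of r] by blast
          then show ?thesis by simp
        qed (simp add: M_def)
      qed
    qed
    ultimately have "(\<lambda>k. \<integral>r. dderiv 1 (a k) r * n r \<partial>lborel) \<longlonglongrightarrow> m s1 - m s2"
      using s12 by (simp add: M_def)
    then have L: "(\<lambda>k. - (\<integral>r. dderiv 1 (a k) r * n r \<partial>lborel)) \<longlonglongrightarrow> - (m s1 - m s2)"
      by (rule tendsto_minus)
    have "(\<lambda>k. \<integral>r. g r * a k r \<partial>lborel) \<longlonglongrightarrow> (\<integral>r. g r * indicator {s1<..s2} r \<partial>lborel)"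
    proof (rule tendsto_integral_mult_bounded[OF g, where B = "2 * B"])
      show "a k \<in> borel_measurable lborel" for k using a smooth_borel test_function_smooth by auto
      show "AE x in lborel. cmod (a k x) \<le> 2 * B" for k
        unfolding a_def mult_2 by (intro AE_I2 order_trans[OF norm_triangle_ineq4] add_mono B)
      have conv: "(\<lambda>k. smooth_step ((x - c) / e k)) \<longlonglongrightarrow> indicator {c<..} x" for x c
      proof (cases "x \<le> c")
        case True
        have "smooth_step ((x - c) / e k) = 0" for k
          using True e(1)[of k] by (intro smooth_step_0) (simp add: divide_le_0_iff)
        then show ?thesis using True by simp
      next
        case False
        have "\<forall>\<^sub>F k in sequentially. e k < x - c" using e0 False by (intro order_tendstoD) auto
        then have "\<forall>\<^sub>F k in sequentially. smooth_step ((x - c) / e k) = 1"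
          by eventually_elim (use e(1) in \<open>auto intro!: smooth_step_1 simp: field_simps\<close>)
        then show ?thesis using False by (simp add: tendsto_eventually)
      qed
      show "AE x in lborel. (\<lambda>k. a k x) \<longlonglongrightarrow> indicator {s1<..s2} x"
      proof (intro AE_I2)
        fix x
        have "(\<lambda>k. a k x) \<longlonglongrightarrow> indicator {s1<..} x - indicator {s2<..} x"
          unfolding a_def by (intro tendsto_diff conv)
        moreover have "indicator {s1<..} x - indicator {s2<..} x = (indicator {s1<..s2} x :: complex)"
          using s12 by (auto simp: indicator_def)
        ultimately show "(\<lambda>k. a k x) \<longlonglongrightarrow> indicator {s1<..s2} x" by simp
      qed
    qed simp
    with L have "- (m s1 - m s2) = (\<integral>r. g r * indicator {s1<..s2} r \<partial>lborel)"
      unfolding eq[OF a] mult.commute[of "g _"] by (rule LIMSEQ_unique)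
    then show ?thesis by (simp add: mult.commute)
  qed
  \<comment> \<open>Left endpoints strictly between 0 and \<open>s\<close>, which is why the
    denominator starts at 2. Continuity of \<open>m\<close> at 0 now brings in the initial
    value.\<close>
  define e where "e k = s / real (Suc (Suc k))" for k
  have e: "0 < e k" "e k < s" for k
    using s by (auto simp: e_def field_simps intro: add_pos_nonneg)
  have "(\<lambda>k. s * inverse (real (Suc (Suc k)))) \<longlonglongrightarrow> s * 0"
    by (intro tendsto_mult tendsto_const LIMSEQ_Suc[OF LIMSEQ_inverse_real_of_nat])
  then have e0: "e \<longlonglongrightarrow> 0" by (simp only: e_def[abs_def] divide_inverse[of _ "real (Suc _)"] mult_zero_right)
  have "(\<lambda>k. \<integral>r. g r * indicator {e k<..s} r \<partial>lborel) \<longlonglongrightarrow> (\<integral>r. g r * indicator {0<..s} r \<partial>lborel)"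
  proof (rule tendsto_integral_mult_bounded[OF g, where B = 1])
    show "AE x in lborel. (\<lambda>k. indicator {e k<..s} x :: complex) \<longlonglongrightarrow> indicator {0<..s} x"
    proof (intro AE_I2)
      fix x
      show "(\<lambda>k. indicator {e k<..s} x :: complex) \<longlonglongrightarrow> indicator {0<..s} x"
      proof (cases "x > 0")
        case True
        then have "\<forall>\<^sub>F k in sequentially. e k < x" using e0 by (intro order_tendstoD)
        then have "\<forall>\<^sub>F k in sequentially. indicator {e k<..s} x = (indicator {0<..s} x :: complex)"
          by eventually_elim (use True in \<open>auto simp: indicator_def\<close>)
        then show ?thesis by (rule tendsto_eventually)
      next
        case False
        then have "indicator {e k<..s} x = (0 :: complex)" for k using e(1)[of k] by (auto simp: indicator_def)
        then show ?thesis using False by simp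
      qed
    qed
  qed (auto simp: indicator_def)
  moreover have "(\<integral>r. g r * indicator {e k<..s} r \<partial>lborel) = m s - m (e k)" for k
    using main[of "e k" s] e[of k] s by (simp add: mult.commute)
  moreover have "(\<lambda>k. m s - m (e k)) \<longlonglongrightarrow> m s - m 0"
  proof (intro tendsto_diff tendsto_const continuous_on_tendsto_compose[OF m e0])
    show "\<forall>\<^sub>F k in sequentially. e k \<in> {0..T}"
    proof (intro always_eventually allI)
      show "e k \<in> {0..T}" for k using e[of k] s by simp
    qed
  qed (use T in auto)
  ultimately have "m s - m 0 = (\<integral>r. g r * indicator {0<..s} r \<partial>lborel)"
    using LIMSEQ_unique by fastforce
  also have "\<dots> = (\<integral>r. indicator {0<..<s} r * g r \<partial>lborel)"
  proof (rule integral_cong_AE)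
    show "AE r in lborel. g r * indicator {0<..s} r = indicator {0<..<s} r * g r"
      using AE_lborel_singleton[of s] by eventually_elim (auto simp: indicator_def)
  qed (use g in auto)
  finally show ?thesis .
qed

section \<open>The equation integrated in time\<close>

definition lap :: "('a::euclidean_space \<Rightarrow> complex) \<Rightarrow> 'a \<Rightarrow> complex" where
  "lap \<psi> y = (\<Sum>b\<in>Basis. dderiv b (dderiv b \<psi>) y)"

lemma smooth_lap: "smooth \<psi> \<Longrightarrow> smooth (lap \<psi>)"
  unfolding lap_def[abs_def] by (intro smooth_sum smooth_dderiv)

lemma lap_bounded:
  assumes "test_function \<Omega> \<psi>"
  obtains B where "\<And>y. cmod (lap \<psi> y) \<le> B"
proof -
  have "\<forall>b\<in>Basis. \<exists>B. \<forall>y. cmod (dderiv b (dderiv b \<psi>) y) \<le> B"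
    using test_function_bounded[OF test_function_dderiv[OF test_function_dderiv[OF assms]]] by metis
  then obtain B where "\<And>b y. b \<in> Basis \<Longrightarrow> cmod (dderiv b (dderiv b \<psi>) y) \<le> B b" by metis
  then have "cmod (lap \<psi> y) \<le> (\<Sum>b\<in>Basis. B b)" for y
    unfolding lap_def by (intro sum_norm_le) auto
  then show ?thesis using that by blast
qed

text \<open>Products \<open>a (fst z) * \<psi> (snd z)\<close> turn the equation into a weak
  differential equation for \<open>s \<mapsto> w s \<psi>\<close>. The exceptional times come only
  from identifying \<open>w s\<close> with the slice of \<open>u\<close> at time \<open>s\<close>,
  so they are the same for all \<open>\<psi>\<close>; this later permits a test function that
  changes with \<open>s\<close>.\<close>

lemma heat_equation_integrated:
  fixes \<Omega> :: "'a::euclidean_space set" and u0 :: "'a \<Rightarrow> complex"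
  assumes \<Omega>: "open \<Omega>" and heat: "heat_equation T \<Omega> u" and init: "initial_value T \<Omega> u u0"
    and int: "set_integrable lborel ({0<..<T} \<times> \<Omega>) u"
  defines "U \<equiv> \<lambda>z. indicator ({0<..<T} \<times> \<Omega>) z *\<^sub>R u z"
  shows "AE s in lborel. s \<in> {0<..<T} \<longrightarrow> (\<forall>\<psi>. test_function \<Omega> \<psi> \<longrightarrow>
    (\<integral>y. U (s, y) * \<psi> y \<partial>lborel) = (LINT x:\<Omega>|lborel. u0 x * \<psi> x)
      + (\<integral>z. U z * (indicator {0<..<s} (fst z) * lap \<psi> (snd z)) \<partial>lborel))"
proof -
  have U: "integrable lborel U" using int by (simp add: U_def set_integrable_def)
  obtain w where w: "\<And>t. t \<in> {0..T} \<Longrightarrow> w t \<in> Hm1 \<Omega>"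
      "\<And>t. t \<in> {0..T} \<Longrightarrow> ((\<lambda>s. Hm1_norm \<Omega> (\<lambda>\<phi>. w s \<phi> - w t \<phi>)) \<longlongrightarrow> 0) (at t within {0..T})"
    and wu: "AE t in lborel. t \<in> {0<..<T} \<longrightarrow>
           (\<forall>\<phi>. test_function \<Omega> \<phi> \<longrightarrow> w t \<phi> = (LINT x:\<Omega>|lborel. u (t, x) * \<phi> x))"
    and w0: "\<And>\<phi>. test_function \<Omega> \<phi> \<Longrightarrow> w 0 \<phi> = (LINT x:\<Omega>|lborel. u0 x * \<phi> x)"
    using init unfolding initial_value_def by blast
  have Us: "(LINT x:\<Omega>|lborel. u (t, x) * \<phi> x) = (\<integral>y. U (t, y) * \<phi> y \<partial>lborel)" if "t \<in> {0<..<T}" for t \<phi>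
    unfolding set_lebesgue_integral_def
    by (rule Bochner_Integration.integral_cong) (use that in \<open>auto simp: U_def indicator_def\<close>)
  have key: "w s \<psi> - w 0 \<psi> = (\<integral>z. U z * (indicator {0<..<s} (fst z) * lap \<psi> (snd z)) \<partial>lborel)"
    if \<psi>: "test_function \<Omega> \<psi>" and s: "0 < s" "s < T" for s \<psi>
  proof -
    have sm: "smooth \<psi>" using \<psi> test_function_smooth by blast
    have [measurable]: "\<psi> \<in> borel_measurable borel" "lap \<psi> \<in> borel_measurable borel"
      using smooth_borel sm smooth_lap by blast+
    obtain B1 where B1: "\<And>y. cmod (\<psi> y) \<le> B1" using test_function_bounded \<psi> by blast
    obtain B2 where B2: "\<And>y. cmod (lap \<psi> y) \<le> B2" using lap_bounded \<psi> by blast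
    have i1: "integrable lborel (\<lambda>z. U z * \<psi> (snd z))"
      by (rule integrable_mult_bounded[OF U, of _ B1]) (use B1 in \<open>auto simp flip: borel_prod\<close>)
    have i2: "integrable lborel (\<lambda>z. U z * lap \<psi> (snd z))"
      by (rule integrable_mult_bounded[OF U, of _ B2]) (use B2 in \<open>auto simp flip: borel_prod\<close>)
    define n where "n s = (\<integral>y. U (s, y) * \<psi> y \<partial>lborel)" for s
    define g where "g s = (\<integral>y. U (s, y) * lap \<psi> y \<partial>lborel)" for s
    have n: "integrable lborel n" using integrable_fst_lborel[OF i1] by (simp add: n_def[abs_def])
    have g: "integrable lborel g" using integrable_fst_lborel[OF i2] by (simp add: g_def[abs_def])
    have "w s \<psi> - w 0 \<psi> = (\<integral>r. indicator {0<..<s} r * g r \<partial>lborel)"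
    proof (rule weak_derivative_imp_integral[where T = T and n = n])
      show "continuous_on {0..T} (\<lambda>s. w s \<psi>)" by (rule Hm1_path_continuous[OF \<Omega> \<psi> w])
      show "n \<in> borel_measurable borel" using n by auto
      show "AE s in lborel. s \<in> {0<..<T} \<longrightarrow> n s = w s \<psi>"
        using wu by eventually_elim (use \<psi> Us in \<open>auto simp: n_def\<close>)
      fix a assume a: "test_function {0<..<T} a"
      have sa: "smooth a" using a test_function_smooth by blast
      have sda: "smooth (dderiv 1 a)" by (intro smooth_dderiv sa) simp
      have [measurable]: "a \<in> borel_measurable borel" "dderiv 1 a \<in> borel_measurable borel"
        using smooth_borel sa sda by blast+
      obtain A1 where A1: "\<And>y. cmod (a y) \<le> A1" using test_function_bounded a by blast
      have "test_function {0<..<T} (dderiv 1 a)" using test_function_dderiv[OF a] by simp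
      then obtain A2 where A2: "\<And>y. cmod (dderiv 1 a y) \<le> A2" using test_function_bounded by blast
      define \<phi> where "\<phi> z = a (fst z) * \<psi> (snd z)" for z
      have \<phi>: "test_function ({0<..<T} \<times> \<Omega>) \<phi>" unfolding \<phi>_def[abs_def] by (rule test_function_product[OF a \<psi>])
      have d: "dderiv v \<phi> = (\<lambda>z. a (fst z) * dderiv (snd v) \<psi> (snd z) + dderiv (fst v) a (fst z) * \<psi> (snd z))" for v
        unfolding \<phi>_def[abs_def]
        by (subst dderiv_mult) (auto simp: dderiv_fst dderiv_snd smooth_fst smooth_snd sa sm)
      have d1: "dderiv (1, 0) \<phi> = (\<lambda>z. dderiv 1 a (fst z) * \<psi> (snd z))"
        using d[of "(1, 0)"] by (simp add: dderiv_zero sm)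
      have d2: "dderiv (0, b) (dderiv (0, b) \<phi>) z = a (fst z) * dderiv b (dderiv b \<psi>) (snd z)" if b: "b \<in> Basis" for b z
      proof -
        have sb: "smooth (dderiv b \<psi>)" using smooth_dderiv sm b by blast
        have "dderiv (0, b) \<phi> = (\<lambda>z. a (fst z) * dderiv b \<psi> (snd z))"
          using d[of "(0, b)"] by (simp add: dderiv_zero sa)
        then show ?thesis
          by (simp add: dderiv_mult dderiv_fst dderiv_snd smooth_fst smooth_snd sa sb dderiv_zero)
      qed
      have eq: "- (LINT z:{0<..<T} \<times> \<Omega>|lborel. u z * dderiv (1, 0) \<phi> z) =
          (LINT z:{0<..<T} \<times> \<Omega>|lborel. u z * (\<Sum>b\<in>Basis. dderiv (0, b) (dderiv (0, b) \<phi>) z))"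
        using heat \<phi> unfolding heat_equation_def by blast
      have "(LINT z:{0<..<T} \<times> \<Omega>|lborel. u z * dderiv (1, 0) \<phi> z)
          = (\<integral>z. (U z * \<psi> (snd z)) * dderiv 1 a (fst z) \<partial>lborel)"
        unfolding set_lebesgue_integral_def d1
        by (rule Bochner_Integration.integral_cong) (auto simp: U_def mult_ac)
      also have "\<dots> = (\<integral>s. \<integral>y. (U (s, y) * \<psi> y) * dderiv 1 a s \<partial>lborel \<partial>lborel)"
        by (subst integral_fst_lborel[symmetric, OF integrable_mult_bounded[OF i1, of _ A2]])
           (use A2 in \<open>auto simp flip: borel_prod\<close>)
      also have "\<dots> = (\<integral>s. dderiv 1 a s * n s \<partial>lborel)"
        by (simp add: n_def mult.commute)
      finally have e1: "(LINT z:{0<..<T} \<times> \<Omega>|lborel. u z * dderiv (1, 0) \<phi> z) = (\<integral>s. dderiv 1 a s * n s \<partial>lborel)" .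
      have "(LINT z:{0<..<T} \<times> \<Omega>|lborel. u z * (\<Sum>b\<in>Basis. dderiv (0, b) (dderiv (0, b) \<phi>) z))
          = (\<integral>z. (U z * lap \<psi> (snd z)) * a (fst z) \<partial>lborel)"
        unfolding set_lebesgue_integral_def lap_def
        by (rule Bochner_Integration.integral_cong) (auto simp: U_def d2 sum_distrib_left sum_distrib_right mult_ac)
      also have "\<dots> = (\<integral>s. \<integral>y. (U (s, y) * lap \<psi> y) * a s \<partial>lborel \<partial>lborel)"
        by (subst integral_fst_lborel[symmetric, OF integrable_mult_bounded[OF i2, of _ A1]])
           (use A1 in \<open>auto simp flip: borel_prod\<close>)
      also have "\<dots> = (\<integral>s. a s * g s \<partial>lborel)"
        by (simp add: g_def mult.commute)
      finally show "- (\<integral>s. dderiv 1 a s * n s \<partial>lborel) = (\<integral>s. a s * g s \<partial>lborel)"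
        using eq e1 by simp
    qed (use g s in auto)
    also have "\<dots> = (\<integral>r. \<integral>y. U (r, y) * lap \<psi> y * indicator {0<..<s} r \<partial>lborel \<partial>lborel)"
      by (simp add: g_def mult.commute)
    also have "\<dots> = (\<integral>z. (U z * lap \<psi> (snd z)) * indicator {0<..<s} (fst z) \<partial>lborel)"
      by (subst integral_fst_lborel[symmetric, OF integrable_mult_bounded[OF i2, of _ 1]])
         (auto simp: indicator_def simp flip: borel_prod)
    also have "\<dots> = (\<integral>z. U z * (indicator {0<..<s} (fst z) * lap \<psi> (snd z)) \<partial>lborel)"
      by (simp add: mult_ac)
    finally show ?thesis .
  qed
  show ?thesis
    using wu
  proof eventually_elim
    fix s assume s: "s \<in> {0<..<T} \<longrightarrow> (\<forall>\<phi>. test_function \<Omega> \<phi> \<longrightarrow> w s \<phi> = (LINT x:\<Omega>|lborel. u (s, x) * \<phi> x))"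
    show "s \<in> {0<..<T} \<longrightarrow> (\<forall>\<psi>. test_function \<Omega> \<psi> \<longrightarrow>
      (\<integral>y. U (s, y) * \<psi> y \<partial>lborel) = (LINT x:\<Omega>|lborel. u0 x * \<psi> x)
        + (\<integral>z. U z * (indicator {0<..<s} (fst z) * lap \<psi> (snd z)) \<partial>lborel))"
    proof (intro impI allI)
      fix \<psi> assume st: "s \<in> {0<..<T}" and \<psi>: "test_function \<Omega> \<psi>"
      show "(\<integral>y. U (s, y) * \<psi> y \<partial>lborel) = (LINT x:\<Omega>|lborel. u0 x * \<psi> x)
        + (\<integral>z. U z * (indicator {0<..<s} (fst z) * lap \<psi> (snd z)) \<partial>lborel)"
        using s st \<psi> key[OF \<psi>, of s] w0[OF \<psi>] Us[OF st, of \<psi>] by (auto simp: algebra_simps)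
    qed
  qed
qed

section \<open>Duhamel's formula\<close>

lemma integral_FTC_reflected:
  fixes f F :: "real \<Rightarrow> complex"
  assumes "r \<le> t" "\<And>s. s \<in> {\<tau> - t..\<tau> - r} \<Longrightarrow> (F has_vector_derivative f s) (at s)"
    and "continuous_on {\<tau> - t..\<tau> - r} f"
  shows "(\<integral>q. indicator {r..t} q *\<^sub>R f (\<tau> - q) \<partial>lborel) = F (\<tau> - r) - F (\<tau> - t)"
proof -
  have "(\<integral>q. indicator {r..t} q *\<^sub>R f (\<tau> - q) \<partial>lborel) = - F (\<tau> - t) - - F (\<tau> - r)"
  proof (rule integral_FTC_Icc[OF assms(1)])
    fix q assume q: "r \<le> q" "q \<le> t"
    have "((\<lambda>q. \<tau> - q) has_vector_derivative - 1) (at q)"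
      by (auto intro!: derivative_eq_intros simp flip: has_real_derivative_iff_has_vector_derivative)
    from vector_diff_chain_at[OF this assms(2), of ] q
    have "((\<lambda>q. F (\<tau> - q)) has_vector_derivative - f (\<tau> - q)) (at q)" by (simp add: o_def)
    from has_vector_derivative_minus[OF this]
    show "((\<lambda>q. - F (\<tau> - q)) has_vector_derivative f (\<tau> - q)) (at q within {r..t})"
      by (simp add: has_vector_derivative_at_within)
  next
    show "continuous_on {r..t} (\<lambda>q. f (\<tau> - q))"
      by (rule continuous_on_compose2[OF assms(3)]) (auto intro: continuous_intros)
  qed
  then show ?thesis by simp
qed

lemma borel_measurable_lborel_pair:
  fixes f :: "'a::euclidean_space \<times> 'b::euclidean_space \<Rightarrow> complex"
  shows "f \<in> borel_measurable (borel \<Otimes>\<^sub>M borel) \<Longrightarrow> f \<in> borel_measurable lborel"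
  by (simp add: borel_prod)

lemma borel_measurable_lborel_triple:
  fixes f :: "'a::euclidean_space \<times> 'b::euclidean_space \<times> 'c::euclidean_space \<Rightarrow> complex"
  shows "f \<in> borel_measurable (borel \<Otimes>\<^sub>M (borel \<Otimes>\<^sub>M borel)) \<Longrightarrow> f \<in> borel_measurable lborel"
  by (simp add: borel_prod)

lemma AE_fst_neq: "AE p in lborel. fst (p :: real \<times> 'a::euclidean_space) \<noteq> t"
proof -
  have "AE z in lborel \<Otimes>\<^sub>M lborel. fst z \<noteq> t \<and> (snd z :: 'a) = snd z"
  proof (rule lborel_pair.AE_pair_measure)
    show "AE x in lborel. AE y in lborel. fst (x, y :: 'a) \<noteq> t \<and> snd (x, y) = snd (x, y)"
      using AE_lborel_singleton[of t] by eventually_elim simp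
    have "open {z :: real \<times> 'a. fst z \<noteq> t}" by (intro open_Collect_neq continuous_intros)
    then show "{z \<in> space (lborel \<Otimes>\<^sub>M lborel). fst z \<noteq> t \<and> (snd z :: 'a) = snd z} \<in> sets (lborel \<Otimes>\<^sub>M lborel)"
      unfolding lborel_prod by simp
  qed
  then show ?thesis unfolding lborel_prod by simp
qed

text \<open>
  Integrating the identity \<open>star\<close> for the test functions \<open>\<kappa> (\<tau> - q)\<close> over \<open>q\<close> and exchanging the order of
  integration avoids test functions that depend on time: the inner integrals over \<open>q\<close> are evaluated by the
  fundamental theorem of calculus, since \<open>\<kappa>\<close> is the time derivative of \<open>\<psi>\<close>.
\<close>

lemma duhamel:
  fixes U :: "real \<times> 'a::euclidean_space \<Rightarrow> complex" and v :: "'a \<Rightarrow> complex"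
    and \<psi> \<kappa> :: "real \<Rightarrow> 'a \<Rightarrow> complex"
  assumes U: "integrable lborel U" "\<And>z. fst z \<le> 0 \<Longrightarrow> U z = 0" and v: "integrable lborel v"
    and star: "AE q in lborel. q \<in> {0<..<T} \<longrightarrow> (\<forall>\<phi>. test_function K \<phi> \<longrightarrow>
      (\<integral>y. U (q, y) * \<phi> y \<partial>lborel) = (\<integral>y. v y * \<phi> y \<partial>lborel)
        + (\<integral>z. U z * (indicator {0<..<q} (fst z) * lap \<phi> (snd z)) \<partial>lborel))"
    and t: "0 < t" "t < T"
    and star_t: "\<And>\<phi>. test_function K \<phi> \<Longrightarrow>
      (\<integral>y. U (t, y) * \<phi> y \<partial>lborel) = (\<integral>y. v y * \<phi> y \<partial>lborel)
        + (\<integral>z. U z * (indicator {0<..<t} (fst z) * lap \<phi> (snd z)) \<partial>lborel)"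
    and \<epsilon>: "\<epsilon> > 0" and \<tau>: "\<tau> = t + \<epsilon>"
    and test: "\<And>s. s \<in> {\<epsilon>..\<tau>} \<Longrightarrow> test_function K (\<psi> s)" "\<And>s. s \<in> {\<epsilon>..\<tau>} \<Longrightarrow> test_function K (\<kappa> s)"
    and der: "\<And>s y. s \<in> {\<epsilon>..\<tau>} \<Longrightarrow> ((\<lambda>s. \<psi> s y) has_vector_derivative \<kappa> s y) (at s)"
      "\<And>s y. s \<in> {\<epsilon>..\<tau>} \<Longrightarrow> ((\<lambda>s. lap (\<psi> s) y) has_vector_derivative lap (\<kappa> s) y) (at s)"
    and cont: "continuous_on ({\<epsilon>..\<tau>} \<times> UNIV) (\<lambda>p. \<kappa> (fst p) (snd p))"
      "continuous_on ({\<epsilon>..\<tau>} \<times> UNIV) (\<lambda>p. lap (\<kappa> (fst p)) (snd p))"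
      "continuous_on ({\<epsilon>..\<tau>} \<times> UNIV) (\<lambda>p. lap (\<psi> (fst p)) (snd p))"
    and bd: "\<And>s y. s \<in> {\<epsilon>..\<tau>} \<Longrightarrow> cmod (\<kappa> s y) \<le> B" "\<And>s y. s \<in> {\<epsilon>..\<tau>} \<Longrightarrow> cmod (lap (\<kappa> s) y) \<le> B"
      "\<And>s y. s \<in> {\<epsilon>..\<tau>} \<Longrightarrow> cmod (lap (\<psi> s) y) \<le> B"
  shows "(\<integral>y. U (t, y) * \<psi> \<epsilon> y \<partial>lborel) = (\<integral>y. v y * \<psi> \<tau> y \<partial>lborel)
    + (\<integral>z. U z * (indicator {0<..<t} (fst z) * (lap (\<psi> (\<tau> - fst z)) (snd z) - \<kappa> (\<tau> - fst z) (snd z))) \<partial>lborel)"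
proof -
  define I :: "real \<Rightarrow> complex" where "I = indicator {0..t}"
  have I_int: "integrable lborel I"
  proof -
    have "integrable lborel (\<lambda>q. complex_of_real (indicator {0..t} q))"
      by (intro integrable_of_real integrable_real_indicator) (auto simp: emeasure_lborel_Icc_eq)
    moreover have "(\<lambda>q. complex_of_real (indicator {0..t} q)) = I" by (auto simp: I_def indicator_def)
    ultimately show ?thesis by simp
  qed
  have [measurable]: "I \<in> borel_measurable borel" by (simp add: I_def)
  have [measurable]: "U \<in> borel_measurable (borel \<Otimes>\<^sub>M borel)" "v \<in> borel_measurable borel"
    using U v by (auto simp: borel_prod)
  have B0: "B \<ge> 0" using bd(1)[of \<epsilon> 0] \<tau> t norm_ge_zero order_trans by (metis add_increasing atLeastAtMost_iff less_imp_le order_refl)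
  \<comment> \<open>The hypotheses on \<open>\<psi>\<close> and \<open>\<kappa>\<close> concern
    times in \<open>{\<epsilon>..\<tau>}\<close> only. Truncation provides functions that are
    measurable and bounded everywhere, as the exchange of integrals requires, and the factor
    \<open>I\<close> selects exactly these times.\<close>
  define ext where "ext f p = indicator ({\<epsilon>..\<tau>} \<times> UNIV) p *\<^sub>R f (fst p) (snd p)" for f :: "real \<Rightarrow> 'a \<Rightarrow> complex" and p
  have ext_m: "ext f \<in> borel_measurable (borel \<Otimes>\<^sub>M borel)"
    if "continuous_on ({\<epsilon>..\<tau>} \<times> UNIV) (\<lambda>p. f (fst p) (snd p))" for f
    unfolding ext_def[abs_def] borel_prod
    by (rule borel_measurable_continuous_on_indicator[OF _ that]) (intro borel_closed closed_Times; simp)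
  have ext_b: "cmod (ext f p) \<le> B" if "\<And>s y. s \<in> {\<epsilon>..\<tau>} \<Longrightarrow> cmod (f s y) \<le> B" for f p
    using that B0 by (auto simp: ext_def indicator_def)
  have ext_I: "I q * ext f (\<tau> - q, y) = I q * f (\<tau> - q) y" for f q y
    by (auto simp: I_def ext_def indicator_def \<tau>)
  define k1 where "k1 = ext \<kappa>"
  define k2 where "k2 = ext (\<lambda>s. lap (\<kappa> s))"
  define k3 where "k3 = ext (\<lambda>s. lap (\<psi> s))"
  have [measurable]: "k1 \<in> borel_measurable (borel \<Otimes>\<^sub>M borel)" "k2 \<in> borel_measurable (borel \<Otimes>\<^sub>M borel)"
      "k3 \<in> borel_measurable (borel \<Otimes>\<^sub>M borel)"
    unfolding k1_def k2_def k3_def by (intro ext_m cont)+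
  have kb: "cmod (k1 p) \<le> B" "cmod (k2 p) \<le> B" "cmod (k3 p) \<le> B" for p
    unfolding k1_def k2_def k3_def by (intro ext_b bd; assumption)+
  have I1: "cmod (I q * w) \<le> cmod w" for q w by (simp add: I_def indicator_def norm_mult)
  have S: "(\<integral>q. I q * f (\<tau> - q) \<partial>lborel) = F \<tau> - F \<epsilon>"
    if "\<And>s. s \<in> {\<epsilon>..\<tau>} \<Longrightarrow> (F has_vector_derivative f s) (at s)" "continuous_on {\<epsilon>..\<tau>} f" for f F :: "real \<Rightarrow> complex"
  proof -
    have "(\<integral>q. I q * f (\<tau> - q) \<partial>lborel) = (\<integral>q. indicator {0..t} q *\<^sub>R f (\<tau> - q) \<partial>lborel)"
      by (rule Bochner_Integration.integral_cong) (auto simp: I_def indicator_def)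
    also have "\<dots> = F (\<tau> - 0) - F (\<tau> - t)"
      by (rule integral_FTC_reflected) (use that t \<tau> in auto)
    finally show ?thesis using \<tau> by simp
  qed
  have g1: "integrable lborel (\<lambda>z. U z * (I (fst z) * k1 (\<tau> - fst z, snd z)))"
  proof (rule integrable_mult_bounded[OF U(1), of _ B])
    show "(\<lambda>z. I (fst z) * k1 (\<tau> - fst z, snd z)) \<in> borel_measurable lborel"
      by (rule borel_measurable_lborel_pair) measurable
  qed (use I1 kb order_trans in blast)
  have L: "(\<integral>q. \<integral>y. U (q, y) * (I q * k1 (\<tau> - q, y)) \<partial>lborel \<partial>lborel)
      = (\<integral>z. U z * (I (fst z) * k1 (\<tau> - fst z, snd z)) \<partial>lborel)"
    using integral_fst_lborel[OF g1] by simp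
  have g2: "integrable lborel (\<lambda>p. (I (fst p) * v (snd p)) * k1 (\<tau> - fst p, snd p))"
  proof (rule integrable_mult_bounded[OF integrable_times_lborel[OF I_int v], of _ B])
    show "(\<lambda>p. k1 (\<tau> - fst p, snd p)) \<in> borel_measurable lborel"
      by (rule borel_measurable_lborel_pair) measurable
  qed (use kb in auto)
  have "(\<integral>q. \<integral>y. I q * v y * k1 (\<tau> - q, y) \<partial>lborel \<partial>lborel) = (\<integral>y. \<integral>q. I q * v y * k1 (\<tau> - q, y) \<partial>lborel \<partial>lborel)"
    using integral_fst_lborel[OF g2] integral_snd_lborel[OF g2] by simp
  also have "\<dots> = (\<integral>y. v y * (\<psi> \<tau> y - \<psi> \<epsilon> y) \<partial>lborel)"
  proof (rule Bochner_Integration.integral_cong)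
    fix y
    have "(\<integral>q. I q * v y * k1 (\<tau> - q, y) \<partial>lborel) = v y * (\<integral>q. I q * \<kappa> (\<tau> - q) y \<partial>lborel)"
      unfolding integral_mult_right_zero[symmetric]
      by (rule Bochner_Integration.integral_cong) (auto simp: k1_def mult.assoc mult.left_commute[of _ "v y"] ext_I)
    also have "(\<integral>q. I q * \<kappa> (\<tau> - q) y \<partial>lborel) = \<psi> \<tau> y - \<psi> \<epsilon> y"
    proof (rule S)
      have "continuous_on {\<epsilon>..\<tau>} (\<lambda>s. (\<lambda>p. \<kappa> (fst p) (snd p)) (s, y))"
        by (rule continuous_on_compose2[OF cont(1)]) (auto intro!: continuous_intros)
      then show "continuous_on {\<epsilon>..\<tau>} (\<lambda>s. \<kappa> s y)" by simp
    qed (rule der)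
    finally show "(\<integral>q. I q * v y * k1 (\<tau> - q, y) \<partial>lborel) = v y * (\<psi> \<tau> y - \<psi> \<epsilon> y)" .
  qed simp
  finally have R1: "(\<integral>q. \<integral>y. I q * v y * k1 (\<tau> - q, y) \<partial>lborel \<partial>lborel) = (\<integral>y. v y * (\<psi> \<tau> y - \<psi> \<epsilon> y) \<partial>lborel)" .
  \<comment> \<open>The region \<open>0 < r < q\<close>: for fixed \<open>r\<close> the variable
    \<open>q\<close> ranges over \<open>{r..t}\<close>, so the time \<open>\<tau> - q\<close> ranges
    over \<open>{\<epsilon>..\<tau> - r}\<close> and the inner integral is an increment of
    \<open>lap (\<psi> s) y\<close>.\<close>
  let ?H = "\<lambda>p :: real \<times> real \<times> 'a. (if 0 < fst (snd p) \<and> fst (snd p) < fst p then 1 else 0) * k2 (\<tau> - fst p, snd (snd p))"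
  have g3: "integrable lborel (\<lambda>p. (I (fst p) * U (snd p)) * ?H p)"
  proof (rule integrable_mult_bounded[OF integrable_times_lborel[OF I_int U(1)], of _ B])
    show "?H \<in> borel_measurable lborel"
      by (rule borel_measurable_lborel_triple) measurable
  qed (use kb B0 in auto)
  have "(\<integral>q. \<integral>z. I q * U z * ?H (q, z) \<partial>lborel \<partial>lborel) = (\<integral>z. \<integral>q. I q * U z * ?H (q, z) \<partial>lborel \<partial>lborel)"
    using integral_fst_lborel[OF g3] integral_snd_lborel[OF g3] by simp
  also have "\<dots> = (\<integral>z. U z * (indicator {0<..<t} (fst z) * (lap (\<psi> (\<tau> - fst z)) (snd z) - lap (\<psi> \<epsilon>) (snd z))) \<partial>lborel)"
  proof (rule Bochner_Integration.integral_cong)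
    fix z :: "real \<times> 'a"
    obtain r y where z: "z = (r, y)" by (cases z)
    consider "r \<le> 0" | "r \<ge> t" | "0 < r" "r < t" by linarith
    then show "(\<integral>q. I q * U z * ?H (q, z) \<partial>lborel)
        = U z * (indicator {0<..<t} (fst z) * (lap (\<psi> (\<tau> - fst z)) (snd z) - lap (\<psi> \<epsilon>) (snd z)))"
    proof cases
      case 1
      then show ?thesis using U(2) z by simp
    next
      case 2
      then have "I q * U z * ?H (q, z) = 0" for q by (auto simp: z I_def indicator_def)
      then have "(\<integral>q. I q * U z * ?H (q, z) \<partial>lborel) = (\<integral>q. 0 \<partial>(lborel :: real measure))" by (simp only:)
      then show ?thesis using 2 by (simp add: z)
    next
      case 3
      have "(\<integral>q. I q * U z * ?H (q, z) \<partial>lborel) = (\<integral>q. U z * (indicator {r..t} q *\<^sub>R lap (\<kappa> (\<tau> - q)) y) \<partial>lborel)"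
      proof (rule integral_cong_AE)
        have "continuous_on {r..t} (\<lambda>q. (\<lambda>p. lap (\<kappa> (fst p)) (snd p)) (\<tau> - q, y))"
          by (rule continuous_on_compose2[OF cont(2)]) (use 3 \<tau> in \<open>auto intro!: continuous_intros\<close>)
        then have "(\<lambda>q. indicator {r..t} q *\<^sub>R lap (\<kappa> (\<tau> - q)) y) \<in> borel_measurable borel"
          by (intro borel_measurable_continuous_on_indicator) auto
        then show "(\<lambda>q. U z * (indicator {r..t} q *\<^sub>R lap (\<kappa> (\<tau> - q)) y)) \<in> borel_measurable lborel"
          unfolding measurable_lborel2 by (intro borel_measurable_times borel_measurable_const)
        show "(\<lambda>q. I q * U z * ?H (q, z)) \<in> borel_measurable lborel"
          unfolding z fst_conv snd_conv by measurable
        show "AE q in lborel. I q * U z * ?H (q, z) = U z * (indicator {r..t} q *\<^sub>R lap (\<kappa> (\<tau> - q)) y)"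
          using AE_lborel_singleton[of r]
        proof eventually_elim
          case (elim q)
          have "I q * k2 (\<tau> - q, y) = I q * lap (\<kappa> (\<tau> - q)) y" unfolding k2_def by (rule ext_I)
          then show ?case using elim 3 by (auto simp: z I_def indicator_def)
        qed
      qed
      also have "\<dots> = U z * (lap (\<psi> (\<tau> - r)) y - lap (\<psi> (\<tau> - t)) y)"
      proof (subst integral_mult_right_zero, subst integral_FTC_reflected[where F = "\<lambda>s. lap (\<psi> s) y"])
        have "continuous_on {\<tau> - t..\<tau> - r} (\<lambda>s. (\<lambda>p. lap (\<kappa> (fst p)) (snd p)) (s, y))"
          by (rule continuous_on_compose2[OF cont(2)]) (use 3 \<tau> in \<open>auto intro!: continuous_intros\<close>)
        then show "continuous_on {\<tau> - t..\<tau> - r} (\<lambda>s. lap (\<kappa> s) y)" by simp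
        show "((\<lambda>s. lap (\<psi> s) y) has_vector_derivative lap (\<kappa> s) y) (at s)" if "s \<in> {\<tau> - t..\<tau> - r}" for s
          by (rule der(2)) (use that 3 \<tau> in auto)
      qed (use 3 in auto)
      also have "\<tau> - t = \<epsilon>" using \<tau> by simp
      finally show ?thesis using 3 by (simp add: z)
    qed
  qed simp
  finally have R2: "(\<integral>q. \<integral>z. I q * U z * ?H (q, z) \<partial>lborel \<partial>lborel)
      = (\<integral>z. U z * (indicator {0<..<t} (fst z) * (lap (\<psi> (\<tau> - fst z)) (snd z) - lap (\<psi> \<epsilon>) (snd z))) \<partial>lborel)" .
  \<comment> \<open>Here \<open>star\<close> is used at time \<open>q\<close> with the test function
    \<open>\<kappa> (\<tau> - q)\<close>. Besides its exceptional times only \<open>q = 0\<close> is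
    discarded, as it lies outside the open interval.\<close>
  have "(\<integral>z. U z * (I (fst z) * k1 (\<tau> - fst z, snd z)) \<partial>lborel)
      = (\<integral>q. (\<integral>y. I q * v y * k1 (\<tau> - q, y) \<partial>lborel) + (\<integral>z. I q * U z * ?H (q, z) \<partial>lborel) \<partial>lborel)"
    unfolding L[symmetric]
  proof (rule integral_cong_AE)
    show "(\<lambda>q. \<integral>y. U (q, y) * (I q * k1 (\<tau> - q, y)) \<partial>lborel) \<in> borel_measurable lborel"
      using integrable_fst_lborel[OF g1] by auto
    show "(\<lambda>q. (\<integral>y. I q * v y * k1 (\<tau> - q, y) \<partial>lborel) + (\<integral>z. I q * U z * ?H (q, z) \<partial>lborel)) \<in> borel_measurable lborel"
      using integrable_fst_lborel[OF g2] integrable_fst_lborel[OF g3] by (intro borel_measurable_add) auto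
    show "AE q in lborel. (\<integral>y. U (q, y) * (I q * k1 (\<tau> - q, y)) \<partial>lborel)
        = (\<integral>y. I q * v y * k1 (\<tau> - q, y) \<partial>lborel) + (\<integral>z. I q * U z * ?H (q, z) \<partial>lborel)"
      using star AE_lborel_singleton[of 0]
    proof eventually_elim
      case (elim q)
      show ?case
      proof (cases "q \<in> {0..t}")
        case False
        then have "I q = 0" by (auto simp: I_def)
        then show ?thesis by simp
      next
        case True
        then have q: "q \<in> {0<..<T}" and s: "\<tau> - q \<in> {\<epsilon>..\<tau>}" using elim(2) t \<tau> by auto
        have i: "I q = 1" using True by (simp add: I_def)
        have k: "k1 (\<tau> - q, y) = \<kappa> (\<tau> - q) y" "k2 (\<tau> - q, y) = lap (\<kappa> (\<tau> - q)) y" for y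
          using s by (auto simp: k1_def k2_def ext_def)
        have "(\<integral>y. U (q, y) * \<kappa> (\<tau> - q) y \<partial>lborel) = (\<integral>y. v y * \<kappa> (\<tau> - q) y \<partial>lborel)
            + (\<integral>z. U z * (indicator {0<..<q} (fst z) * lap (\<kappa> (\<tau> - q)) (snd z)) \<partial>lborel)"
          using elim(1) q test(2)[OF s] by blast
        moreover have "(\<integral>z. I q * U z * ?H (q, z) \<partial>lborel)
            = (\<integral>z. U z * (indicator {0<..<q} (fst z) * lap (\<kappa> (\<tau> - q)) (snd z)) \<partial>lborel)"
          by (rule Bochner_Integration.integral_cong) (auto simp: i k indicator_def)
        ultimately show ?thesis by (simp add: i k)
      qed
    qed
  qed
  also have "\<dots> = (\<integral>y. v y * (\<psi> \<tau> y - \<psi> \<epsilon> y) \<partial>lborel)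
      + (\<integral>z. U z * (indicator {0<..<t} (fst z) * (lap (\<psi> (\<tau> - fst z)) (snd z) - lap (\<psi> \<epsilon>) (snd z))) \<partial>lborel)"
    unfolding R1[symmetric] R2[symmetric]
    using integrable_fst_lborel[OF g2] integrable_fst_lborel[OF g3] by simp
  finally have main: "(\<integral>z. U z * (I (fst z) * k1 (\<tau> - fst z, snd z)) \<partial>lborel) = \<dots>" .
  have v\<psi>: "integrable lborel (\<lambda>y. v y * \<psi> s y)" if s: "s \<in> {\<epsilon>..\<tau>}" for s
  proof -
    obtain C where "\<And>y. cmod (\<psi> s y) \<le> C" using test_function_bounded[OF test(1)[OF s]] by blast
    then show ?thesis
      by (intro integrable_mult_bounded[OF v, of _ C])
         (use smooth_borel[OF test_function_smooth[OF test(1)[OF s]]] in auto)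
  qed
  have ends: "\<epsilon> \<in> {\<epsilon>..\<tau>}" "\<tau> \<in> {\<epsilon>..\<tau>}" using \<tau> t by auto
  let ?J = "\<lambda>z. indicator {0<..<t} (fst z) :: complex"
  have J: "cmod (?J z * w) \<le> cmod w" for z :: "real \<times> 'a" and w by (simp add: indicator_def norm_mult)
  have u1: "integrable lborel (\<lambda>z. U z * (?J z * k3 (\<tau> - fst z, snd z)))"
  proof (rule integrable_mult_bounded[OF U(1), of _ B])
    show "(\<lambda>z. ?J z * k3 (\<tau> - fst z, snd z)) \<in> borel_measurable lborel"
      by (rule borel_measurable_lborel_pair) measurable
  qed (use J kb order_trans in blast)
  have u2: "integrable lborel (\<lambda>z. U z * (?J z * k3 (\<epsilon>, snd z)))"
  proof (rule integrable_mult_bounded[OF U(1), of _ B])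
    show "(\<lambda>z. ?J z * k3 (\<epsilon>, snd z)) \<in> borel_measurable lborel"
      by (rule borel_measurable_lborel_pair) measurable
  qed (use J kb order_trans in blast)
  have u3: "integrable lborel (\<lambda>z. U z * (?J z * k1 (\<tau> - fst z, snd z)))"
  proof (rule integrable_mult_bounded[OF U(1), of _ B])
    show "(\<lambda>z. ?J z * k1 (\<tau> - fst z, snd z)) \<in> borel_measurable lborel"
      by (rule borel_measurable_lborel_pair) measurable
  qed (use J kb order_trans in blast)
  have kJ: "?J z * k1 (\<tau> - fst z, snd z) = ?J z * \<kappa> (\<tau> - fst z) (snd z)"
      "?J z * k3 (\<tau> - fst z, snd z) = ?J z * lap (\<psi> (\<tau> - fst z)) (snd z)"
      "k3 (\<epsilon>, snd z) = lap (\<psi> \<epsilon>) (snd z)" for z :: "real \<times> 'a"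
    using \<tau> t by (auto simp: k1_def k3_def ext_def indicator_def)
  have IJ: "(\<integral>z. U z * (I (fst z) * k1 (\<tau> - fst z, snd z)) \<partial>lborel) = (\<integral>z. U z * (?J z * k1 (\<tau> - fst z, snd z)) \<partial>lborel)"
  proof (rule integral_cong_AE)
    show "AE z in lborel. U z * (I (fst z) * k1 (\<tau> - fst z, snd z)) = U z * (?J z * k1 (\<tau> - fst z, snd z))"
      using AE_fst_neq[of t]
    proof eventually_elim
      case (elim z)
      then show ?case using U(2)[of z] by (cases "fst z \<le> 0") (auto simp: I_def indicator_def)
    qed
  qed (use g1 u3 in auto)
  \<comment> \<open>At the final time the identity is used once more, with
    \<open>\<psi> \<epsilon>\<close>; its right side cancels the terms with
    \<open>\<psi> \<epsilon>\<close> left over from the increments.\<close>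
  have "(\<integral>y. U (t, y) * \<psi> \<epsilon> y \<partial>lborel) = (\<integral>y. v y * \<psi> \<epsilon> y \<partial>lborel) + (\<integral>z. U z * (?J z * k3 (\<epsilon>, snd z)) \<partial>lborel)"
    using star_t[OF test(1)[OF ends(1)]] by (simp add: kJ)
  also have "\<dots> = (\<integral>y. v y * \<psi> \<tau> y \<partial>lborel) + ((\<integral>z. U z * (?J z * k3 (\<tau> - fst z, snd z)) \<partial>lborel)
      - (\<integral>z. U z * (?J z * k1 (\<tau> - fst z, snd z)) \<partial>lborel))"
  proof -
    have "(\<integral>z. U z * (?J z * (lap (\<psi> (\<tau> - fst z)) (snd z) - lap (\<psi> \<epsilon>) (snd z))) \<partial>lborel)
        = (\<integral>z. U z * (?J z * k3 (\<tau> - fst z, snd z)) \<partial>lborel) - (\<integral>z. U z * (?J z * k3 (\<epsilon>, snd z)) \<partial>lborel)"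
      using Bochner_Integration.integral_diff[OF u1 u2] by (simp add: kJ right_diff_distrib)
    moreover have "(\<integral>y. v y * (\<psi> \<tau> y - \<psi> \<epsilon> y) \<partial>lborel) = (\<integral>y. v y * \<psi> \<tau> y \<partial>lborel) - (\<integral>y. v y * \<psi> \<epsilon> y \<partial>lborel)"
      using Bochner_Integration.integral_diff[OF v\<psi>[OF ends(2)] v\<psi>[OF ends(1)]] by (simp add: right_diff_distrib)
    ultimately show ?thesis using main IJ by simp
  qed
  also have "(\<integral>z. U z * (?J z * k3 (\<tau> - fst z, snd z)) \<partial>lborel) - (\<integral>z. U z * (?J z * k1 (\<tau> - fst z, snd z)) \<partial>lborel)
      = (\<integral>z. U z * (?J z * (lap (\<psi> (\<tau> - fst z)) (snd z) - \<kappa> (\<tau> - fst z) (snd z))) \<partial>lborel)"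
    using Bochner_Integration.integral_diff[OF u1 u3] by (simp add: kJ right_diff_distrib)
  finally show ?thesis .
qed

section \<open>Localised heat kernels\<close>

lemma smooth_hk: "smooth (\<lambda>y. complex_of_real (hk s (x - y)))"
proof -
  have "smooth (\<lambda>r::real. c * complex_of_real (exp (- r / (4 * s))))" for c
  proof (rule smooth_coinduct)
    let ?S = "{\<lambda>r. c * complex_of_real (exp (- r / (4 * s))) | c. True}"
    show "(\<lambda>r. c * complex_of_real (exp (- r / (4 * s)))) \<in> ?S" by blast
    have d: "((\<lambda>r. c * complex_of_real (exp (- r / (4 * s)))) has_derivative
        (\<lambda>h. h *\<^sub>R (c * complex_of_real (- 1 / (4 * s) * exp (- r / (4 * s)))))) (at r)" for c r
    proof -
      have "((\<lambda>r. exp (- r / (4 * s))) has_real_derivative (- 1 / (4 * s) * exp (- r / (4 * s)))) (at r)"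
        by (cases "s = 0") (auto intro!: derivative_eq_intros simp: field_simps)
      from has_vector_derivative_mult_right[OF has_vector_derivative_of_real[OF this], of c]
      show ?thesis by (simp add: has_vector_derivative_def)
    qed
    show "f differentiable (at r)" if "f \<in> ?S" for f r
      using that d by (auto simp: differentiable_def)
    show "dderiv b f \<in> ?S" if fS: "f \<in> ?S" and bB: "b \<in> Basis" for f and b :: real
    proof -
      obtain c where f: "f = (\<lambda>r. c * complex_of_real (exp (- r / (4 * s))))" using fS by blast
      have "dderiv b f = (\<lambda>r. (c * complex_of_real (- 1 / (4 * s))) * complex_of_real (exp (- r / (4 * s))))"
        unfolding f by (rule ext, subst dderiv_eq[OF d]) (use bB in simp)
      then show ?thesis by blast
    qed
  qed
  from smooth_compose_real[OF this[of "complex_of_real (gcoef DIM('a) s)"] smooth_norm_power2[of x]]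
  show ?thesis by (simp add: hk_def norm_minus_commute)
qed

lemma dderiv_of_real: "(f has_derivative D) (at x) \<Longrightarrow> dderiv b (\<lambda>x. complex_of_real (f x)) x = of_real (D b)"
  by (rule dderiv_eq[OF has_derivative_of_real])

lemma has_derivative_norm_power2:
  "((\<lambda>y. (norm (x - y))\<^sup>2) has_derivative (\<lambda>h. - 2 * ((x - y) \<bullet> h))) (at (y::'a::euclidean_space))"
  unfolding power2_norm_eq_inner
  by (auto intro!: derivative_eq_intros simp: inner_commute)

lemma dderiv_hk:
  fixes x :: "'a::euclidean_space"
  assumes "s > 0"
  shows "dderiv b (\<lambda>y. complex_of_real (hk s (x - y))) y
    = of_real (((x - y) \<bullet> b) / (2 * s)) * of_real (hk s (x - y))"
proof -
  have "((\<lambda>y. hk s (x - y)) has_derivative (\<lambda>h. ((x - y) \<bullet> h) / (2 * s) * hk s (x - y))) (at y)"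
  proof -
    have d: "((\<lambda>r. gcoef DIM('a) s * exp (- r / (4 * s))) has_derivative
        (\<lambda>h. (- 1 / (4 * s)) * (gcoef DIM('a) s * exp (- r / (4 * s))) * h)) (at r)" for r
    proof -
      have "((\<lambda>r. gcoef DIM('a) s * exp (- r / (4 * s))) has_real_derivative
          (- 1 / (4 * s)) * (gcoef DIM('a) s * exp (- r / (4 * s)))) (at r)"
        using assms by (auto intro!: derivative_eq_intros)
      then show ?thesis by (simp only: has_field_derivative_def)
    qed
    from has_derivative_compose[OF has_derivative_norm_power2 d] show ?thesis
      unfolding hk_def by (rule has_derivative_eq_rhs) (simp add: fun_eq_iff)
  qed
  from dderiv_of_real[OF this] show ?thesis by simp
qed

text \<open>The factor by which the Laplacian, and equally the time derivative, multiplies the heat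
  kernel.\<close>

definition Lh :: "real \<Rightarrow> 'a::euclidean_space \<Rightarrow> real" where
  "Lh s v = (norm v)\<^sup>2 / (4 * s\<^sup>2) - real DIM('a) / (2 * s)"

lemma smooth_Lh: "smooth (\<lambda>y. complex_of_real (Lh s (x - y)))"
proof -
  have "smooth (\<lambda>y. complex_of_real ((norm (y - x))\<^sup>2) * of_real (inverse (4 * s\<^sup>2)) - of_real (real DIM('a) / (2 * s)))"
    by (intro smooth_diff smooth_mult smooth_norm_power2 smooth_const)
  moreover have "complex_of_real (Lh s (x - y))
      = complex_of_real ((norm (y - x))\<^sup>2) * of_real (inverse (4 * s\<^sup>2)) - of_real (real DIM('a) / (2 * s))" for y
    unfolding Lh_def norm_minus_commute[of x] divide_inverse[of "_\<^sup>2"] by (simp only: of_real_diff of_real_mult)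
  ultimately show ?thesis by (simp only:)
qed

lemma dderiv_Lh:
  fixes x :: "'a::euclidean_space"
  assumes "s > 0"
  shows "dderiv b (\<lambda>y. complex_of_real (Lh s (x - y))) y = of_real (- ((x - y) \<bullet> b) / (2 * s\<^sup>2))"
proof -
  have "((\<lambda>y. Lh s (x - y)) has_derivative (\<lambda>h. - ((x - y) \<bullet> h) / (2 * s\<^sup>2))) (at y)"
  proof -
    have "((\<lambda>y. (1 / (4 * s\<^sup>2)) * (norm (x - y))\<^sup>2 - real DIM('a) / (2 * s)) has_derivative
        (\<lambda>h. (1 / (4 * s\<^sup>2)) * (- 2 * ((x - y) \<bullet> h)) - 0)) (at y)"
      by (intro has_derivative_diff has_derivative_mult_right has_derivative_norm_power2 has_derivative_const)
    then show ?thesis unfolding Lh_def by (simp add: mult.commute)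
  qed
  from dderiv_of_real[OF this] show ?thesis by simp
qed

lemma smooth_of_real_inner: "smooth (\<lambda>y. complex_of_real (((x - y) \<bullet> b) * c))"
proof -
  have "smooth (\<lambda>y. (of_real (x \<bullet> b) - complex_of_real (y \<bullet> b)) * of_real c)"
    by (intro smooth_mult smooth_diff smooth_const smooth_inner)
  then show ?thesis by (simp add: inner_diff_left)
qed

lemma dderiv_of_real_inner:
  "dderiv h (\<lambda>y. complex_of_real (((x - y) \<bullet> b) * c)) y = of_real (- (h \<bullet> b) * c)"
proof (rule dderiv_of_real)
  show "((\<lambda>y. ((x - y) \<bullet> b) * c) has_derivative (\<lambda>h. - (h \<bullet> b) * c)) (at y)"
    by (auto intro!: derivative_eq_intros)
qed

lemma lap_mult:
  assumes "smooth f" "smooth g"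
  shows "lap (\<lambda>x. f x * g x) y = f y * lap g y + 2 * (\<Sum>b\<in>Basis. dderiv b f y * dderiv b g y) + g y * lap f y"
proof -
  have "dderiv b (dderiv b (\<lambda>x. f x * g x)) y
      = f y * dderiv b (dderiv b g) y + 2 * (dderiv b f y * dderiv b g y) + g y * dderiv b (dderiv b f) y"
    if b: "b \<in> Basis" for b
    unfolding dderiv_mult[OF assms]
    by (simp add: dderiv_add dderiv_mult smooth_mult smooth_dderiv assms b algebra_simps)
  then show ?thesis
    unfolding lap_def by (simp add: sum.distrib sum_distrib_left)
qed

lemma norm_power2_Basis: "(norm (v::'a::euclidean_space))\<^sup>2 = (\<Sum>b\<in>Basis. (v \<bullet> b)\<^sup>2)"
  by (subst power2_norm_eq_inner, subst euclidean_inner) (simp add: power2_eq_square)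

lemma lap_hk:
  fixes x :: "'a::euclidean_space"
  assumes "s > 0"
  shows "lap (\<lambda>y. complex_of_real (hk s (x - y))) y = of_real (Lh s (x - y)) * of_real (hk s (x - y))"
proof -
  have "dderiv b (dderiv b (\<lambda>y. complex_of_real (hk s (x - y)))) y
      = of_real ((((x - y) \<bullet> b)\<^sup>2 / (4 * s\<^sup>2) - 1 / (2 * s)) * hk s (x - y))" if b: "b \<in> Basis" for b
  proof -
    have e: "dderiv b (\<lambda>y. complex_of_real (hk s (x - y)))
        = (\<lambda>y. of_real (((x - y) \<bullet> b) * (1 / (2 * s))) * of_real (hk s (x - y)))"
      by (rule ext) (simp add: dderiv_hk[OF assms])
    have "dderiv b (dderiv b (\<lambda>y. complex_of_real (hk s (x - y)))) y
        = of_real (((x - y) \<bullet> b) * (1 / (2 * s)) * (((x - y) \<bullet> b) / (2 * s) * hk s (x - y))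
            + (- 1 * (1 / (2 * s))) * hk s (x - y))"
      by (subst e, unfold dderiv_mult[OF smooth_of_real_inner smooth_hk] dderiv_hk[OF assms] dderiv_of_real_inner
          inner_same_Basis[OF b]) (simp only: of_real_mult of_real_add)
    also have "((x - y) \<bullet> b) * (1 / (2 * s)) * (((x - y) \<bullet> b) / (2 * s) * hk s (x - y)) + (- 1 * (1 / (2 * s))) * hk s (x - y)
        = (((x - y) \<bullet> b)\<^sup>2 / (4 * s\<^sup>2) - 1 / (2 * s)) * hk s (x - y)"
    proof -
      have "a * (1 / (2 * s)) * (a / (2 * s) * h) + (- 1 * (1 / (2 * s))) * h = (a\<^sup>2 / (4 * s\<^sup>2) - 1 / (2 * s)) * h" for a h :: real
        by (simp add: power2_eq_square algebra_simps)
      then show ?thesis .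
    qed
    finally show ?thesis .
  qed
  then have "lap (\<lambda>y. complex_of_real (hk s (x - y))) y
      = of_real (\<Sum>b\<in>Basis. (((x - y) \<bullet> b)\<^sup>2 / (4 * s\<^sup>2) - 1 / (2 * s)) * hk s (x - y))"
    unfolding lap_def of_real_sum by (intro sum.cong) auto
  also have "(\<Sum>b\<in>Basis. (((x - y) \<bullet> b)\<^sup>2 / (4 * s\<^sup>2) - 1 / (2 * s)) * hk s (x - y)) = Lh s (x - y) * hk s (x - y)"
    unfolding Lh_def norm_power2_Basis
    by (simp add: sum_distrib_right[symmetric] sum_subtractf sum_divide_distrib)
  finally show ?thesis by simp
qed

lemma lap_Lh:
  fixes x :: "'a::euclidean_space"
  assumes "s > 0"
  shows "lap (\<lambda>y. complex_of_real (Lh s (x - y))) y = of_real (real DIM('a) / (2 * s\<^sup>2))"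
proof -
  have "dderiv b (dderiv b (\<lambda>y. complex_of_real (Lh s (x - y)))) y = of_real (1 / (2 * s\<^sup>2))" if b: "b \<in> Basis" for b
  proof -
    have "dderiv b (\<lambda>y. complex_of_real (Lh s (x - y))) = (\<lambda>y. of_real (((x - y) \<bullet> b) * (- 1 / (2 * s\<^sup>2))))"
      by (rule ext) (simp add: dderiv_Lh[OF assms])
    then show ?thesis by (simp only: dderiv_of_real_inner inner_same_Basis[OF b]) simp
  qed
  then show ?thesis unfolding lap_def by simp
qed

text \<open>The time derivative of \<open>Lh\<close>.\<close>

definition Lt :: "real \<Rightarrow> 'a::euclidean_space \<Rightarrow> real" where
  "Lt s v = - (norm v)\<^sup>2 / (2 * s ^ 3) + real DIM('a) / (2 * s\<^sup>2)"

text \<open>The gradient cross term contributes the first and the Laplacian of \<open>Lh\<close> the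
  second summand of \<open>Lt\<close>. The result is also the time derivative of
  \<open>Lh * hk\<close>, since Laplacian and time derivative commute.\<close>

lemma lap_Lh_hk:
  fixes x :: "'a::euclidean_space"
  assumes "s > 0"
  shows "lap (\<lambda>y. complex_of_real (Lh s (x - y)) * of_real (hk s (x - y))) y
    = of_real ((Lh s (x - y))\<^sup>2 + Lt s (x - y)) * of_real (hk s (x - y))"
proof -
  have "(\<Sum>b\<in>Basis. dderiv b (\<lambda>y. complex_of_real (Lh s (x - y))) y * dderiv b (\<lambda>y. complex_of_real (hk s (x - y))) y)
      = of_real (\<Sum>b\<in>Basis. ((x - y) \<bullet> b)\<^sup>2 * (- 1 / (4 * s ^ 3) * hk s (x - y)))"
    unfolding dderiv_hk[OF assms] dderiv_Lh[OF assms] of_real_sum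
  proof (intro sum.cong refl)
    fix b :: 'a
    have "- a / (2 * s\<^sup>2) * (a / (2 * s) * h) = a\<^sup>2 * (- 1 / (4 * s ^ 3) * h)" for a h :: real
      by (simp add: power2_eq_square power3_eq_cube mult_ac)
    from this[of "(x - y) \<bullet> b" "hk s (x - y)"]
    show "complex_of_real (- ((x - y) \<bullet> b) / (2 * s\<^sup>2)) * (of_real ((x - y) \<bullet> b / (2 * s)) * of_real (hk s (x - y)))
      = of_real (((x - y) \<bullet> b)\<^sup>2 * (- 1 / (4 * s ^ 3) * hk s (x - y)))"
      by (simp only: of_real_mult[symmetric])
  qed
  also have "\<dots> = of_real ((norm (x - y))\<^sup>2 * (- 1 / (4 * s ^ 3) * hk s (x - y)))"
    unfolding norm_power2_Basis sum_distrib_right ..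
  finally have e: "(\<Sum>b\<in>Basis. dderiv b (\<lambda>y. complex_of_real (Lh s (x - y))) y * dderiv b (\<lambda>y. complex_of_real (hk s (x - y))) y)
      = of_real ((norm (x - y))\<^sup>2 * (- 1 / (4 * s ^ 3) * hk s (x - y)))" .
  have "lap (\<lambda>y. complex_of_real (Lh s (x - y)) * of_real (hk s (x - y))) y
      = of_real (Lh s (x - y) * (Lh s (x - y) * hk s (x - y)) + 2 * ((norm (x - y))\<^sup>2 * (- 1 / (4 * s ^ 3) * hk s (x - y)))
          + hk s (x - y) * (real DIM('a) / (2 * s\<^sup>2)))"
    unfolding lap_mult[OF smooth_Lh smooth_hk] lap_hk[OF assms] lap_Lh[OF assms] e by simp
  also have "Lh s (x - y) * (Lh s (x - y) * hk s (x - y)) + 2 * ((norm (x - y))\<^sup>2 * (- 1 / (4 * s ^ 3) * hk s (x - y)))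
          + hk s (x - y) * (real DIM('a) / (2 * s\<^sup>2)) = ((Lh s (x - y))\<^sup>2 + Lt s (x - y)) * hk s (x - y)"
    unfolding Lt_def by (simp add: algebra_simps power2_eq_square)
  finally show ?thesis by simp
qed

text \<open>Written as \<open>exp (- (real d / 2) * ln (4 * pi * s))\<close> the power can be
  differentiated without a case distinction on \<open>d\<close>.\<close>

lemma gcoef_has_derivative:
  assumes "s > 0"
  shows "(gcoef d has_real_derivative - real d / (2 * s) * gcoef d s) (at s)"
proof -
  have eq: "gcoef d s = exp (- (real d / 2) * ln (4 * pi * s))" if "s > 0" for s
  proof -
    have "sqrt (4 * pi * s) = exp (ln (4 * pi * s) / 2)"
      using that by (simp add: ln_sqrt[symmetric])
    then have "1 / sqrt (4 * pi * s) = exp (- (ln (4 * pi * s) / 2))" by (simp add: exp_minus inverse_eq_divide)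
    then have "gcoef d s = exp (real d * - (ln (4 * pi * s) / 2))" unfolding gcoef_def by (simp only: exp_of_nat_mult)
    then show ?thesis by (simp add: mult.commute)
  qed
  have "((\<lambda>s. exp (- (real d / 2) * ln (4 * pi * s))) has_real_derivative
      - real d / (2 * s) * exp (- (real d / 2) * ln (4 * pi * s))) (at s)"
    using assms by (auto intro!: derivative_eq_intros simp: field_simps)
  then show ?thesis unfolding eq[OF assms]
    by (rule has_field_derivative_transform_within_open[of _ _ _ "{0<..}"]) (use assms eq in auto)
qed

lemma hk_has_time_derivative:
  assumes "s > 0"
  shows "((\<lambda>s. hk s v) has_real_derivative Lh s v * hk s v) (at s)"
proof -
  have "((\<lambda>s. exp (- (norm v)\<^sup>2 / (4 * s))) has_real_derivative (norm v)\<^sup>2 / (4 * s\<^sup>2) * exp (- (norm v)\<^sup>2 / (4 * s))) (at s)"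
    using assms by (auto intro!: derivative_eq_intros simp: power2_eq_square field_simps)
  from DERIV_mult[OF gcoef_has_derivative[OF assms] this] show ?thesis
    unfolding hk_def Lh_def by (rule DERIV_cong) (simp add: algebra_simps)
qed

lemma Lh_has_time_derivative:
  assumes "s > 0"
  shows "((\<lambda>s. Lh s v) has_real_derivative Lt s v) (at s)"
  unfolding Lh_def Lt_def using assms
  by (auto intro!: derivative_eq_intros simp: power2_eq_square power3_eq_cube field_simps)

lemma continuous_on_hk:
  fixes g :: "'c::topological_space \<Rightarrow> 'a::euclidean_space"
  assumes "continuous_on S f" "continuous_on S g" "\<And>x. x \<in> S \<Longrightarrow> f x > 0"
  shows "continuous_on S (\<lambda>x. hk (f x) (g x))"
  unfolding hk_def gcoef_def
  by (intro continuous_intros assms) (use assms(3) in \<open>auto simp: less_imp_neq[OF assms(3), symmetric]\<close>)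

lemma continuous_on_Lh:
  fixes g :: "'c::topological_space \<Rightarrow> 'a::euclidean_space"
  assumes "continuous_on S f" "continuous_on S g" "\<And>x. x \<in> S \<Longrightarrow> f x > 0"
  shows "continuous_on S (\<lambda>x. Lh (f x) (g x))" "continuous_on S (\<lambda>x. Lt (f x) (g x))"
  unfolding Lh_def Lt_def
  by (intro continuous_intros assms; use assms(3) in \<open>auto simp: less_imp_neq[OF assms(3), symmetric]\<close>)+

text \<open>Multiplied by the kernel and divided by \<open>s\<close> this is the cross term of the
  product rule, twice the sum of the products of the partial derivatives of \<open>\<zeta>\<close>
  and of the kernel.\<close>

definition drift :: "('a::euclidean_space \<Rightarrow> complex) \<Rightarrow> 'a \<Rightarrow> 'a \<Rightarrow> complex" where
  "drift \<zeta> x y = (\<Sum>b\<in>Basis. dderiv b \<zeta> y * of_real ((x - y) \<bullet> b))"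

lemma lap_cutoff_hk:
  fixes x :: "'a::euclidean_space"
  assumes "smooth \<zeta>" "s > 0"
  shows "lap (\<lambda>y. \<zeta> y * of_real (hk s (x - y))) y
    = (\<zeta> y * of_real (Lh s (x - y)) + drift \<zeta> x y * of_real (1 / s) + lap \<zeta> y) * of_real (hk s (x - y))"
proof -
  have "2 * (D * (of_real (a / (2 * s)) * H)) = D * of_real a * (of_real (1 / s) * H)" for D H :: complex and a
    by simp
  then have e: "2 * (\<Sum>b\<in>Basis. dderiv b \<zeta> y * (of_real ((x - y) \<bullet> b / (2 * s)) * of_real (hk s (x - y))))
      = drift \<zeta> x y * (of_real (1 / s) * of_real (hk s (x - y)))"
    unfolding drift_def sum_distrib_left sum_distrib_right by (simp only:)
  show ?thesis
    unfolding lap_mult[OF assms(1) smooth_hk] lap_hk[OF assms(2)] dderiv_hk[OF assms(2)] e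
    by (simp only: distrib_right distrib_left mult_ac)
qed

text \<open>The right side is the time derivative of the one in \<open>lap_cutoff_hk\<close>;
  Duhamel's formula asks for exactly this relation between the Laplacians of \<open>\<kappa>\<close>
  and \<open>\<psi>\<close>.\<close>

lemma lap_cutoff_Lh_hk:
  fixes x :: "'a::euclidean_space"
  assumes "smooth \<zeta>" "s > 0"
  shows "lap (\<lambda>y. \<zeta> y * (of_real (Lh s (x - y)) * of_real (hk s (x - y)))) y
    = (\<zeta> y * of_real ((Lh s (x - y))\<^sup>2 + Lt s (x - y)) + drift \<zeta> x y * of_real (Lh s (x - y) / s - 1 / s\<^sup>2)
      + lap \<zeta> y * of_real (Lh s (x - y))) * of_real (hk s (x - y))"
proof -
  have "dderiv b (\<lambda>y. of_real (Lh s (x - y)) * of_real (hk s (x - y))) y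
      = complex_of_real ((x - y) \<bullet> b) * of_real ((Lh s (x - y) / s - 1 / s\<^sup>2) * hk s (x - y) / 2)" for b
  proof -
    have "l * (a / (2 * s) * h) + - a / (2 * s\<^sup>2) * h = a * ((l / s - 1 / s\<^sup>2) * h / 2)" for a h l :: real
      by (simp add: field_simps)
    from this[of "Lh s (x - y)" "(x - y) \<bullet> b" "hk s (x - y)"] show ?thesis
      unfolding dderiv_mult[OF smooth_Lh smooth_hk] dderiv_hk[OF assms(2)] dderiv_Lh[OF assms(2)]
      by (simp only: of_real_mult[symmetric] of_real_add[symmetric])
  qed
  then have e: "2 * (\<Sum>b\<in>Basis. dderiv b \<zeta> y * dderiv b (\<lambda>y. of_real (Lh s (x - y)) * of_real (hk s (x - y))) y)
      = drift \<zeta> x y * (of_real (Lh s (x - y) / s - 1 / s\<^sup>2) * of_real (hk s (x - y)))"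
  proof -
    assume d: "\<And>b. dderiv b (\<lambda>y. of_real (Lh s (x - y)) * of_real (hk s (x - y))) y
      = complex_of_real ((x - y) \<bullet> b) * of_real ((Lh s (x - y) / s - 1 / s\<^sup>2) * hk s (x - y) / 2)"
    have "2 * (D * (of_real a * of_real (q * h / 2))) = D * of_real a * (of_real q * of_real h)" for D :: complex and a q h
      by simp
    then show ?thesis unfolding drift_def sum_distrib_left sum_distrib_right d by (simp only:)
  qed
  show ?thesis
    unfolding lap_mult[OF assms(1) smooth_mult[OF smooth_Lh smooth_hk]] lap_Lh_hk[OF assms(2)] e
    by (simp add: algebra_simps)
qed

lemma outside_support:
  assumes "test_function K \<zeta>"
  obtains r where "\<And>y. norm y > r \<Longrightarrow> \<zeta> y = 0" "\<And>x y. norm y > r \<Longrightarrow> drift \<zeta> x y = 0" "\<And>y. norm y > r \<Longrightarrow> lap \<zeta> y = 0"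
proof -
  have "bounded (closure {x. \<zeta> x \<noteq> 0})" using assms compact_imp_bounded unfolding test_function_def by blast
  then obtain r where r: "\<forall>x\<in>closure {x. \<zeta> x \<noteq> 0}. norm x \<le> r" using bounded_iff by blast
  have 1: "y \<notin> closure {x. \<zeta> x \<noteq> 0}" if "norm y > r" for y using r that by force
  have 2: "dderiv b \<zeta> y = 0" if "y \<notin> closure {x. \<zeta> x \<noteq> 0}" for b y using that by (rule dderiv_eq_0_outside)
  have 3: "dderiv b (dderiv b \<zeta>) y = 0" if "y \<notin> closure {x. \<zeta> x \<noteq> 0}" for b y
  proof (rule dderiv_eq_0_outside)
    have "closure {x. dderiv b \<zeta> x \<noteq> 0} \<subseteq> closure {x. \<zeta> x \<noteq> 0}" using 2 by (intro closure_minimal) auto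
    then show "y \<notin> closure {x. dderiv b \<zeta> x \<noteq> 0}" using that by blast
  qed
  show ?thesis
    by (rule that[of r]) (use 1 2 3 closure_subset[of "{x. \<zeta> x \<noteq> 0}"] in \<open>auto simp: drift_def lap_def\<close>)
qed

lemma bounded_on_strip:
  fixes F :: "real \<Rightarrow> 'a::euclidean_space \<Rightarrow> complex"
  assumes "continuous_on ({a..b} \<times> UNIV) (\<lambda>p. F (fst p) (snd p))" "\<And>s y. norm y > r \<Longrightarrow> F s y = 0"
  obtains B where "\<And>s y. s \<in> {a..b} \<Longrightarrow> cmod (F s y) \<le> B"
proof -
  have "compact ((\<lambda>p. F (fst p) (snd p)) ` ({a..b} \<times> cball 0 r))"
    by (intro compact_continuous_image continuous_on_subset[OF assms(1)] compact_Times) auto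
  then obtain B where B: "\<forall>w\<in>(\<lambda>p. F (fst p) (snd p)) ` ({a..b} \<times> cball 0 r). norm w \<le> B"
    using compact_imp_bounded bounded_iff by blast
  have "cmod (F s y) \<le> max B 0" if "s \<in> {a..b}" for s y
    using B that assms(2)[of y s] by (cases "norm y \<le> r") (auto simp: le_max_iff_disj)
  then show ?thesis using that by blast
qed

text \<open>Duhamel's formula for the kernel cut off by \<open>\<zeta>\<close>. As the kernel solves
  the heat equation, the terms with \<open>\<zeta>\<close> itself cancel and only its derivatives
  remain. The shift by \<open>\<epsilon>\<close> keeps all kernel times positive, and the
  exceptional times depend neither on \<open>x\<close> nor on \<open>\<epsilon>\<close>.\<close>

lemma heat_kernel_representation:
  fixes U :: "real \<times> 'a::euclidean_space \<Rightarrow> complex" and v :: "'a \<Rightarrow> complex"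
  assumes U: "integrable lborel U" "\<And>z. fst z \<le> 0 \<Longrightarrow> U z = 0" and v: "integrable lborel v"
    and star: "AE q in lborel. q \<in> {0<..<T} \<longrightarrow> (\<forall>\<phi>. test_function K \<phi> \<longrightarrow>
      (\<integral>y. U (q, y) * \<phi> y \<partial>lborel) = (\<integral>y. v y * \<phi> y \<partial>lborel)
        + (\<integral>z. U z * (indicator {0<..<q} (fst z) * lap \<phi> (snd z)) \<partial>lborel))"
    and \<zeta>: "test_function K \<zeta>"
  shows "AE t in lborel. t \<in> {0<..<T} \<longrightarrow> (\<forall>x \<epsilon>. \<epsilon> > 0 \<longrightarrow>
     (\<integral>y. U (t, y) * (\<zeta> y * of_real (hk \<epsilon> (x - y))) \<partial>lborel)
      = (\<integral>y. v y * (\<zeta> y * of_real (hk (t + \<epsilon>) (x - y))) \<partial>lborel)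
      + (\<integral>z. U z * (indicator {0<..<t} (fst z) * ((drift \<zeta> x (snd z) * of_real (1 / (t + \<epsilon> - fst z)) + lap \<zeta> (snd z))
          * of_real (hk (t + \<epsilon> - fst z) (x - snd z)))) \<partial>lborel))"
  using star
proof (eventually_elim, intro impI allI)
  fix t x \<epsilon>
  assume st: "t \<in> {0<..<T} \<longrightarrow> (\<forall>\<phi>. test_function K \<phi> \<longrightarrow>
      (\<integral>y. U (t, y) * \<phi> y \<partial>lborel) = (\<integral>y. v y * \<phi> y \<partial>lborel)
        + (\<integral>z. U z * (indicator {0<..<t} (fst z) * lap \<phi> (snd z)) \<partial>lborel))"
    and t: "t \<in> {0<..<T}" and \<epsilon>: "(\<epsilon>::real) > 0"
  define \<tau> where "\<tau> = t + \<epsilon>"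
  have sm: "smooth \<zeta>" using \<zeta> test_function_smooth by blast
  obtain r where r: "\<And>y. norm y > r \<Longrightarrow> \<zeta> y = 0" "\<And>x y. norm y > r \<Longrightarrow> drift \<zeta> x y = 0" "\<And>y. norm y > r \<Longrightarrow> lap \<zeta> y = 0"
    using outside_support[OF \<zeta>] by blast
  define \<psi> where "\<psi> s y = \<zeta> y * of_real (hk s (x - y))" for s y
  define \<kappa> where "\<kappa> s y = \<zeta> y * (of_real (Lh s (x - y)) * of_real (hk s (x - y)))" for s y
  define l\<psi> where "l\<psi> s y = (\<zeta> y * of_real (Lh s (x - y)) + drift \<zeta> x y * of_real (1 / s) + lap \<zeta> y) * of_real (hk s (x - y))" for s y
  define l\<kappa> where "l\<kappa> s y = (\<zeta> y * of_real ((Lh s (x - y))\<^sup>2 + Lt s (x - y)) + drift \<zeta> x y * of_real (Lh s (x - y) / s - 1 / s\<^sup>2)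
      + lap \<zeta> y * of_real (Lh s (x - y))) * of_real (hk s (x - y))" for s y
  have lap\<psi>: "lap (\<psi> s) = l\<psi> s" if "s > 0" for s
    unfolding \<psi>_def l\<psi>_def by (rule ext) (rule lap_cutoff_hk[OF sm that])
  have lap\<kappa>: "lap (\<kappa> s) = l\<kappa> s" if "s > 0" for s
    unfolding \<kappa>_def l\<kappa>_def by (rule ext) (rule lap_cutoff_Lh_hk[OF sm that])
  have pos: "s > 0" if "s \<in> {\<epsilon>..\<tau>}" for s using that \<epsilon> by auto
  let ?S = "{\<epsilon>..\<tau>} \<times> (UNIV :: 'a set)"
  have cs: "continuous_on ?S (\<lambda>p. \<zeta> (snd p))" "continuous_on ?S (\<lambda>p. lap \<zeta> (snd p))" "continuous_on ?S (\<lambda>p. drift \<zeta> x (snd p))"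
  proof -
    have c: "continuous_on ?S (\<lambda>p. f (snd p))" if "smooth f" for f
      by (rule continuous_on_compose2[OF smooth_imp_continuous[OF that, of UNIV]]) (auto intro: continuous_intros)
    show "continuous_on ?S (\<lambda>p. \<zeta> (snd p))" "continuous_on ?S (\<lambda>p. lap \<zeta> (snd p))"
      by (intro c sm smooth_lap)+
    show "continuous_on ?S (\<lambda>p. drift \<zeta> x (snd p))" unfolding drift_def
      by (intro continuous_intros c smooth_dderiv sm)
  qed
  have ch: "continuous_on ?S (\<lambda>p. hk (fst p) (x - snd p))" "continuous_on ?S (\<lambda>p. Lh (fst p) (x - snd p))"
      "continuous_on ?S (\<lambda>p. Lt (fst p) (x - snd p))"
    using pos by (auto intro!: continuous_on_hk continuous_on_Lh continuous_intros)
  have nz: "\<forall>p\<in>?S. fst p \<noteq> 0" "\<forall>p\<in>?S. (fst p)\<^sup>2 \<noteq> 0" using pos by force+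
  have c1: "continuous_on ?S (\<lambda>p. \<kappa> (fst p) (snd p))" unfolding \<kappa>_def
    by (intro continuous_intros cs ch)
  have c2: "continuous_on ?S (\<lambda>p. l\<kappa> (fst p) (snd p))" unfolding l\<kappa>_def
    by (intro continuous_intros cs ch nz)
  have c3: "continuous_on ?S (\<lambda>p. l\<psi> (fst p) (snd p))" unfolding l\<psi>_def
    by (intro continuous_intros cs ch nz)
  obtain B1 where B1: "\<And>s y. s \<in> {\<epsilon>..\<tau>} \<Longrightarrow> cmod (\<kappa> s y) \<le> B1"
    using bounded_on_strip[OF c1, of r] r by (auto simp: \<kappa>_def)
  obtain B2 where B2: "\<And>s y. s \<in> {\<epsilon>..\<tau>} \<Longrightarrow> cmod (l\<kappa> s y) \<le> B2"
    using bounded_on_strip[OF c2, of r] r by (auto simp: l\<kappa>_def)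
  obtain B3 where B3: "\<And>s y. s \<in> {\<epsilon>..\<tau>} \<Longrightarrow> cmod (l\<psi> s y) \<le> B3"
    using bounded_on_strip[OF c3, of r] r by (auto simp: l\<psi>_def)
  define B where "B = max B1 (max B2 B3)"
  have "(\<integral>y. U (t, y) * \<psi> \<epsilon> y \<partial>lborel) = (\<integral>y. v y * \<psi> \<tau> y \<partial>lborel)
    + (\<integral>z. U z * (indicator {0<..<t} (fst z) * (lap (\<psi> (\<tau> - fst z)) (snd z) - \<kappa> (\<tau> - fst z) (snd z))) \<partial>lborel)"
  proof (rule duhamel[OF U v star, of t \<epsilon>, where B = B])
    show "test_function K (\<psi> s)" for s unfolding \<psi>_def by (intro test_function_mult \<zeta> smooth_hk)
    show "test_function K (\<kappa> s)" for s unfolding \<kappa>_def by (intro test_function_mult \<zeta> smooth_mult smooth_hk smooth_Lh)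
    fix s y assume s: "s \<in> {\<epsilon>..\<tau>}"
    have s0: "s > 0" using pos s by blast
    have dhk: "((\<lambda>s. complex_of_real (hk s (x - y))) has_vector_derivative of_real (Lh s (x - y) * hk s (x - y))) (at s)"
      by (rule has_vector_derivative_of_real[OF hk_has_time_derivative[OF s0]])
    show "((\<lambda>s. \<psi> s y) has_vector_derivative \<kappa> s y) (at s)"
      using has_vector_derivative_mult_right[OF dhk, of "\<zeta> y"] by (simp add: \<psi>_def \<kappa>_def)
    have d1: "((\<lambda>s. complex_of_real (Lh s (x - y))) has_vector_derivative of_real (Lt s (x - y))) (at s)"
      by (rule has_vector_derivative_of_real[OF Lh_has_time_derivative[OF s0]])
    have d2: "((\<lambda>s. complex_of_real (1 / s)) has_vector_derivative of_real (- 1 / s\<^sup>2)) (at s)"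
      by (rule has_vector_derivative_of_real) (use s0 in \<open>auto intro!: derivative_eq_intros simp: power2_eq_square\<close>)
    have "((\<lambda>s. l\<psi> s y) has_vector_derivative
       ((\<zeta> y * of_real (Lh s (x - y)) + drift \<zeta> x y * of_real (1 / s) + lap \<zeta> y) * of_real (Lh s (x - y) * hk s (x - y))
        + (\<zeta> y * of_real (Lt s (x - y)) + drift \<zeta> x y * of_real (- 1 / s\<^sup>2) + 0) * of_real (hk s (x - y)))) (at s)"
      unfolding l\<psi>_def
      by (intro has_vector_derivative_mult has_vector_derivative_add has_vector_derivative_mult_right dhk d1 d2
          has_vector_derivative_const)
    also have "((\<zeta> y * of_real (Lh s (x - y)) + drift \<zeta> x y * of_real (1 / s) + lap \<zeta> y) * of_real (Lh s (x - y) * hk s (x - y))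
        + (\<zeta> y * of_real (Lt s (x - y)) + drift \<zeta> x y * of_real (- 1 / s\<^sup>2) + 0) * of_real (hk s (x - y))) = l\<kappa> s y"
      unfolding l\<kappa>_def by (simp add: algebra_simps power2_eq_square)
    finally have "((\<lambda>s. l\<psi> s y) has_vector_derivative l\<kappa> s y) (at s)" .
    then have "((\<lambda>s. lap (\<psi> s) y) has_vector_derivative l\<kappa> s y) (at s)"
      by (rule has_vector_derivative_transform_within_open[of _ _ _ "{0<..}"]) (use s0 lap\<psi> in auto)
    then show "((\<lambda>s. lap (\<psi> s) y) has_vector_derivative lap (\<kappa> s) y) (at s)" using lap\<kappa>[OF s0] by simp
    show "cmod (\<kappa> s y) \<le> B" "cmod (lap (\<kappa> s) y) \<le> B" "cmod (lap (\<psi> s) y) \<le> B"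
      using B1[OF s, of y] B2[OF s, of y] B3[OF s, of y] by (auto simp: B_def lap\<psi>[OF s0] lap\<kappa>[OF s0])
  next
    show "continuous_on ?S (\<lambda>p. \<kappa> (fst p) (snd p))" by (rule c1)
    show "continuous_on ?S (\<lambda>p. lap (\<kappa> (fst p)) (snd p))"
      by (rule continuous_on_eq[OF c2]) (use pos lap\<kappa> in auto)
    show "continuous_on ?S (\<lambda>p. lap (\<psi> (fst p)) (snd p))"
      by (rule continuous_on_eq[OF c3]) (use pos lap\<psi> in auto)
  qed (use t \<epsilon> st in \<open>auto simp: \<tau>_def\<close>)
  also have "(\<integral>z. U z * (indicator {0<..<t} (fst z) * (lap (\<psi> (\<tau> - fst z)) (snd z) - \<kappa> (\<tau> - fst z) (snd z))) \<partial>lborel)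
      = (\<integral>z. U z * (indicator {0<..<t} (fst z) * ((drift \<zeta> x (snd z) * of_real (1 / (\<tau> - fst z)) + lap \<zeta> (snd z))
          * of_real (hk (\<tau> - fst z) (x - snd z)))) \<partial>lborel)"
  proof (rule Bochner_Integration.integral_cong)
    fix z :: "real \<times> 'a"
    show "U z * (indicator {0<..<t} (fst z) * (lap (\<psi> (\<tau> - fst z)) (snd z) - \<kappa> (\<tau> - fst z) (snd z)))
       = U z * (indicator {0<..<t} (fst z) * ((drift \<zeta> x (snd z) * of_real (1 / (\<tau> - fst z)) + lap \<zeta> (snd z))
          * of_real (hk (\<tau> - fst z) (x - snd z))))"
    proof (cases "fst z \<in> {0<..<t}")
      case True
      then have "\<tau> - fst z > 0" using \<epsilon> by (auto simp: \<tau>_def)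
      from lap\<psi>[OF this] show ?thesis by (simp add: l\<psi>_def \<kappa>_def algebra_simps)
    qed simp
  qed simp
  finally show "(\<integral>y. U (t, y) * (\<zeta> y * of_real (hk \<epsilon> (x - y))) \<partial>lborel)
      = (\<integral>y. v y * (\<zeta> y * of_real (hk (t + \<epsilon>) (x - y))) \<partial>lborel)
      + (\<integral>z. U z * (indicator {0<..<t} (fst z) * ((drift \<zeta> x (snd z) * of_real (1 / (t + \<epsilon> - fst z)) + lap \<zeta> (snd z))
          * of_real (hk (t + \<epsilon> - fst z) (x - snd z)))) \<partial>lborel)"
    unfolding \<psi>_def \<tau>_def .
qed

section \<open>Recovering a function from its Gaussian means\<close>

text \<open>Open sets are stable under intersection and generate the Borel sets, so the vanishing of
  the integrals spreads to all Borel sets by a Dynkin system argument.\<close>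

lemma AE_eq_0_if_open_integrals_eq_0:
  fixes g :: "'a::euclidean_space \<Rightarrow> complex"
  assumes g: "integrable lborel g" and zero: "\<And>S. open S \<Longrightarrow> (\<integral>x. g x * indicator S x \<partial>lborel) = 0"
  shows "AE x in lborel. g x = 0"
proof (rule sigma_finite_measure.density_zero[OF sigma_finite_lborel g])
  have si: "set_integrable lborel A g" if "A \<in> sets borel" for A
    using integrable_mult_indicator[OF _ g] that by (simp add: set_integrable_def)
  fix A :: "'a set" assume "A \<in> sets lborel"
  then have A: "A \<in> sigma_sets UNIV (Collect open)" by (simp add: sets_borel)
  have "Int_stable (Collect (open :: 'a set \<Rightarrow> bool))" "Collect (open :: 'a set \<Rightarrow> bool) \<subseteq> Pow UNIV"
    by (auto simp: Int_stable_def)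
  from this A show "(LINT x:A|lborel. g x) = 0"
  proof (induct rule: sigma_sets_induct_disjoint)
    case (basic A)
    have "(LINT x:A|lborel. g x) = (\<integral>x. g x * indicator A x \<partial>lborel)"
      unfolding set_lebesgue_integral_def by (rule Bochner_Integration.integral_cong) (auto simp: indicator_def)
    with basic zero show ?case by simp
  next
    case (compl A)
    have A: "A \<in> sets borel" using compl by (simp add: sets_borel)
    have "(LINT x:A \<union> (UNIV - A)|lborel. g x) = (LINT x:A|lborel. g x) + (LINT x:UNIV - A|lborel. g x)"
      using A by (intro set_integral_Un si) auto
    moreover have "(LINT x:UNIV|lborel. g x) = 0"
      using zero[of UNIV] by (simp add: set_lebesgue_integral_def)
    ultimately show ?case using compl by simp
  next
    case (union A)
    have A: "A i \<in> sets borel" for i using union by (auto simp: sets_borel)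
    have "(LINT x:(\<Union>i. A i)|lborel. g x) = (\<Sum>i. LINT x:A i|lborel. g x)"
      using union(1) A by (intro lebesgue_integral_countable_add si) (auto simp: disjoint_family_on_def)
    with union show ?case by simp
  qed (simp add: set_lebesgue_integral_def)
qed

lemma hk_le_gcoef: "s > 0 \<Longrightarrow> hk s (v::'a::euclidean_space) \<le> gcoef DIM('a) s"
  using gcoef_pos[of s "DIM('a)"] mult_left_mono[of "exp (- (norm v)\<^sup>2 / (4 * s))" 1 "gcoef DIM('a) s"]
  by (simp add: hk_def)

lemma integral_hk_tendsto:
  fixes \<beta> :: "'a::euclidean_space \<Rightarrow> complex"
  assumes \<beta>: "continuous_on UNIV \<beta>" "\<And>x. cmod (\<beta> x) \<le> 1" and e: "\<And>n. e n > 0" "e \<longlonglongrightarrow> 0"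
  shows "(\<lambda>n. \<integral>x. \<beta> x * of_real (hk (e n) (x - y)) \<partial>lborel) \<longlonglongrightarrow> \<beta> y"
    and "cmod (\<integral>x. \<beta> x * of_real (hk (e n) (x - y)) \<partial>lborel) \<le> 1"
proof -
  have [measurable]: "\<beta> \<in> borel_measurable borel" using \<beta>(1) by (rule borel_measurable_continuous_onI)
  have eq: "(\<integral>x. \<beta> x * of_real (hk (e n) (x - y)) \<partial>lborel) = (\<integral>v. of_real (hk (e n) v) * \<beta> (y + v) \<partial>lborel)" for n
    by (subst integral_lborel_translate[of _ y, symmetric]) (auto simp: mult.commute)
  show "(\<lambda>n. \<integral>x. \<beta> x * of_real (hk (e n) (x - y)) \<partial>lborel) \<longlonglongrightarrow> \<beta> y"
    unfolding eq
  proof (rule LIMSEQ_I)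
    fix r :: real assume r: "r > 0"
    have "continuous (at y) \<beta>" using \<beta>(1) by (simp add: continuous_on_eq_continuous_at)
    then obtain d where d: "d > 0" "\<And>x. dist x y < d \<Longrightarrow> dist (\<beta> x) (\<beta> y) < r / 2"
      unfolding continuous_at_eps_delta using r half_gt_zero by blast
    let ?C = "\<lambda>n. 2 * (sqrt 2 ^ DIM('a) * exp (- d\<^sup>2 / (8 * e n)))"
    have "?C \<longlonglongrightarrow> 2 * (sqrt 2 ^ DIM('a) * 0)"
    proof (intro tendsto_mult tendsto_const)
      have "filterlim (\<lambda>n. inverse (e n)) at_top sequentially"
        using e by (intro filterlim_inverse_at_top) auto
      then have "filterlim (\<lambda>n. (- d\<^sup>2 / 8) * inverse (e n)) at_bot sequentially"
        by (rule filterlim_tendsto_neg_mult_at_bot[OF tendsto_const, rotated]) (use d in simp)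
      from filterlim_compose[OF exp_at_bot this]
      show "(\<lambda>n. exp (- d\<^sup>2 / (8 * e n))) \<longlonglongrightarrow> 0" by (simp add: field_simps)
    qed
    then have "?C \<longlonglongrightarrow> 0" by simp
    from order_tendstoD(2)[OF this, of "r / 2"] r
    have "\<forall>\<^sub>F n in sequentially. ?C n < r / 2" by simp
    then have "\<forall>\<^sub>F n in sequentially. norm ((\<integral>v. of_real (hk (e n) v) * \<beta> (y + v) \<partial>lborel) - \<beta> y) < r"
    proof eventually_elim
      case (elim n)
      have "cmod ((\<integral>v. of_real (hk (e n) v) * \<beta> (y + v) \<partial>lborel) - \<beta> y) \<le> r / 2 + ?C n"
      proof (rule integral_hk_approx(2)[OF e(1) d(1)])
        show "cmod (\<beta> (y + v) - \<beta> y) \<le> 2" for v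
          using norm_triangle_ineq4[of "\<beta> (y + v)" "\<beta> y"] \<beta>(2)[of "y + v"] \<beta>(2)[of y] by linarith
        show "cmod (\<beta> (y + v) - \<beta> y) \<le> r / 2" if "norm v < d" for v
          using d(2)[of "y + v"] that by (simp add: dist_norm)
      qed simp
      then show ?case using elim by linarith
    qed
    then show "\<exists>no. \<forall>n\<ge>no. norm ((\<integral>v. of_real (hk (e n) v) * \<beta> (y + v) \<partial>lborel) - \<beta> y) < r"
      by (simp add: eventually_sequentially)
  qed
  have "cmod (\<integral>v. of_real (hk (e n) v) * \<beta> (y + v) \<partial>lborel) \<le> (\<integral>v. hk (e n) (v::'a) \<partial>lborel)"
  proof (rule Bochner_Integration.integral_norm_bound_integral)
    show "integrable lborel (\<lambda>v. of_real (hk (e n) v) * \<beta> (y + v))"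
      by (rule integrable_mult_bounded[of _ _ _ 1])
         (use \<beta>(2) integrable_hk[OF e(1)] in \<open>auto intro!: integrable_of_real\<close>)
    show "norm (of_real (hk (e n) v) * \<beta> (y + v)) \<le> hk (e n) v" for v
      using \<beta>(2)[of "y + v"] hk_pos[OF e(1), of n v] by (simp add: norm_mult mult_left_le)
  qed (use integrable_hk[OF e(1)] in auto)
  then show "cmod (\<integral>x. \<beta> x * of_real (hk (e n) (x - y)) \<partial>lborel) \<le> 1"
    unfolding eq using integral_hk[OF e(1), of n, where 'a='a] by simp
qed

text \<open>Exchanging the integrals moves the Gaussian means from \<open>F\<close> to a continuous
  \<open>\<beta>\<close> vanishing outside \<open>V\<close>, for which they converge boundedly. So
  \<open>F\<close> and \<open>r\<close> have the same integral against every such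
  \<open>\<beta>\<close>.\<close>

lemma AE_eq_limit_of_gaussian_means:
  fixes F r :: "'a::euclidean_space \<Rightarrow> complex"
  assumes F: "integrable lborel F" and V: "open V" "bounded V" and e: "\<And>n. e n > 0" "e \<longlonglongrightarrow> 0"
    and lim: "\<And>x. x \<in> V \<Longrightarrow> (\<lambda>n. \<integral>y. F y * of_real (hk (e n) (x - y)) \<partial>lborel) \<longlonglongrightarrow> r x"
    and bd: "\<And>x n. x \<in> V \<Longrightarrow> cmod (\<integral>y. F y * of_real (hk (e n) (x - y)) \<partial>lborel) \<le> C"
  shows "AE x in lborel. x \<in> V \<longrightarrow> F x = r x"
proof -
  have [measurable]: "F \<in> borel_measurable borel" using F by auto
  have [measurable]: "V \<in> sets borel" using V by simp
  define l where "l n x = (\<integral>y. F y * of_real (hk (e n) (x - y)) \<partial>lborel)" for n x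
  have lm [measurable]: "l n \<in> borel_measurable borel" for n
  proof -
    have "(\<lambda>(x, y). F y * of_real (hk (e n) (x - y))) \<in> borel_measurable (borel \<Otimes>\<^sub>M lborel)"
      unfolding hk_def by measurable
    then show ?thesis unfolding l_def[abs_def]
      by (rule lborel.borel_measurable_lebesgue_integral)
  qed
  \<comment> \<open>The hypotheses describe \<open>r\<close> only on \<open>V\<close>; the
    truncation is measurable as a pointwise limit of measurable functions.\<close>
  define r' where "r' x = indicator V x * r x" for x
  have r'_lim: "(\<lambda>n. indicator V x * l n x) \<longlonglongrightarrow> r' x" for x
    using lim[of x] by (cases "x \<in> V") (auto simp: r'_def l_def)
  have [measurable]: "r' \<in> borel_measurable borel"
    by (rule borel_measurable_LIMSEQ_metric[OF _ r'_lim]) measurable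
  have l_bd: "cmod (indicator V x * l n x) \<le> max C 0" for n x
    using bd[of x n] by (auto simp: l_def indicator_def le_max_iff_disj)
  have r'_bd: "cmod (r' x) \<le> max C 0" for x
    using LIMSEQ_le_const2[OF tendsto_norm[OF r'_lim[of x]]] l_bd by blast
  have iV: "integrable lborel (\<lambda>x. indicator V x :: complex)"
  proof -
    have "integrable lborel (\<lambda>x. complex_of_real (indicator V x))"
      using emeasure_bounded_finite[OF V(2)] by (intro integrable_of_real integrable_real_indicator) auto
    moreover have "(\<lambda>x. complex_of_real (indicator V x)) = (\<lambda>x. indicator V x)" by (auto simp: indicator_def)
    ultimately show ?thesis by simp
  qed
  define g where "g x = indicator V x * (F x - r' x)" for x
  have iVF: "integrable lborel (\<lambda>x. indicator V x * F x)"
    using integrable_mult_bounded[OF F, of "indicator V" 1] by (auto simp: mult.commute indicator_def)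
  have iVr: "integrable lborel (\<lambda>x. indicator V x * r' x)"
    by (rule integrable_mult_bounded[OF iV, of _ "max C 0"]) (use r'_bd in auto)
  have g: "integrable lborel g"
    using Bochner_Integration.integrable_diff[OF iVF iVr] by (simp add: g_def[abs_def] right_diff_distrib)
  have main: "(\<integral>x. g x * \<beta> x \<partial>lborel) = 0"
    if \<beta>: "continuous_on UNIV \<beta>" "\<And>x. cmod (\<beta> x) \<le> 1" "\<And>x. x \<notin> V \<Longrightarrow> \<beta> x = 0" for \<beta>
  proof -
    have [measurable]: "\<beta> \<in> borel_measurable borel" using \<beta>(1) by (rule borel_measurable_continuous_onI)
    have i\<beta>: "integrable lborel \<beta>"
    proof -
      have "integrable lborel (\<lambda>x. indicator V x * \<beta> x)"
        by (rule integrable_mult_bounded[OF iV, of _ 1]) (use \<beta> in auto)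
      moreover have "(\<lambda>x. indicator V x * \<beta> x) = \<beta>" using \<beta>(3) by (auto simp: indicator_def fun_eq_iff)
      ultimately show ?thesis by simp
    qed
    have "(\<integral>x. \<beta> x * (indicator V x * l n x) \<partial>lborel) = (\<integral>y. F y * (\<integral>x. \<beta> x * of_real (hk (e n) (x - y)) \<partial>lborel) \<partial>lborel)" for n
    proof -
      have i: "integrable lborel (\<lambda>p. (\<beta> (fst p) * F (snd p)) * of_real (hk (e n) (fst p - snd p)))"
      proof (rule integrable_mult_bounded[OF integrable_times_lborel[OF i\<beta> F], of _ "gcoef DIM('a) (e n)"])
        show "(\<lambda>p. complex_of_real (hk (e n) (fst p - snd p :: 'a))) \<in> borel_measurable lborel"
          by (rule borel_measurable_lborel_pair) (unfold hk_def, measurable)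
        show "AE p in lborel. cmod (of_real (hk (e n) (fst p - snd p :: 'a))) \<le> gcoef DIM('a) (e n)"
          using hk_le_gcoef[OF e(1), where 'a='a] hk_pos[OF e(1), where 'a='a] by (intro AE_I2) (simp add: abs_of_pos)
      qed
      have "(\<integral>x. \<beta> x * (indicator V x * l n x) \<partial>lborel) = (\<integral>x. \<integral>y. \<beta> x * F y * of_real (hk (e n) (x - y)) \<partial>lborel \<partial>lborel)"
        using \<beta>(3) by (intro Bochner_Integration.integral_cong refl) (auto simp: l_def indicator_def mult.assoc)
      also have "\<dots> = (\<integral>y. \<integral>x. \<beta> x * F y * of_real (hk (e n) (x - y)) \<partial>lborel \<partial>lborel)"
        using integral_fst_lborel[OF i] integral_snd_lborel[OF i] by simp
      also have "\<dots> = (\<integral>y. F y * (\<integral>x. \<beta> x * of_real (hk (e n) (x - y)) \<partial>lborel) \<partial>lborel)"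
      proof (intro Bochner_Integration.integral_cong refl)
        fix y
        have "(\<integral>x. \<beta> x * F y * of_real (hk (e n) (x - y)) \<partial>lborel) = (\<integral>x. F y * (\<beta> x * of_real (hk (e n) (x - y))) \<partial>lborel)"
          by (simp only: mult_ac)
        then show "(\<integral>x. \<beta> x * F y * of_real (hk (e n) (x - y)) \<partial>lborel) = F y * (\<integral>x. \<beta> x * of_real (hk (e n) (x - y)) \<partial>lborel)"
          by simp
      qed
      finally show ?thesis .
    qed
    moreover have "(\<lambda>n. \<integral>y. F y * (\<integral>x. \<beta> x * of_real (hk (e n) (x - y)) \<partial>lborel) \<partial>lborel) \<longlonglongrightarrow> (\<integral>y. F y * \<beta> y \<partial>lborel)"
    proof (rule tendsto_integral_mult_bounded[OF F, where B = 1])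
      show "(\<lambda>y. \<integral>x. \<beta> x * of_real (hk (e n) (x - y)) \<partial>lborel) \<in> borel_measurable lborel" for n
      proof -
        have "(\<lambda>(y, x). \<beta> x * of_real (hk (e n) (x - y))) \<in> borel_measurable (borel \<Otimes>\<^sub>M lborel)"
          unfolding hk_def by measurable
        then show ?thesis unfolding measurable_lborel2 by (rule lborel.borel_measurable_lebesgue_integral)
      qed
      show "AE y in lborel. cmod (\<integral>x. \<beta> x * of_real (hk (e n) (x - y)) \<partial>lborel) \<le> 1" for n
        using integral_hk_tendsto(2)[OF \<beta>(1,2) e] by (intro AE_I2)
      show "AE y in lborel. (\<lambda>n. \<integral>x. \<beta> x * of_real (hk (e n) (x - y)) \<partial>lborel) \<longlonglongrightarrow> \<beta> y"
        using integral_hk_tendsto(1)[OF \<beta>(1,2) e] by (intro AE_I2)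
    qed simp
    moreover have "(\<lambda>n. \<integral>x. \<beta> x * (indicator V x * l n x) \<partial>lborel) \<longlonglongrightarrow> (\<integral>x. \<beta> x * r' x \<partial>lborel)"
      by (rule tendsto_integral_mult_bounded[OF i\<beta>, where B = "max C 0"]) (use l_bd r'_lim in auto)
    ultimately have "(\<integral>y. F y * \<beta> y \<partial>lborel) = (\<integral>x. \<beta> x * r' x \<partial>lborel)" using LIMSEQ_unique by simp
    moreover have "g x * \<beta> x = F x * \<beta> x - \<beta> x * r' x" for x
      using \<beta>(3)[of x] by (auto simp: g_def indicator_def algebra_simps)
    moreover have "integrable lborel (\<lambda>x. F x * \<beta> x)" "integrable lborel (\<lambda>x. \<beta> x * r' x)"
      by (rule integrable_mult_bounded[OF F, of _ 1] integrable_mult_bounded[OF i\<beta>, of _ "max C 0"]; use \<beta> r'_bd in auto)+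
    ultimately show ?thesis by simp
  qed
  have "AE x in lborel. g x = 0"
  proof (rule AE_eq_0_if_open_integrals_eq_0[OF g])
    fix S :: "'a set" assume S: "open S"
    define O' where "O' = S \<inter> V"
    have O': "open O'" using S V by (auto simp: O'_def)
    \<comment> \<open>The complement must be nonempty because \<open>infdist\<close> to the empty
      set is 0 by convention.\<close>
    have "O' \<noteq> UNIV" using V(2) not_bounded_UNIV by (metis O'_def Int_UNIV)
    then have ne: "- O' \<noteq> {}" by auto
    \<comment> \<open>Continuous functions increasing to the indicator of the open set
      \<open>O'\<close>.\<close>
    define \<beta> where "\<beta> k x = complex_of_real (min 1 (real k * infdist x (- O')))" for k x
    have "(\<integral>x. g x * \<beta> k x \<partial>lborel) = 0" for k
    proof (rule main)
      show "continuous_on UNIV (\<beta> k)" unfolding \<beta>_def by (intro continuous_intros)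
      show "cmod (\<beta> k x) \<le> 1" for x unfolding \<beta>_def norm_of_real by (simp add: infdist_nonneg)
      show "\<beta> k x = 0" if "x \<notin> V" for x
        using that by (auto simp: \<beta>_def O'_def min_def)
    qed
    moreover have "(\<lambda>k. \<integral>x. g x * \<beta> k x \<partial>lborel) \<longlonglongrightarrow> (\<integral>x. g x * indicator O' x \<partial>lborel)"
    proof (rule tendsto_integral_mult_bounded[OF g, where B = 1])
      show "\<beta> k \<in> borel_measurable lborel" for k
        unfolding \<beta>_def measurable_lborel2 by (intro borel_measurable_continuous_onI continuous_intros)
      show "(indicator O' :: 'a \<Rightarrow> complex) \<in> borel_measurable lborel" using O' by simp
      show "AE x in lborel. cmod (\<beta> k x) \<le> 1" for k
        unfolding \<beta>_def norm_of_real by (intro AE_I2) (simp add: infdist_nonneg)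
      show "AE x in lborel. (\<lambda>k. \<beta> k x) \<longlonglongrightarrow> indicator O' x"
      proof (intro AE_I2)
        fix x
        show "(\<lambda>k. \<beta> k x) \<longlonglongrightarrow> indicator O' x"
        proof (cases "x \<in> O'")
          case False
          then show ?thesis by (simp add: \<beta>_def)
        next
          case True
          have pos: "infdist x (- O') > 0"
            using True O' ne infdist_pos_not_in_closed[of "- O'" x] by (simp add: closed_def)
          obtain k0 :: nat where k0: "1 / infdist x (- O') < real k0" using reals_Archimedean2 by blast
          have "\<forall>\<^sub>F k in sequentially. \<beta> k x = indicator O' x"
          proof (rule eventually_sequentiallyI[of k0])
            fix k assume k: "k0 \<le> k"
            have "1 < real k0 * infdist x (- O')" using k0 pos by (simp add: field_simps)
            also have "\<dots> \<le> real k * infdist x (- O')" using k pos by (intro mult_right_mono) auto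
            finally show "\<beta> k x = indicator O' x" using True by (simp add: \<beta>_def)
          qed
          then show ?thesis by (rule tendsto_eventually)
        qed
      qed
    qed
    ultimately have "(\<integral>x. g x * indicator O' x \<partial>lborel) = 0" by (simp add: LIMSEQ_const_iff)
    moreover have "g x * indicator S x = g x * indicator O' x" for x
      by (auto simp: g_def O'_def indicator_def)
    ultimately show "(\<integral>x. g x * indicator S x \<partial>lborel) = 0" by (simp only:)
  qed
  then show ?thesis by eventually_elim (auto simp: g_def r'_def)
qed

section \<open>The profile of the shift\<close>

text \<open>Such squares are the primitives of the piecewise linear functions from which the profile
  is built.\<close>

lemma has_real_derivative_pos_part_power2:
  "((\<lambda>s. (max 0 s)\<^sup>2 / 2) has_real_derivative max 0 s) (at (s::real))"
proof (cases s "0::real" rule: linorder_cases)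
  case less
  have "((\<lambda>s. 0) has_real_derivative 0) (at s)" by simp
  then have "((\<lambda>s. (max 0 s)\<^sup>2 / 2) has_real_derivative 0) (at s)"
    by (rule has_field_derivative_transform_within_open[of _ _ _ "{..<0}"]) (use less in auto)
  then show ?thesis using less by simp
next
  case greater
  have "((\<lambda>s. s\<^sup>2 / 2) has_real_derivative s) (at s)" by (auto intro!: derivative_eq_intros)
  then have "((\<lambda>s. (max 0 s)\<^sup>2 / 2) has_real_derivative s) (at s)"
    by (rule has_field_derivative_transform_within_open[of _ _ _ "{0<..}"]) (use greater in auto)
  then show ?thesis using greater by simp
next
  case equal
  have "((\<lambda>h. \<bar>h\<bar> / 2) \<longlongrightarrow> \<bar>0\<bar> / (2::real)) (at 0)" by (intro tendsto_intros) simp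
  then have lim: "((\<lambda>h. \<bar>h\<bar> / 2) \<longlongrightarrow> (0::real)) (at 0)" by simp
  have "((\<lambda>h. ((max 0 (0 + h))\<^sup>2 / 2 - (max 0 0)\<^sup>2 / 2) / h) \<longlongrightarrow> 0) (at (0::real))"
  proof (rule tendsto_norm_zero_cancel, rule tendsto_sandwich[OF _ _ tendsto_const lim])
    show "\<forall>\<^sub>F h in at (0::real). norm (((max 0 (0 + h))\<^sup>2 / 2 - (max 0 0)\<^sup>2 / 2) / h) \<le> \<bar>h\<bar> / 2"
      by (intro always_eventually allI) (auto simp: max_def power2_eq_square abs_mult)
  qed simp
  then show ?thesis unfolding equal DERIV_def by simp
qed

text \<open>The profile averages a piecewise linear descent over a window of length
  \<open>\<nu> / 2\<close>, which makes it continuously differentiable. The descent from 1 to 0 is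
  spread over the length \<open>a + \<nu>\<close> instead of \<open>a\<close>, so the slope of
  \<open>a * g\<close> stays below 1 as the Gaussian bound demands; the last inequality keeps the
  shifted points where the data are holomorphic.\<close>

lemma shift_profile:
  fixes a \<nu> :: real
  assumes "a > 0" "\<nu> > 0"
  obtains g g' L where "\<And>r. (g has_real_derivative g' r) (at r)" "continuous_on UNIV g'"
    "\<And>r. r \<le> \<nu> / 2 \<Longrightarrow> g r = 1" "\<And>r. r < \<nu> / 2 \<Longrightarrow> g' r = 0" "\<And>r. r \<ge> a + 2 * \<nu> \<Longrightarrow> g r = 0" "\<And>r. 0 \<le> g r" "\<And>r. g r \<le> 1"
    "\<And>r. \<bar>g' r\<bar> \<le> L" "\<And>r. 0 \<le> r \<Longrightarrow> (1 - g r) * a \<le> a / (a + \<nu>) * r"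
    "\<And>r. 0 \<le> r \<Longrightarrow> r \<le> a + 2 * \<nu> \<Longrightarrow> a * g r + r \<le> a + 2 * \<nu>"
proof -
  define \<beta> where "\<beta> = a + 2 * \<nu>"
  define m where "m s = 1 - (max 0 (s - \<nu>) - max 0 (s - \<beta>)) / (a + \<nu>)" for s
  define M where "M s = s - ((max 0 (s - \<nu>))\<^sup>2 / 2 - (max 0 (s - \<beta>))\<^sup>2 / 2) / (a + \<nu>)" for s
  have M: "(M has_real_derivative m s) (at s)" for s
  proof -
    have p: "((\<lambda>s. (max 0 (s - c))\<^sup>2 / 2) has_real_derivative max 0 (s - c)) (at s)" for c
    proof -
      have "((\<lambda>s. s - c) has_real_derivative 1) (at s)" by (auto intro!: derivative_eq_intros)
      from DERIV_chain2[where g = "\<lambda>s. s - c" and f = "\<lambda>s. (max 0 s)\<^sup>2 / 2", OF has_real_derivative_pos_part_power2 this]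
      show ?thesis by simp
    qed
    show ?thesis unfolding M_def m_def
      by (intro DERIV_diff DERIV_ident DERIV_cdivide p)
  qed
  have m1: "m s = 1" if "s \<le> \<nu>" for s using that assms by (simp add: m_def \<beta>_def)
  have m0: "m s = 0" if "s \<ge> \<beta>" for s using that assms by (simp add: m_def \<beta>_def field_simps)
  have mm: "m s = (\<beta> - s) / (a + \<nu>)" if "\<nu> \<le> s" "s \<le> \<beta>" for s
    using that assms by (simp add: m_def \<beta>_def field_simps)
  have m_ge: "m s \<ge> 0" for s
    using m1[of s] m0[of s] mm[of s] assms by (cases "s \<le> \<nu>"; cases "s \<ge> \<beta>") auto
  have m_le: "m s \<le> 1" for s
  proof -
    have "max 0 (s - \<beta>) \<le> max 0 (s - \<nu>)" using assms by (auto simp: \<beta>_def)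
    then show ?thesis using assms by (simp add: m_def)
  qed
  define g where "g r = (M (r + \<nu> / 2) - M r) / (\<nu> / 2)" for r
  define g' where "g' r = (m (r + \<nu> / 2) - m r) / (\<nu> / 2)" for r
  \<comment> \<open>By the mean value theorem the average is a value of \<open>m\<close> slightly to
    the right of \<open>r\<close>, so the bounds are inherited from \<open>m\<close>.\<close>
  have gm: "\<exists>s. r < s \<and> s < r + \<nu> / 2 \<and> g r = m s" for r
  proof -
    have "\<exists>s>r. s < r + \<nu> / 2 \<and> M (r + \<nu> / 2) - M r = (r + \<nu> / 2 - r) * m s"
      by (rule MVT2) (use assms M in auto)
    then show ?thesis using assms by (auto simp: g_def)
  qed
  show ?thesis
  proof (rule that[of g g' "2 / (\<nu> / 2)"])
    show "(g has_real_derivative g' r) (at r)" for r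
    proof -
      have "((\<lambda>r. M (r + \<nu> / 2)) has_real_derivative m (r + \<nu> / 2) * 1) (at r)"
        by (rule DERIV_chain2[OF M]) (auto intro!: derivative_eq_intros)
      then show ?thesis unfolding g_def g'_def
        using M by (intro DERIV_cdivide DERIV_diff) auto
    qed
    show "continuous_on UNIV g'" unfolding g'_def m_def using assms by (intro continuous_intros) auto
    show "g r = 1" if "r \<le> \<nu> / 2" for r using gm[of r] m1 that by fastforce
    show "g' r = 0" if "r < \<nu> / 2" for r using that assms by (simp add: g'_def m1)
    show "g r = 0" if "r \<ge> a + 2 * \<nu>" for r using gm[of r] m0 that by (fastforce simp: \<beta>_def)
    show "0 \<le> g r" "g r \<le> 1" for r using gm[of r] m_ge m_le by metis+
    show "\<bar>g' r\<bar> \<le> 2 / (\<nu> / 2)" for r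
    proof -
      have "\<bar>m (r + \<nu> / 2) - m r\<bar> \<le> 2"
        using m_ge[of r] m_le[of r] m_ge[of "r + \<nu> / 2"] m_le[of "r + \<nu> / 2"] by linarith
      then show ?thesis using assms unfolding g'_def abs_divide by (intro divide_mono) auto
    qed
    show "(1 - g r) * a \<le> a / (a + \<nu>) * r" if r: "0 \<le> r" for r
    proof -
      obtain s where s: "r < s" "s < r + \<nu> / 2" "g r = m s" using gm by blast
      \<comment> \<open>The plateau of \<open>m\<close> up to \<open>\<nu>\<close> is longer than
        the window, so \<open>s - \<nu> < r\<close>.\<close>
      have "1 - m s \<le> r / (a + \<nu>)"
      proof (cases "s \<le> \<nu>")
        case True
        then show ?thesis using m1 r assms by simp
      next
        case False
        have "max 0 (s - \<nu>) - max 0 (s - \<beta>) \<le> r" using s False assms by auto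
        then show ?thesis using assms by (simp add: m_def divide_right_mono)
      qed
      then have "(1 - m s) * a \<le> r / (a + \<nu>) * a" using assms by (intro mult_right_mono) auto
      then show ?thesis by (simp add: s mult.commute)
    qed
    show "a * g r + r \<le> a + 2 * \<nu>" if r: "0 \<le> r" "r \<le> a + 2 * \<nu>" for r
    \<comment> \<open>Up to \<open>2 * \<nu>\<close> the bound \<open>g r \<le> 1\<close> suffices;
      beyond, \<open>s\<close> lies past the plateau and the linear formula for \<open>m\<close>
      applies.\<close>
    proof (cases "r \<le> 2 * \<nu>")
      case True
      have "g r \<le> 1" using gm[of r] m_le by metis
      then have "a * g r \<le> a" using assms by (simp add: mult_left_le)
      then show ?thesis using True by linarith
    next
      case False
      obtain s where s: "r < s" "s < r + \<nu> / 2" "g r = m s" using gm by blast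
      have "m s \<le> (\<beta> - r) / (a + \<nu>)"
      proof (cases "s \<le> \<beta>")
        case True
        then have "m s = (\<beta> - s) / (a + \<nu>)" using s False assms by (intro mm) auto
        then show ?thesis using s assms by (simp add: divide_right_mono)
      next
        case False
        then show ?thesis using m0[of s] r assms by (simp add: \<beta>_def)
      qed
      also have "\<dots> \<le> (\<beta> - r) / a" using assms r by (intro divide_left_mono) (auto simp: \<beta>_def)
      finally have "a * m s \<le> \<beta> - r" using assms by (simp add: field_simps)
      then show ?thesis by (simp add: s \<beta>_def)
    qed
  qed
qed

section \<open>The local representation\<close>

text \<open>The local domain of holomorphy of the initial data: with \<open>r\<close> the distance
  of \<open>x\<close> from the frontier it is contained in the tube.\<close>

definition diamond :: "real ^ 'n \<Rightarrow> real \<Rightarrow> (complex ^ 'n) set" where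
  "diamond x r = {z. norm (Rev z - x) + norm (Imv z) < r}"

lemma open_diamond: "open (diamond x r)"
  unfolding diamond_def
  by (intro open_Collect_less continuous_intros continuous_on_Rev continuous_on_Imv)

lemma convex_diamond: "convex (diamond x r)"
proof (rule convexI)
  fix z w :: "complex ^ 'a" and u v :: real
  assume zw: "z \<in> diamond x r" "w \<in> diamond x r" and uv: "0 \<le> u" "0 \<le> v" "u + v = 1"
  have R: "Rev (u *\<^sub>R z + v *\<^sub>R w) - x = u *\<^sub>R (Rev z - x) + v *\<^sub>R (Rev w - x)"
  proof -
    have "x = u *\<^sub>R x + v *\<^sub>R x" using uv by (simp flip: scaleR_add_left)
    then show ?thesis
      by (simp add: linear_add[OF linear_Rev] linear_scale[OF linear_Rev] algebra_simps)
  qed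
  have "norm (u *\<^sub>R (Rev z - x) + v *\<^sub>R (Rev w - x)) + norm (u *\<^sub>R Imv z + v *\<^sub>R Imv w)
      \<le> (u * norm (Rev z - x) + v * norm (Rev w - x)) + (u * norm (Imv z) + v * norm (Imv w))"
    using uv by (intro add_mono order_trans[OF norm_triangle_ineq]) auto
  also have "\<dots> = u * (norm (Rev z - x) + norm (Imv z)) + v * (norm (Rev w - x) + norm (Imv w))"
    by (simp add: algebra_simps)
  also have "\<dots> < r"
    using zw uv by (intro convex_bound_lt) (auto simp: diamond_def)
  finally show "u *\<^sub>R z + v *\<^sub>R w \<in> diamond x r"
    by (simp add: diamond_def R linear_add[OF linear_Imv] linear_scale[OF linear_Imv])
qed

lemma Basis_vec_real: "(Basis :: (real ^ 'n) set) = range (\<lambda>i. axis i 1)"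
  by (auto simp: Basis_vec_def)

lemma sum_Basis_vec: "(\<Sum>b\<in>(Basis :: (real ^ 'n) set). g b) = (\<Sum>i\<in>UNIV. g (axis i 1))"
proof -
  have "inj (\<lambda>i :: 'n. axis i (1::real))" by (auto simp: inj_on_def axis_eq_axis)
  then show ?thesis unfolding Basis_vec_real by (simp add: sum.reindex)
qed

text \<open>All radii are measured by the margin \<open>\<nu>\<close>. The real part of
  \<open>z\<close> stays within \<open>\<nu>\<close> of \<open>x0\<close> and its imaginary part
  below \<open>a\<close>; the shift ends at distance \<open>a + 2 * \<nu>\<close> from the real
  part, hence within \<open>a + 3 * \<nu>\<close> of \<open>x0\<close>. The cutoff is 1 up to radius
  \<open>a + 4 * \<nu>\<close>, is 0 from \<open>a + 6 * \<nu>\<close> on, and is a test function on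
  the ball of radius \<open>a + 7 * \<nu>\<close>. In the application \<open>a + 8 * \<nu>\<close>
  is the distance to the frontier and \<open>U\<close> is the solution extended by 0.\<close>

locale local_heat =
  fixes U :: "real \<times> (real ^ 'n) \<Rightarrow> complex" and U0 :: "complex ^ 'n \<Rightarrow> complex"
    and x0 :: "real ^ 'n" and a \<nu> :: real
  assumes a: "a > 0" and \<nu>: "\<nu> > 0"
    and U: "integrable lborel U" "\<And>z. fst z \<le> 0 \<Longrightarrow> U z = 0"
    and U0: "holomorphic_several_on U0 (diamond x0 (a + 8 * \<nu>))"
begin

definition "cutoff = bump x0 (a + 4 * \<nu>) (a + 6 * \<nu>)"
definition "init y = U0 (cvec y 0) * cutoff y"
definition "C = cylinder x0 \<nu> a"
definition "driftc z y = (\<Sum>i\<in>UNIV. dderiv (axis i 1) cutoff y * (z $ i - of_real (y $ i)))"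
text \<open>Since \<open>Ker\<close> vanishes for nonpositive times and \<open>U\<close> before time 0, the time integral in \<open>Bt\<close> needs no bounds.\<close>

definition "Ker s z y = (if s > 0 then (driftc z y * of_real (1 / s) + lap cutoff y) * hkc s (z - cvec y 0) else 0)"
definition "G t z = (\<integral>y. init y * hkc t (z - cvec y 0) \<partial>lborel)"
definition "Bt t z = (\<integral>p. U p * Ker (t - fst p) z (snd p) \<partial>lborel)"
definition "R t z = G t z + Bt t z"

section \<open>The cutoff and the localised data\<close>

lemma smooth_cutoff: "smooth cutoff"
  unfolding cutoff_def by (rule smooth_bump)

lemma cutoff_1: "norm (y - x0) \<le> a + 4 * \<nu> \<Longrightarrow> cutoff y = 1"
  and cutoff_0: "a + 6 * \<nu> \<le> norm (y - x0) \<Longrightarrow> cutoff y = 0"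
  unfolding cutoff_def using a \<nu> by (auto intro: bump_eq_1 bump_eq_0)

lemma test_cutoff: "test_function (ball x0 (a + 7 * \<nu>)) cutoff"
  unfolding cutoff_def using a \<nu> by (intro test_function_bump) auto

lemma local_const_derivs:
  assumes "open S" "y \<in> S" "\<And>y. y \<in> S \<Longrightarrow> cutoff y = c"
  shows "dderiv b cutoff y = 0" "lap cutoff y = 0"
proof -
  have d: "dderiv b cutoff y = 0" if "y \<in> S" for b y
    by (rule dderiv_eq, rule has_derivative_transform_within_open[of "\<lambda>y. c" _ _ _ S]) (use assms that in auto)
  then show "dderiv b cutoff y = 0" using assms by blast
  have "dderiv b (dderiv b cutoff) y = 0" for b
    by (rule dderiv_eq, rule has_derivative_transform_within_open[of "\<lambda>y. 0" _ _ _ S]) (use assms d in auto)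
  then show "lap cutoff y = 0" by (simp add: lap_def)
qed

lemma derivs_0:
  assumes "norm (y - x0) < a + 4 * \<nu> \<or> norm (y - x0) > a + 6 * \<nu>"
  shows "dderiv b cutoff y = 0" "lap cutoff y = 0"
proof -
  have 1: "open {y. norm (y - x0) < a + 4 * \<nu>}" "open {y. norm (y - x0) > a + 6 * \<nu>}"
    by (intro open_Collect_less continuous_intros)+
  have "dderiv b cutoff y = 0 \<and> lap cutoff y = 0"
    using assms
  proof
    assume "norm (y - x0) < a + 4 * \<nu>"
    then show ?thesis using local_const_derivs[OF 1(1), of y 1] cutoff_1 by auto
  next
    assume "norm (y - x0) > a + 6 * \<nu>"
    then show ?thesis using local_const_derivs[OF 1(2), of y 0] cutoff_0 by auto
  qed
  then show "dderiv b cutoff y = 0" "lap cutoff y = 0" by auto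
qed

lemma Ker_0: "norm (y - x0) < a + 4 * \<nu> \<or> norm (y - x0) > a + 6 * \<nu> \<Longrightarrow> Ker s z y = 0"
  by (simp add: Ker_def driftc_def derivs_0)

text \<open>\<open>U0\<close> is controlled only on the diamond, but the cutoff vanishes before its
  real section ends, so two overlapping open sets cover the space.\<close>

lemma continuous_init: "continuous_on UNIV init"
proof -
  have "UNIV = ball x0 (a + 8 * \<nu>) \<union> - cball x0 (a + 6 * \<nu>)" using a \<nu> by auto
  moreover have "continuous_on (ball x0 (a + 8 * \<nu>) \<union> - cball x0 (a + 6 * \<nu>)) init"
  proof (rule continuous_on_open_Un)
    show "continuous_on (ball x0 (a + 8 * \<nu>)) init" unfolding init_def
      by (intro continuous_intros continuous_on_compose2[OF holomorphic_several_imp_continuous[OF U0]]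
          continuous_on_cvec smooth_imp_continuous smooth_cutoff)
         (auto simp: diamond_def dist_norm norm_minus_commute)
    show "continuous_on (- cball x0 (a + 6 * \<nu>)) init"
      by (rule continuous_on_eq[OF continuous_on_const[of _ 0]])
         (auto simp: init_def cutoff_0 dist_norm norm_minus_commute)
  qed auto
  ultimately show ?thesis by simp
qed

lemma init_0: "norm (y - x0) \<ge> a + 6 * \<nu> \<Longrightarrow> init y = 0"
  by (simp add: init_def cutoff_0)

lemma init_0': "norm y > norm x0 + (a + 6 * \<nu>) \<Longrightarrow> init y = 0"
  using norm_triangle_ineq2[of y x0] by (intro init_0) linarith

lemma integrable_init: "integrable lborel init"
  using integrable_continuous_compact_support[OF continuous_init init_0'] .

lemma init_borel [measurable]: "init \<in> borel_measurable borel"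
  using continuous_init by (rule borel_measurable_continuous_onI)

section \<open>Estimates of the kernel on the cylinder\<close>

lemma in_C: "cvec x \<eta> \<in> C \<longleftrightarrow> norm (x - x0) < \<nu> \<and> norm \<eta> < a"
  by (simp add: C_def cylinder_def)

lemma open_C: "open C" and convex_C: "convex C"
  by (simp_all add: C_def open_cylinder convex_cylinder)

lemma C_cases:
  assumes "z \<in> C"
  obtains x \<eta> where "z = cvec x \<eta>" "norm (x - x0) < \<nu>" "norm \<eta> < a"
  using assms in_C[of "Rev z" "Imv z"] that[of "Rev z" "Imv z"] by simp

text \<open>The real part of \<open>z\<close> is within \<open>\<nu>\<close> of \<open>x0\<close>,
  so its distance to \<open>y\<close> is at least \<open>a + 3 * \<nu>\<close>, and the real part of
  the complex square is at least
  \<open>(a + 3 * \<nu>)\<^sup>2 - a\<^sup>2 \<ge> 9 * \<nu>\<^sup>2\<close>.\<close>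

lemma hkc_bound:
  assumes z: "z \<in> C" and y: "norm (y - x0) \<ge> a + 4 * \<nu>" and s: "s > 0"
  shows "cmod (hkc s (z - cvec y 0)) \<le> gcoef CARD('n) s * exp (- (9 * \<nu>\<^sup>2) / (4 * s))"
proof -
  obtain x \<eta> where x: "z = cvec x \<eta>" "norm (x - x0) < \<nu>" "norm \<eta> < a" using z by (rule C_cases)
  have "norm (y - x0) \<le> norm (x - y) + norm (x - x0)"
    using norm_triangle_ineq[of "y - x" "x - x0"] by (simp add: norm_minus_commute)
  then have "a + 3 * \<nu> \<le> norm (x - y)" using x y by linarith
  then have "(a + 3 * \<nu>)\<^sup>2 \<le> (norm (x - y))\<^sup>2" using a \<nu> by (intro power_mono) auto
  moreover have "(norm \<eta>)\<^sup>2 \<le> a\<^sup>2" using x by (intro power_mono) auto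
  moreover have "(a + 3 * \<nu>)\<^sup>2 - a\<^sup>2 \<ge> 9 * \<nu>\<^sup>2" using a \<nu> by (simp add: power2_eq_square algebra_simps)
  ultimately have "9 * \<nu>\<^sup>2 \<le> (norm (x - y))\<^sup>2 - (norm \<eta>)\<^sup>2" by linarith
  then have "- ((norm (x - y))\<^sup>2 - (norm \<eta>)\<^sup>2) / (4 * s) \<le> - (9 * \<nu>\<^sup>2) / (4 * s)"
    using s by (intro divide_right_mono) auto
  then show ?thesis
    using gcoef_pos[OF s, of "CARD('n)"] by (simp add: x cvec_diff cmod_hkc[OF s])
qed

lemma driftc_bounded: obtains b where "b \<ge> 0" "\<And>z y. z \<in> C \<Longrightarrow> cmod (driftc z y) \<le> b"
proof -
  have "\<exists>B. \<forall>y. cmod (dderiv (axis i 1) cutoff y) \<le> B" for i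
    using test_function_bounded[OF test_function_dderiv[OF test_cutoff, of "axis i 1"]]
    by (metis Basis_vec_real rangeI)
  then obtain B where B: "\<And>i y. cmod (dderiv (axis i 1) cutoff y) \<le> B i" by metis
  define c where "c = 7 * \<nu> + 2 * a"
  have le: "cmod (dderiv (axis i 1) cutoff y * (z $ i - of_real (y $ i))) \<le> B i * c" if z: "z \<in> C" for z y i
  proof (cases "norm (y - x0) \<le> a + 6 * \<nu>")
    case True
    obtain x \<eta> where x: "z = cvec x \<eta>" "norm (x - x0) < \<nu>" "norm \<eta> < a" using z by (rule C_cases)
    have "z $ i - of_real (y $ i) = Complex ((x - y) $ i) (\<eta> $ i)"
      by (simp add: x cvec_nth complex_eq_iff)
    also have "cmod \<dots> \<le> \<bar>(x - y) $ i\<bar> + \<bar>\<eta> $ i\<bar>"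
      using cmod_le[of "Complex ((x - y) $ i) (\<eta> $ i)"] by simp
    also have "\<dots> \<le> norm (x - y) + norm \<eta>" by (intro add_mono component_le_norm_cart)
    also have "norm (x - y) \<le> norm (x - x0) + norm (y - x0)" using norm_triangle_ineq4[of "x - x0" "y - x0"] by simp
    finally have "cmod (z $ i - of_real (y $ i)) \<le> c" using x True by (simp add: c_def)
    then show ?thesis unfolding norm_mult by (intro mult_mono B) (use order_trans[OF norm_ge_zero B] in auto)
  next
    case False
    then show ?thesis using a \<nu> order_trans[OF norm_ge_zero B[of i y]] by (simp add: derivs_0 c_def)
  qed
  have b: "cmod (driftc z y) \<le> (\<Sum>i\<in>UNIV. B i * c)" if "z \<in> C" for z y
    unfolding driftc_def by (intro sum_norm_le le that)
  have "cvec x0 0 \<in> C" using a \<nu> by (simp add: in_C)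
  then have "(\<Sum>i\<in>UNIV. B i * c) \<ge> 0" using b order_trans[OF norm_ge_zero] by blast
  then show ?thesis using that b by blast
qed

text \<open>The kernel lives on the annulus where the cutoff varies; there the Gaussian factor of
  \<open>hkc_bound\<close> outweighs both \<open>1 / s\<close> and the normalisation. The bound
  \<open>m\<close> gives smallness for short times, while \<open>M\<close> is a majorant for all
  times.\<close>

lemma Ker_estimate:
  obtains m M where "(m \<longlongrightarrow> 0) (at_right 0)" "M \<ge> 0" "\<And>s z y. s > 0 \<Longrightarrow> z \<in> C \<Longrightarrow> cmod (Ker s z y) \<le> m s"
    "\<And>s z y. z \<in> C \<Longrightarrow> cmod (Ker s z y) \<le> M"
proof -
  obtain b where b: "b \<ge> 0" "\<And>z y. z \<in> C \<Longrightarrow> cmod (driftc z y) \<le> b" using driftc_bounded by blast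
  obtain b2 where b2: "\<And>y. cmod (lap cutoff y) \<le> b2" using lap_bounded[OF test_cutoff] by blast
  have b20: "b2 \<ge> 0" using order_trans[OF norm_ge_zero b2] .
  let ?e = "\<lambda>k s. inverse s ^ k * gcoef CARD('n) s * exp (- (9 * \<nu>\<^sup>2) / (4 * s))"
  define m where "m s = b * ?e 1 s + b2 * ?e 0 s" for s
  have c: "9 * \<nu>\<^sup>2 > 0" using \<nu> by simp
  have m0: "(m \<longlongrightarrow> b * 0 + b2 * 0) (at_right 0)" unfolding m_def
    by (intro tendsto_intros gcoef_exp_tendsto_0 c)
  obtain M1 where M1: "M1 > 0" "\<And>s. s > 0 \<Longrightarrow> ?e 1 s \<le> M1" using gcoef_exp_bounded[OF c, of 1 "CARD('n)"] by blast
  obtain M0 where M0: "M0 > 0" "\<And>s. s > 0 \<Longrightarrow> ?e 0 s \<le> M0" using gcoef_exp_bounded[OF c, of 0 "CARD('n)"] by blast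
  have Km: "cmod (Ker s z y) \<le> m s" if s: "s > 0" and z: "z \<in> C" for s z y
  proof (cases "norm (y - x0) < a + 4 * \<nu>")
    case True
    have "0 \<le> m s" unfolding m_def using b(1) b20 gcoef_pos[OF s, of "CARD('n)"] s
      by (intro add_nonneg_nonneg mult_nonneg_nonneg) auto
    then show ?thesis using Ker_0[of y s z] True by simp
  next
    case False
    have "cmod (driftc z y * of_real (1 / s) + lap cutoff y) \<le> b * (1 / s) + b2"
      using b(2)[OF z, of y] b2[of y] s
      by (intro order_trans[OF norm_triangle_ineq] add_mono) (auto simp: norm_mult norm_divide divide_right_mono)
    moreover have "cmod (hkc s (z - cvec y 0)) \<le> gcoef CARD('n) s * exp (- (9 * \<nu>\<^sup>2) / (4 * s))"
      using hkc_bound[OF z _ s] False by simp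
    moreover have "cmod (Ker s z y) = cmod (driftc z y * of_real (1 / s) + lap cutoff y) * cmod (hkc s (z - cvec y 0))"
      using s by (simp add: Ker_def norm_mult)
    moreover have "0 \<le> b * (1 / s) + b2" using b(1) b20 s by simp
    ultimately have "cmod (Ker s z y) \<le> (b * (1 / s) + b2) * (gcoef CARD('n) s * exp (- (9 * \<nu>\<^sup>2) / (4 * s)))"
      by (simp only:) (intro mult_mono, simp_all)
    moreover have "(b * (1 / s) + b2) * (g * E) = b * (inverse s ^ 1 * g * E) + b2 * (inverse s ^ 0 * g * E)" for g E
      by (simp add: divide_inverse distrib_right mult.assoc)
    ultimately show ?thesis unfolding m_def by metis
  qed
  have "m s \<le> b * M1 + b2 * M0" if "s > 0" for s
    unfolding m_def using M0(2)[OF that] M1(2)[OF that] b b20 by (intro add_mono mult_left_mono)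
  moreover have "0 \<le> b * M1 + b2 * M0" using b b20 M0 M1 by simp
  ultimately have "cmod (Ker s z y) \<le> b * M1 + b2 * M0" if z: "z \<in> C" for s z y
  proof (cases "s > 0")
    case True
    assume m_le: "\<And>s. s > 0 \<Longrightarrow> m s \<le> b * M1 + b2 * M0"
    show ?thesis using Km[OF True z, of y] m_le[OF True] by linarith
  qed (simp add: Ker_def)
  then show ?thesis using that[of m "b * M1 + b2 * M0"] m0 Km \<open>0 \<le> b * M1 + b2 * M0\<close> by simp
qed

lemma continuous_on_dderiv_cutoff: "continuous_on UNIV (dderiv (axis i 1) cutoff)"
  by (rule smooth_imp_continuous, rule smooth_dderiv[OF smooth_cutoff]) (auto simp: Basis_vec_real)

lemma continuous_on_Ker:
  assumes "continuous_on S f" "continuous_on S g" "continuous_on S h" "\<And>x. x \<in> S \<Longrightarrow> f x > 0"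
  shows "continuous_on S (\<lambda>x. Ker (f x) (g x) (h x))"
proof -
  have "continuous_on S (\<lambda>x. (driftc (g x) (h x) * of_real (1 / f x) + lap cutoff (h x)) * hkc (f x) (g x - cvec (h x) 0))"
    unfolding driftc_def
    using assms(4)
    by (intro continuous_intros assms continuous_on_hkc continuous_on_cvec
        continuous_on_compose2[OF continuous_on_dderiv_cutoff _ subset_UNIV]
        continuous_on_compose2[OF smooth_imp_continuous[OF smooth_lap[OF smooth_cutoff]] _ subset_UNIV]) force+
  then show ?thesis by (rule continuous_on_eq) (simp add: Ker_def assms(4))
qed

lemma Ker_measurable: "(\<lambda>p. Ker (t - fst p) z (snd p)) \<in> borel_measurable lborel"
proof -
  have "(\<lambda>p. indicator ({0<..} \<times> UNIV) p *\<^sub>R Ker (fst p) z (snd p)) \<in> borel_measurable borel"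
    by (rule borel_measurable_continuous_on_indicator)
       (auto intro!: continuous_on_Ker continuous_intros borel_open open_Times)
  moreover have "indicator ({0<..} \<times> UNIV) p *\<^sub>R Ker (fst p) z (snd p) = Ker (fst p) z (snd p)" for p
    by (cases p) (auto simp: indicator_def Ker_def)
  ultimately have [measurable]: "(\<lambda>p. Ker (fst p) z (snd p)) \<in> borel_measurable (borel \<Otimes>\<^sub>M borel)"
    by (simp add: borel_prod)
  have "(\<lambda>p. (\<lambda>p. Ker (fst p) z (snd p)) (t - fst p, snd p)) \<in> borel_measurable (borel \<Otimes>\<^sub>M borel)"
    by measurable
  then show ?thesis by (intro borel_measurable_lborel_pair) simp
qed

lemma Ker_holomorphic: "holomorphic_several_on (\<lambda>z. Ker s z y) S"
proof (cases "s > 0")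
  case True
  have "holomorphic_several_on (\<lambda>z. (driftc z y * of_real (1 / s) + lap cutoff y) * hkc s (z - cvec y 0)) S"
    unfolding driftc_def
    by (intro holomorphic_several_mult holomorphic_several_add holomorphic_several_sum holomorphic_several_diff
        holomorphic_several_nth holomorphic_several_const holomorphic_several_hkc)
  then show ?thesis using True by (simp add: Ker_def)
qed (simp add: Ker_def holomorphic_several_const)

lemma hkc_measurable: "t > 0 \<Longrightarrow> (\<lambda>y. hkc t (z - cvec y 0)) \<in> borel_measurable lborel"
  unfolding measurable_lborel2
  by (intro borel_measurable_continuous_onI continuous_on_hkc continuous_intros continuous_on_cvec)

section \<open>Holomorphy and continuity of the local representation\<close>

lemma holomorphic_R:
  assumes t: "t > 0"
  shows "holomorphic_several_on (R t) C"
proof -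
  have "holomorphic_several_on (G t) C" unfolding G_def[abs_def]
  proof (rule holomorphic_several_integral[OF open_C integrable_init])
    show "(\<lambda>y. hkc t (z - cvec y 0)) \<in> borel_measurable lborel" for z by (rule hkc_measurable[OF t])
    show "holomorphic_several_on (\<lambda>z. hkc t (z - cvec y 0)) C" for y by (rule holomorphic_several_hkc)
    show "cmod (hkc t (z - cvec y 0)) \<le> gcoef CARD('n) t * exp (a\<^sup>2 / (4 * t))" if z: "z \<in> C" for z y
    proof -
      obtain x \<eta> where x: "z = cvec x \<eta>" "norm (x - x0) < \<nu>" "norm \<eta> < a" using z by (rule C_cases)
      have "(norm \<eta>)\<^sup>2 \<le> a\<^sup>2" using x by (intro power_mono) auto
      then have "- ((norm (x - y))\<^sup>2 - (norm \<eta>)\<^sup>2) \<le> a\<^sup>2" using zero_le_power2[of "norm (x - y)"] by linarith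
      then have "- ((norm (x - y))\<^sup>2 - (norm \<eta>)\<^sup>2) / (4 * t) \<le> a\<^sup>2 / (4 * t)"
        using t by (intro divide_right_mono) auto
      then show ?thesis using gcoef_pos[OF t, of "CARD('n)"] by (simp add: x cvec_diff cmod_hkc[OF t])
    qed
  qed
  moreover have "holomorphic_several_on (Bt t) C" unfolding Bt_def[abs_def]
  proof -
    obtain M where M: "\<And>s z y. z \<in> C \<Longrightarrow> cmod (Ker s z y) \<le> M" using Ker_estimate by metis
    show "holomorphic_several_on (\<lambda>z. \<integral>p. U p * Ker (t - fst p) z (snd p) \<partial>lborel) C"
      by (rule holomorphic_several_integral[OF open_C U(1)]) (use Ker_measurable Ker_holomorphic M in auto)
  qed
  ultimately show ?thesis unfolding R_def[abs_def] by (rule holomorphic_several_add)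
qed

text \<open>For negative \<open>s\<close> the kernel is 0 at all nearby times. Time 0, where the two
  cases of the definition meet, is avoided in the applications, if necessary at the cost of a null
  set.\<close>

lemma Ker_tendsto:
  assumes "s \<noteq> 0" "(f \<longlongrightarrow> s) F" "(g \<longlongrightarrow> z) F"
  shows "((\<lambda>x. Ker (f x) (g x) y) \<longlongrightarrow> Ker s z y) F"
proof (cases "s > 0")
  case True
  have "continuous_on ({0<..} \<times> UNIV) (\<lambda>p. Ker (fst p) (snd p) y)"
    by (rule continuous_on_Ker) (auto intro: continuous_intros)
  then have "isCont (\<lambda>p. Ker (fst p) (snd p) y) (s, z)"
    using True by (subst (asm) continuous_on_eq_continuous_at) (auto intro: open_Times)
  from isCont_tendsto_compose[OF this tendsto_Pair[OF assms(2,3)]] show ?thesis by simp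
next
  case False
  then have "\<forall>\<^sub>F x in F. f x < 0" using assms by (intro order_tendstoD(2)) auto
  then have "\<forall>\<^sub>F x in F. Ker (f x) (g x) y = Ker s z y"
    by eventually_elim (use False in \<open>simp add: Ker_def\<close>)
  then show ?thesis by (rule tendsto_eventually)
qed

lemma real_in_C: "cvec x 0 \<in> C \<longleftrightarrow> x \<in> ball x0 \<nu>"
  using a by (simp add: in_C dist_norm norm_minus_commute)

lemma gcoef_antimono: "0 < s \<Longrightarrow> s \<le> t \<Longrightarrow> gcoef d t \<le> gcoef d s"
  unfolding gcoef_def by (intro power_mono divide_left_mono real_sqrt_le_mono) auto

text \<open>The kernel in \<open>G\<close> is bounded uniformly only for times above some
  \<open>\<tau> > 0\<close>, so continuity is shown beyond each \<open>\<tau>\<close>, and these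
  sets exhaust the positive times. In \<open>Bt\<close> the points whose time equals that of
  \<open>q\<close> form a null set.\<close>

lemma continuous_R: "continuous_on ({0<..} \<times> ball x0 \<nu>) (\<lambda>p. R (fst p) (cvec (snd p) 0))"
proof -
  have G: "continuous_on ({\<tau><..} \<times> ball x0 \<nu>) (\<lambda>p. G (fst p) (cvec (snd p) 0))" if \<tau>: "\<tau> > 0" for \<tau>
    unfolding G_def
  proof (rule continuous_on_integral_mult[OF integrable_init, where B = "gcoef CARD('n) \<tau>"])
    fix p assume p: "p \<in> {\<tau><..} \<times> ball x0 \<nu>"
    show "(\<lambda>y. hkc (fst p) (cvec (snd p) 0 - cvec y 0)) \<in> borel_measurable lborel"
      using p \<tau> by (intro hkc_measurable) auto
    show "AE y in lborel. cmod (hkc (fst p) (cvec (snd p) 0 - cvec y 0)) \<le> gcoef CARD('n) \<tau>"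
    proof (intro AE_I2)
      fix y
      have f: "fst p > 0" "\<tau> \<le> fst p" using p \<tau> by auto
      show "cmod (hkc (fst p) (cvec (snd p) 0 - cvec y 0)) \<le> gcoef CARD('n) \<tau>"
        using hk_le_gcoef[OF f(1), of "snd p - y"] hk_pos[OF f(1), of "snd p - y"] gcoef_antimono[OF \<tau> f(2), of "CARD('n)"]
        by (simp add: cvec_diff hkc_cvec_0)
    qed
  next
    fix q assume q: "q \<in> {\<tau><..} \<times> ball x0 \<nu>"
    show "AE y in lborel. ((\<lambda>p. hkc (fst p) (cvec (snd p) 0 - cvec y 0)) \<longlongrightarrow> hkc (fst q) (cvec (snd q) 0 - cvec y 0))
        (at q within {\<tau><..} \<times> ball x0 \<nu>)"
    proof (intro AE_I2)
      fix y
      have "continuous_on ({\<tau><..} \<times> ball x0 \<nu>) (\<lambda>p. hkc (fst p) (cvec (snd p) 0 - cvec y 0))"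
        using \<tau> by (intro continuous_on_hkc continuous_intros continuous_on_cvec) auto
      then show "((\<lambda>p. hkc (fst p) (cvec (snd p) 0 - cvec y 0)) \<longlongrightarrow> hkc (fst q) (cvec (snd q) 0 - cvec y 0))
        (at q within {\<tau><..} \<times> ball x0 \<nu>)" using q unfolding continuous_on_def by blast
    qed
  qed
  have "continuous_on (\<Union>\<tau>\<in>{0<..}. {\<tau><..} \<times> ball x0 \<nu>) (\<lambda>p. G (fst p) (cvec (snd p) 0))"
    by (rule continuous_on_open_UN) (auto intro: G open_Times)
  moreover have "(\<Union>\<tau>\<in>{0<..}. {\<tau><..} \<times> ball x0 \<nu>) = {0::real<..} \<times> ball x0 \<nu>"
    by (auto simp: Bex_def intro: dense)
  ultimately have G': "continuous_on ({0<..} \<times> ball x0 \<nu>) (\<lambda>p. G (fst p) (cvec (snd p) 0))" by simp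
  obtain M where M: "\<And>s z y. z \<in> C \<Longrightarrow> cmod (Ker s z y) \<le> M" using Ker_estimate by metis
  have "continuous_on ({0<..} \<times> ball x0 \<nu>) (\<lambda>p. Bt (fst p) (cvec (snd p) 0))"
    unfolding Bt_def
  proof (rule continuous_on_integral_mult[OF U(1), where B = M])
    show "AE p' in lborel. cmod (Ker (fst p - fst p') (cvec (snd p) 0) (snd p')) \<le> M"
      if "p \<in> {0<..} \<times> ball x0 \<nu>" for p
      using that by (intro AE_I2 M) (auto simp: real_in_C)
    fix q :: "real \<times> (real ^ 'n)" assume q: "q \<in> {0<..} \<times> ball x0 \<nu>"
    show "AE p' in lborel. ((\<lambda>p. Ker (fst p - fst p') (cvec (snd p) 0) (snd p')) \<longlongrightarrow>
        Ker (fst q - fst p') (cvec (snd q) 0) (snd p')) (at q within {0<..} \<times> ball x0 \<nu>)"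
      using AE_fst_neq[of "fst q"]
    proof eventually_elim
      case (elim p')
      have "continuous_on UNIV (\<lambda>p :: real \<times> (real ^ 'n). cvec (snd p) 0)"
        by (intro continuous_on_cvec continuous_intros)
      then have "((\<lambda>p. cvec (snd p) 0) \<longlongrightarrow> cvec (snd q) 0) (at q within {0<..} \<times> ball x0 \<nu>)"
        using continuous_on_subset[OF _ subset_UNIV] q unfolding continuous_on_def by blast
      then show ?case using elim by (intro Ker_tendsto tendsto_intros) auto
    qed
  qed (rule Ker_measurable)
  then show ?thesis unfolding R_def using G' by (intro continuous_on_add)
qed

section \<open>Identification with the solution at real points\<close>

lemma driftc_real: "driftc (cvec x 0) y = drift cutoff x y"
  unfolding driftc_def drift_def sum_Basis_vec
  by (intro sum.cong refl) (simp add: cvec_nth inner_axis complex_eq_iff)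

text \<open>As \<open>\<epsilon>\<close> tends to 0, the left side of the representation gives
  Gaussian means of the product of a time slice of \<open>U\<close> with the cutoff, and the right
  side tends boundedly to \<open>R t\<close>. On the ball of radius \<open>\<nu>\<close> the cutoff
  is 1.\<close>

lemma R_eq_U_AE:
  assumes rep: "AE t in lborel. t \<in> {0<..<T} \<longrightarrow> (\<forall>x \<epsilon>. \<epsilon> > 0 \<longrightarrow>
     (\<integral>y. U (t, y) * (cutoff y * of_real (hk \<epsilon> (x - y))) \<partial>lborel)
      = (\<integral>y. init y * of_real (hk (t + \<epsilon>) (x - y)) \<partial>lborel)
      + (\<integral>z. U z * (indicator {0<..<t} (fst z) * ((drift cutoff x (snd z) * of_real (1 / (t + \<epsilon> - fst z)) + lap cutoff (snd z))
          * of_real (hk (t + \<epsilon> - fst z) (x - snd z)))) \<partial>lborel))"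
  shows "AE t in lborel. t \<in> {0<..<T} \<longrightarrow> (AE x in lborel. x \<in> ball x0 \<nu> \<longrightarrow> U (t, x) = R t (cvec x 0))"
proof -
  have int: "AE t in lborel. integrable lborel (\<lambda>y. U (t, y))"
    using lborel_pair.AE_integrable_fst'[of U] U(1) by (simp add: lborel_prod)
  obtain M where M: "M \<ge> 0" "\<And>s z y. z \<in> C \<Longrightarrow> cmod (Ker s z y) \<le> M" using Ker_estimate by metis
  obtain Bc where Bc: "\<And>y. cmod (cutoff y) \<le> Bc" using test_function_bounded[OF test_cutoff] by blast
  show ?thesis
    using rep int
  proof (eventually_elim, intro impI)
    fix t
    assume t: "t \<in> {0<..<T}" and Ut: "integrable lborel (\<lambda>y. U (t, y))"
      and rep: "t \<in> {0<..<T} \<longrightarrow> (\<forall>x \<epsilon>. \<epsilon> > 0 \<longrightarrow>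
     (\<integral>y. U (t, y) * (cutoff y * of_real (hk \<epsilon> (x - y))) \<partial>lborel)
      = (\<integral>y. init y * of_real (hk (t + \<epsilon>) (x - y)) \<partial>lborel)
      + (\<integral>z. U z * (indicator {0<..<t} (fst z) * ((drift cutoff x (snd z) * of_real (1 / (t + \<epsilon> - fst z)) + lap cutoff (snd z))
          * of_real (hk (t + \<epsilon> - fst z) (x - snd z)))) \<partial>lborel))"
    define e where "e n = inverse (real (Suc n))" for n
    have e: "e n > 0" "e \<longlonglongrightarrow> 0" for n
      using LIMSEQ_inverse_real_of_nat by (auto simp: e_def[abs_def])
    let ?I = "\<lambda>p. indicator {0<..<t} (fst p) :: complex"
    have rep': "(\<integral>y. (U (t, y) * cutoff y) * of_real (hk (e n) (x - y)) \<partial>lborel)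
        = (\<integral>y. init y * of_real (hk (t + e n) (x - y)) \<partial>lborel)
        + (\<integral>p. U p * (?I p * Ker (t + e n - fst p) (cvec x 0) (snd p)) \<partial>lborel)" for n x
    proof -
      have "(\<integral>p. U p * (?I p * ((drift cutoff x (snd p) * of_real (1 / (t + e n - fst p)) + lap cutoff (snd p))
          * of_real (hk (t + e n - fst p) (x - snd p)))) \<partial>lborel)
          = (\<integral>p. U p * (?I p * Ker (t + e n - fst p) (cvec x 0) (snd p)) \<partial>lborel)"
      proof (intro Bochner_Integration.integral_cong refl)
        fix p :: "real \<times> (real ^ 'n)"
        show "U p * (?I p * ((drift cutoff x (snd p) * of_real (1 / (t + e n - fst p)) + lap cutoff (snd p))
          * of_real (hk (t + e n - fst p) (x - snd p)))) = U p * (?I p * Ker (t + e n - fst p) (cvec x 0) (snd p))"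
        proof (cases "fst p \<in> {0<..<t}")
          case True
          then have "t + e n - fst p > 0" using e(1)[of n] by auto
          then show ?thesis by (simp add: Ker_def driftc_real cvec_diff hkc_cvec_0)
        qed simp
      qed
      then show ?thesis using rep t e(1)[of n] by (simp add: mult.assoc)
    qed
    have KI: "(\<lambda>p. ?I p * Ker (s - fst p) z (snd p)) \<in> borel_measurable lborel" for s z
    proof (rule borel_measurable_times[OF _ Ker_measurable])
      show "?I \<in> borel_measurable lborel" by (rule borel_measurable_lborel_pair) measurable
    qed
    have KIb: "cmod (?I p * Ker s z y) \<le> M" if "z \<in> C" for p :: "real \<times> (real ^ 'n)" and s z y
      using M(2)[OF that, of s y] M(1) by (simp add: indicator_def norm_mult)
    have BI: "Bt t z = (\<integral>p. U p * (?I p * Ker (t - fst p) z (snd p)) \<partial>lborel)" for z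
      unfolding Bt_def
    proof (intro Bochner_Integration.integral_cong refl)
      fix p :: "real \<times> (real ^ 'n)"
      show "U p * Ker (t - fst p) z (snd p) = U p * (?I p * Ker (t - fst p) z (snd p))"
        using U(2)[of p] by (cases "fst p \<le> 0") (auto simp: indicator_def Ker_def)
    qed
    have t0: "t > 0" using t by simp
    have hkb: "cmod (of_real (hk (t + e n) (x - y))) \<le> gcoef CARD('n) t" for n and x y :: "real ^ 'n"
    proof -
      have p: "t + e n > 0" using t0 e(1)[of n] by simp
      show ?thesis
        using hk_le_gcoef[OF p, of "x - y"] hk_pos[OF p, of "x - y"] gcoef_antimono[OF t0, of "t + e n" "CARD('n)"] e(1)[of n]
        by simp
    qed
    have te: "(\<lambda>n. t + e n) \<longlonglongrightarrow> t" using tendsto_add[OF tendsto_const[of t] e(2)] by simp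
    have hkm: "(\<lambda>y. complex_of_real (hk s (x - y))) \<in> borel_measurable lborel" for s and x :: "real ^ 'n"
      unfolding measurable_lborel2 using smooth_borel[OF smooth_hk] .
    have "AE x in lborel. x \<in> ball x0 \<nu> \<longrightarrow> U (t, x) * cutoff x = R t (cvec x 0)"
    proof (rule AE_eq_limit_of_gaussian_means[OF _ _ _ e])
      show "integrable lborel (\<lambda>y. U (t, y) * cutoff y)"
        by (rule integrable_mult_bounded[OF Ut, of _ Bc]) (use Bc smooth_borel[OF smooth_cutoff] in auto)
      fix x assume x: "x \<in> ball x0 \<nu>"
      have "(\<lambda>n. \<integral>y. init y * of_real (hk (t + e n) (x - y)) \<partial>lborel) \<longlonglongrightarrow> (\<integral>y. init y * of_real (hk t (x - y)) \<partial>lborel)"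
      proof (rule tendsto_integral_mult_bounded[OF integrable_init, where B = "gcoef CARD('n) t"])
        show "AE y in lborel. (\<lambda>n. complex_of_real (hk (t + e n) (x - y))) \<longlonglongrightarrow> of_real (hk t (x - y))"
        proof (intro AE_I2 tendsto_of_real)
          fix y
          show "(\<lambda>n. hk (t + e n) (x - y)) \<longlonglongrightarrow> hk t (x - y)"
            by (rule isCont_tendsto_compose[OF DERIV_isCont[OF hk_has_time_derivative[OF t0]] te])
        qed
      qed (use hkb hkm in auto)
      moreover have "(\<lambda>n. \<integral>p. U p * (?I p * Ker (t + e n - fst p) (cvec x 0) (snd p)) \<partial>lborel) \<longlonglongrightarrow>
          (\<integral>p. U p * (?I p * Ker (t - fst p) (cvec x 0) (snd p)) \<partial>lborel)"
      proof (rule tendsto_integral_mult_bounded[OF U(1), where B = M])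
        show "AE p in lborel. (\<lambda>n. ?I p * Ker (t + e n - fst p) (cvec x 0) (snd p)) \<longlonglongrightarrow> ?I p * Ker (t - fst p) (cvec x 0) (snd p)"
        proof (intro AE_I2)
          fix p :: "real \<times> (real ^ 'n)"
          show "(\<lambda>n. ?I p * Ker (t + e n - fst p) (cvec x 0) (snd p)) \<longlonglongrightarrow> ?I p * Ker (t - fst p) (cvec x 0) (snd p)"
          proof (cases "fst p \<in> {0<..<t}")
            case True
            then show ?thesis by (intro tendsto_mult tendsto_const Ker_tendsto tendsto_diff te) auto
          qed simp
        qed
      qed (use KIb KI x in \<open>auto simp: real_in_C\<close>)
      ultimately show "(\<lambda>n. \<integral>y. (U (t, y) * cutoff y) * of_real (hk (e n) (x - y)) \<partial>lborel) \<longlonglongrightarrow> R t (cvec x 0)"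
        unfolding rep' R_def BI G_def by (simp add: cvec_diff hkc_cvec_0 tendsto_add)
      fix n
      have "cmod (\<integral>y. init y * of_real (hk (t + e n) (x - y)) \<partial>lborel) \<le> (\<integral>y. cmod (init y) * gcoef CARD('n) t \<partial>lborel)"
      proof (rule Bochner_Integration.integral_norm_bound_integral)
        show "integrable lborel (\<lambda>y. init y * of_real (hk (t + e n) (x - y)))"
          by (rule integrable_mult_bounded[OF integrable_init hkm, of _ _ "gcoef CARD('n) t"]) (use hkb in auto)
      qed (use integrable_init hkb in \<open>auto simp: norm_mult intro!: mult_left_mono\<close>)
      moreover have "cmod (\<integral>p. U p * (?I p * Ker (t + e n - fst p) (cvec x 0) (snd p)) \<partial>lborel) \<le> (\<integral>p. cmod (U p) * M \<partial>lborel)"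
      proof (rule Bochner_Integration.integral_norm_bound_integral)
        show "integrable lborel (\<lambda>p. U p * (?I p * Ker (t + e n - fst p) (cvec x 0) (snd p)))"
          by (rule integrable_mult_bounded[OF U(1) KI, of _ _ M]) (use KIb x in \<open>auto simp: real_in_C\<close>)
        show "norm (U p * (?I p * Ker (t + e n - fst p) (cvec x 0) (snd p))) \<le> cmod (U p) * M" for p
          unfolding norm_mult[of "U p"] using x by (intro mult_left_mono KIb) (auto simp: real_in_C)
      qed (use U in auto)
      ultimately show "cmod (\<integral>y. (U (t, y) * cutoff y) * of_real (hk (e n) (x - y)) \<partial>lborel)
          \<le> (\<integral>y. cmod (init y) * gcoef CARD('n) t \<partial>lborel) + (\<integral>p. cmod (U p) * M \<partial>lborel)"
        unfolding rep' by (intro order_trans[OF norm_triangle_ineq] add_mono)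
    qed auto
    then show "AE x in lborel. x \<in> ball x0 \<nu> \<longrightarrow> U (t, x) = R t (cvec x 0)"
    proof eventually_elim
      case (elim x)
      then show ?case using cutoff_1[of x] a \<nu> by (auto simp: dist_norm norm_minus_commute)
    qed
  qed
qed

text \<open>Only times between 0 and \<open>t\<close> contribute, so the kernel is evaluated at
  elapsed times below \<open>t\<close>, where it is uniformly small; what remains is the L1 norm of
  \<open>U\<close>. The summand 1 in \<open>e'\<close> covers the case that this norm is 0.\<close>

lemma Bt_uniform_limit: "uniform_limit C Bt (\<lambda>z. 0) (at_right 0)"
proof (rule uniform_limitI)
  fix e :: real assume e: "e > 0"
  obtain m M where m: "(m \<longlongrightarrow> 0) (at_right 0)" "\<And>s z y. s > 0 \<Longrightarrow> z \<in> C \<Longrightarrow> cmod (Ker s z y) \<le> m s"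
    using Ker_estimate by metis
  define N where "N = (\<integral>p. cmod (U p) \<partial>lborel)"
  have N: "N \<ge> 0" by (simp add: N_def)
  define e' where "e' = e / (2 * (N + 1))"
  have e': "e' > 0" using e N by (simp add: e'_def)
  obtain d where d: "d > 0" "\<And>s. 0 < s \<Longrightarrow> s < d \<Longrightarrow> m s < e'"
    using order_tendstoD(2)[OF m(1) e'] unfolding eventually_at_right_field by blast
  have "\<forall>\<^sub>F t in at_right 0. t < d" using d(1) by (auto simp: eventually_at_right_field)
  then show "\<forall>\<^sub>F t in at_right 0. \<forall>z\<in>C. dist (Bt t z) 0 < e"
  proof eventually_elim
    case (elim t)
    show ?case
    proof
      fix z assume z: "z \<in> C"
      have le: "cmod (U p * Ker (t - fst p) z (snd p)) \<le> e' * cmod (U p)" for p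
      proof (cases "0 < fst p \<and> fst p < t")
        case True
        then have "cmod (Ker (t - fst p) z (snd p)) \<le> e'"
          using m(2)[of "t - fst p" z "snd p"] d(2)[of "t - fst p"] z elim by auto
        then show ?thesis unfolding norm_mult mult.commute[of e'] by (intro mult_left_mono) auto
      next
        case False
        then have "U p = 0 \<or> Ker (t - fst p) z (snd p) = 0" using U(2)[of p] by (auto simp: Ker_def)
        then show ?thesis using e' by auto
      qed
      have "cmod (Bt t z) \<le> (\<integral>p. e' * cmod (U p) \<partial>lborel)" unfolding Bt_def
      proof (rule Bochner_Integration.integral_norm_bound_integral)
        obtain M' where "\<And>s z y. z \<in> C \<Longrightarrow> cmod (Ker s z y) \<le> M'" using Ker_estimate by metis
        then show "integrable lborel (\<lambda>p. U p * Ker (t - fst p) z (snd p))"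
          by (intro integrable_mult_bounded[OF U(1) Ker_measurable, where B = M']) (use z in auto)
      qed (use U le in auto)
      also have "\<dots> = e' * N" by (simp add: N_def)
      also have "\<dots> = e * (N / (2 * (N + 1)))" by (simp add: e'_def)
      also have "\<dots> < e * 1" using e N by (intro mult_strict_left_mono) (auto simp: field_simps)
      finally show "dist (Bt t z) 0 < e" by simp
    qed
  qed
qed

text \<open>
  The integral over the real space is moved to the points \<open>x + y + \<i> g(|y|) \<eta>\<close>, where \<open>z = x + \<i> \<eta>\<close>:
  there the modulus of the kernel is bounded by a real Gaussian, and near \<open>y = 0\<close> the kernel is the real one.
\<close>

lemma G_uniform_limit: "uniform_limit C G U0 (at_right 0)"
proof (rule uniform_limitI)
  fix e0 :: real assume e0: "e0 > 0"
  obtain g g' L where g: "\<And>r. (g has_real_derivative g' r) (at r)" "continuous_on UNIV g'"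
    "\<And>r. r \<le> \<nu> / 2 \<Longrightarrow> g r = 1" "\<And>r. r < \<nu> / 2 \<Longrightarrow> g' r = 0" "\<And>r. r \<ge> a + 2 * \<nu> \<Longrightarrow> g r = 0" "\<And>r. 0 \<le> g r" "\<And>r. g r \<le> 1"
    "\<And>r. \<bar>g' r\<bar> \<le> L" "\<And>r. 0 \<le> r \<Longrightarrow> (1 - g r) * a \<le> a / (a + \<nu>) * r"
    "\<And>r. 0 \<le> r \<Longrightarrow> r \<le> a + 2 * \<nu> \<Longrightarrow> a * g r + r \<le> a + 2 * \<nu>"
    using shift_profile[OF a \<nu>] by blast
  have L0: "L \<ge> 0" using g(8)[of 0] abs_ge_zero order_trans by blast
  have cg: "continuous_on UNIV g" using g(1) by (meson DERIV_isCont continuous_at_imp_continuous_on)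
  \<comment> \<open>A compact part of the diamond containing all points at which \<open>U0\<close>
    has to be estimated; it supplies one bound and one modulus of continuity for all
    \<open>z\<close> in \<open>C\<close>.\<close>
  let ?P = "{p :: (real ^ 'n) \<times> (real ^ 'n). norm (fst p - x0) + norm (snd p) \<le> a + 4 * \<nu>}"
  define S where "S = (\<lambda>p. cvec (fst p) (snd p)) ` ?P"
  have S_iff: "cvec p q \<in> S \<longleftrightarrow> norm (p - x0) + norm q \<le> a + 4 * \<nu>" for p q
    unfolding S_def image_iff by (metis (mono_tags, lifting) Imv_cvec Rev_cvec fst_conv mem_Collect_eq snd_conv)
  have "compact S" unfolding S_def
  proof (rule compact_continuous_image)
    show "continuous_on ?P (\<lambda>p. cvec (fst p) (snd p))"
      by (intro continuous_on_cvec continuous_intros)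
    have "?P \<subseteq> cball x0 (a + 4 * \<nu>) \<times> cball 0 (a + 4 * \<nu>)"
    proof
      fix p assume "p \<in> ?P"
      then have "norm (fst p - x0) \<le> a + 4 * \<nu>" "norm (snd p) \<le> a + 4 * \<nu>"
        using norm_ge_zero[of "fst p - x0"] norm_ge_zero[of "snd p"] by (auto simp del: norm_ge_zero)
      then show "p \<in> cball x0 (a + 4 * \<nu>) \<times> cball 0 (a + 4 * \<nu>)"
        by (cases p) (auto simp: dist_norm norm_minus_commute)
    qed
    then have "bounded ?P"
      by (rule bounded_subset[rotated]) (intro bounded_Times bounded_cball)
    moreover have "closed ?P"
      by (intro closed_Collect_le continuous_intros)
    ultimately show "compact ?P"
      by (simp add: compact_eq_bounded_closed)
  qed
  moreover have S_sub: "S \<subseteq> diamond x0 (a + 8 * \<nu>)" using \<nu> by (auto simp: S_def diamond_def)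
  ultimately have cS: "compact S" "continuous_on S U0"
    using continuous_on_subset[OF holomorphic_several_imp_continuous[OF U0]] by auto
  obtain M0 where M0: "M0 > 0" "\<And>w. w \<in> S \<Longrightarrow> cmod (U0 w) \<le> M0"
    using compact_imp_bounded[OF compact_continuous_image[OF cS(2,1)]] unfolding bounded_pos by auto
  obtain Mi where Mi: "Mi \<ge> 0" "\<And>y. cmod (init y) \<le> Mi"
    using bounded_continuous_compact_support[OF continuous_init init_0'] by metis
  \<comment> \<open>At distance \<open>r\<close> from the centre the height still missing is at most
    \<open>\<kappa> * r\<close> with \<open>\<kappa> < 1\<close>, so the fraction
    \<open>c = 1 - \<kappa>\<^sup>2\<close> of the Gaussian exponent survives.\<close>
  define \<kappa> where "\<kappa> = a / (a + \<nu>)"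
  have \<kappa>: "0 < \<kappa>" "\<kappa> < 1" using a \<nu> by (auto simp: \<kappa>_def)
  define c where "c = 1 - \<kappa>\<^sup>2"
  have c: "c > 0" using \<kappa> by (simp add: c_def power_less_one_iff abs_square_less_1)
  \<comment> \<open>Within this radius the profile is constantly 1 and the shifted kernel is the
    real one.\<close>
  define \<delta> where "\<delta> = \<nu> / 2"
  have \<delta>: "\<delta> > 0" using \<nu> by (simp add: \<delta>_def)
  define K1 where "K1 = max (M0 * (1 + L * a)) Mi"
  define vol where "vol = measure lborel (cball (0 :: real ^ 'n) (a + 7 * \<nu>))"
  define gs where "gs t = gcoef CARD('n) t * exp (- (c * \<delta>\<^sup>2) / (4 * t))" for t
  have K1: "K1 \<ge> 0" using Mi by (simp add: K1_def le_max_iff_disj)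
  have far: "t > 0 \<Longrightarrow> norm y \<ge> \<delta> \<Longrightarrow> norm q \<le> \<kappa> * norm y \<Longrightarrow> cmod (hkc t (cvec (- y) q)) \<le> gs t" for t and y q :: "real ^ 'n"
  proof -
    assume t: "t > 0" and y: "norm y \<ge> \<delta>" and q: "norm q \<le> \<kappa> * norm y"
    have "(norm q)\<^sup>2 \<le> (\<kappa> * norm y)\<^sup>2" using q by (intro power_mono) auto
    moreover have "c * \<delta>\<^sup>2 \<le> c * (norm y)\<^sup>2" using c y \<delta> by (intro mult_left_mono power_mono) auto
    moreover have "c * (norm y)\<^sup>2 = (norm y)\<^sup>2 - (\<kappa> * norm y)\<^sup>2" by (simp add: c_def algebra_simps power_mult_distrib)
    ultimately have "- ((norm (- y))\<^sup>2 - (norm q)\<^sup>2) \<le> - (c * \<delta>\<^sup>2)" by simp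
    then have "- ((norm (- y))\<^sup>2 - (norm q)\<^sup>2) / (4 * t) \<le> - (c * \<delta>\<^sup>2) / (4 * t)"
      using t by (intro divide_right_mono) auto
    then show ?thesis using gcoef_pos[OF t, of "CARD('n)"] by (simp add: cmod_hkc[OF t] gs_def)
  qed
  have hkc_minus: "hkc t (v - w) = hkc t (w - v)" for t and v w :: "complex ^ 'n"
    by (simp add: hkc_def csq_def power2_commute)
  obtain d where d: "d > 0" "\<And>v w. v \<in> S \<Longrightarrow> w \<in> S \<Longrightarrow> dist v w < d \<Longrightarrow> dist (U0 v) (U0 w) < e0 / 4"
    using compact_uniformly_continuous[OF cS(2,1)] e0 unfolding uniformly_continuous_on_def
    by (metis divide_pos_pos dist_commute zero_less_numeral)
  define d' where "d' = min d \<delta>"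
  have d': "d' > 0" "d' \<le> d" "d' \<le> \<delta>" using d \<delta> by (auto simp: d'_def)
  define tl where "tl t = 2 * M0 * (sqrt 2 ^ CARD('n) * exp (- d'\<^sup>2 / (8 * t)))" for t
  have est: "dist (G t z) (U0 z) \<le> e0 / 4 + tl t + K1 * gs t * vol" if t: "t > 0" and z: "z \<in> C" for t z
  proof -
    obtain x \<eta> where x: "z = cvec x \<eta>" "norm (x - x0) < \<nu>" "norm \<eta> < a" using z by (rule C_cases)
    \<comment> \<open>Coordinates are centred at \<open>x\<close>. Translated by \<open>x\<close>,
      points of \<open>W\<close> stay in the diamond, since
      \<open>a + 7 * \<nu> < a + 8 * \<nu>\<close>, and points of \<open>V\<close> stay where the
      cutoff is 1; moreover \<open>V\<close> contains the closed ball outside which the shift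
      vanishes.\<close>
    define W where "W = diamond (0 :: real ^ 'n) (a + 6 * \<nu>)"
    define V where "V = ball (0 :: real ^ 'n) (a + 3 * \<nu>)"
    define F where "F w = U0 (cvec x 0 + w) * hkc t (w - cvec 0 \<eta>)" for w
    define Rr where "Rr y = init (x + y) * hkc t (cvec (- y) \<eta>)" for y
    define \<tau> where "\<tau> y = g (norm y)" for y :: "real ^ 'n"
    \<comment> \<open>At \<open>y = 0\<close> the division yields 0, which is the correct derivative
      because the profile is constant near 0.\<close>
    define \<tau>' where "\<tau>' y = g' (norm y) * ((y \<bullet> \<eta>) / norm y)" for y :: "real ^ 'n"
    define N where "N y = (if y \<in> V then F (cvec y (\<tau> y *\<^sub>R \<eta>)) * (1 + \<i> * of_real (\<tau>' y)) else Rr y)" for y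
    have xy: "norm (x + y - x0) < \<nu> + norm y" for y
      using norm_triangle_ineq[of "x - x0" y] x by (simp add: algebra_simps)
    have Rr0: "Rr y = 0" if "norm y > a + 7 * \<nu>" for y
    proof -
      have "norm y \<le> norm (x + y - x0) + norm (x - x0)"
        using norm_triangle_ineq4[of "x + y - x0" "x - x0"] by simp
      then have "norm (x + y - x0) \<ge> a + 6 * \<nu>" using that x by linarith
      then show ?thesis by (simp add: Rr_def init_0)
    qed
    have Rrc: "continuous_on UNIV Rr" unfolding Rr_def using t
      by (intro continuous_intros continuous_on_compose2[OF continuous_init _ subset_UNIV] continuous_on_hkc continuous_on_cvec) auto
    have GR: "G t z = (\<integral>y. Rr y \<partial>lborel)"
    proof -
      have "(\<lambda>y. init y * hkc t (z - cvec y 0)) \<in> borel_measurable borel"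
        using hkc_measurable[OF t] by (intro borel_measurable_times) auto
      from integral_lborel_translate[OF this, of x]
      show ?thesis unfolding G_def Rr_def by (simp add: x cvec_diff)
    qed
    have holF: "holomorphic_several_on F W" unfolding F_def
    proof (intro holomorphic_several_mult holomorphic_several_hkc)
      show "holomorphic_several_on (\<lambda>w. U0 (cvec x 0 + w)) W"
        unfolding holomorphic_several_on_def
      proof
        fix w assume w: "w \<in> W"
        have "norm (Rev (cvec x 0 + w) - x0) \<le> norm (Rev w) + norm (x - x0)"
          using norm_triangle_ineq[of "Rev w" "x - x0"] by (simp add: linear_add[OF linear_Rev] algebra_simps)
        then have "cvec x 0 + w \<in> diamond x0 (a + 8 * \<nu>)"
          using w x \<nu> by (simp add: W_def diamond_def linear_add[OF linear_Imv])
        then obtain Lw where Lw: "(U0 has_derivative Lw) (at (cvec x 0 + w))" "\<forall>c v. Lw (c *s v) = c * Lw v"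
          using U0 unfolding holomorphic_several_on_def by blast
        have "((\<lambda>w. cvec x 0 + w) has_derivative (\<lambda>h. h)) (at w)"
          by (auto intro!: derivative_eq_intros)
        from has_derivative_compose[OF this Lw(1)] Lw(2)
        show "\<exists>Lw. ((\<lambda>w. U0 (cvec x 0 + w)) has_derivative Lw) (at w) \<and> (\<forall>c v. Lw (c *s v) = c * Lw v)" by blast
      qed
    qed
    \<comment> \<open>The last property of \<open>g\<close> enters here: the segments from real
      points to their shifted images remain in \<open>W\<close>.\<close>
    have rad: "norm y + \<theta> * \<tau> y * norm \<eta> < a + 3 * \<nu>" if y: "y \<in> V" and \<theta>: "0 \<le> \<theta>" "\<theta> \<le> 1" for y \<theta>
    proof (cases "norm y \<le> a + 2 * \<nu>")
      case True
      have "\<theta> * \<tau> y * norm \<eta> \<le> 1 * g (norm y) * a"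
        using \<theta> x g(6)[of "norm y"] unfolding \<tau>_def by (intro mult_mono mult_nonneg_nonneg) auto
      then show ?thesis using g(10)[of "norm y"] True \<nu> by (simp add: mult.commute)
    next
      case False
      then show ?thesis using g(5)[of "norm y"] y by (simp add: \<tau>_def V_def)
    qed
    have F_eq: "F (cvec y q) = U0 (cvec (x + y) q) * hkc t (cvec (- y) (\<eta> - q))" for y q
      using hkc_minus[of t "cvec y q" "cvec 0 \<eta>"] by (simp add: F_def cvec_add cvec_diff)
    have N_int: "integrable lborel N" and N_eq: "(\<integral>y. N y \<partial>lborel) = (\<integral>y. Rr y \<partial>lborel)"
    proof -
      have cl: "closed (cball (0 :: real ^ 'n) (a + 2 * \<nu>))" by simp
      have W: "open W" "convex W" and V: "open V" by (simp_all add: W_def V_def open_diamond convex_diamond)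
      have Rri: "integrable lborel Rr" by (rule integrable_continuous_compact_support[OF Rrc Rr0])
      have sub: "cball (0 :: real ^ 'n) (a + 2 * \<nu>) \<subseteq> V" using \<nu> by (auto simp: V_def)
      have c1: "continuous_on UNIV \<tau>" unfolding \<tau>_def
        by (intro continuous_on_compose2[OF cg _ subset_UNIV] continuous_intros)
      have c2: "continuous_on UNIV \<tau>'"
      proof -
        have "continuous_on ((- {0}) \<union> ball 0 (\<nu> / 2)) \<tau>'"
        proof (rule continuous_on_open_Un)
          show "continuous_on (- {0}) \<tau>'" unfolding \<tau>'_def
            by (intro continuous_intros continuous_on_compose2[OF g(2) _ subset_UNIV]) auto
          show "continuous_on (ball 0 (\<nu> / 2)) \<tau>'"
            by (rule continuous_on_eq[OF continuous_on_const[of _ 0]]) (simp add: \<tau>'_def g(4))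
        qed auto
        moreover have "(- {0}) \<union> ball 0 (\<nu> / 2) = (UNIV :: (real ^ 'n) set)" using \<nu> by auto
        ultimately show ?thesis by simp
      qed
      have dt: "((\<lambda>s. \<tau> (y + s *\<^sub>R \<eta>)) has_real_derivative \<tau>' y) (at 0)" for y
      proof (cases "y = 0")
        case True
        have "((\<lambda>s. 1) has_real_derivative 0) (at 0)" by simp
        then have "((\<lambda>s. \<tau> (y + s *\<^sub>R \<eta>)) has_real_derivative 0) (at 0)"
        proof (rule has_field_derivative_transform_within_open)
          show "open {s. norm (s *\<^sub>R \<eta>) < \<nu> / 2}" by (intro open_Collect_less continuous_intros)
        qed (use True \<nu> in \<open>auto simp: \<tau>_def g(3)\<close>)
        then show ?thesis using True by (simp add: \<tau>'_def)
      next
        case False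
        have d1: "((\<lambda>s. (y + s *\<^sub>R \<eta>) \<bullet> (y + s *\<^sub>R \<eta>)) has_real_derivative 2 * (y \<bullet> \<eta>)) (at 0)"
        proof -
          have "((\<lambda>s. y \<bullet> y + 2 * (y \<bullet> \<eta>) * s + (\<eta> \<bullet> \<eta>) * s\<^sup>2) has_real_derivative 2 * (y \<bullet> \<eta>)) (at 0)"
            by (auto intro!: derivative_eq_intros)
          moreover have "(y + s *\<^sub>R \<eta>) \<bullet> (y + s *\<^sub>R \<eta>) = y \<bullet> y + 2 * (y \<bullet> \<eta>) * s + (\<eta> \<bullet> \<eta>) * s\<^sup>2" for s
            by (simp add: inner_add_left inner_add_right inner_commute[of \<eta> y] power2_eq_square distrib_left mult_ac)
          ultimately show ?thesis by simp
        qed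
        have d2: "(sqrt has_real_derivative inverse (sqrt ((y + 0 *\<^sub>R \<eta>) \<bullet> (y + 0 *\<^sub>R \<eta>))) / 2) (at ((y + 0 *\<^sub>R \<eta>) \<bullet> (y + 0 *\<^sub>R \<eta>)))"
          using False by (intro DERIV_real_sqrt) simp
        have "((\<lambda>s. sqrt ((y + s *\<^sub>R \<eta>) \<bullet> (y + s *\<^sub>R \<eta>))) has_real_derivative
            inverse (sqrt ((y + 0 *\<^sub>R \<eta>) \<bullet> (y + 0 *\<^sub>R \<eta>))) / 2 * (2 * (y \<bullet> \<eta>))) (at 0)"
          by (rule DERIV_chain2[where f = sqrt and g = "\<lambda>s. (y + s *\<^sub>R \<eta>) \<bullet> (y + s *\<^sub>R \<eta>)", OF d2 d1])
        then have d3: "((\<lambda>s. norm (y + s *\<^sub>R \<eta>)) has_real_derivative (y \<bullet> \<eta>) / norm y) (at 0)"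
        proof -
          have "inverse r / 2 * (2 * b) = b / r" for b r :: real by (simp add: field_simps)
          then show ?thesis
            using \<open>(_ has_real_derivative inverse _ / 2 * _) (at 0)\<close> unfolding norm_eq_sqrt_inner by simp
        qed
        have d4: "(g has_real_derivative g' (norm y)) (at (norm (y + 0 *\<^sub>R \<eta>)))" using g(1) by simp
        show ?thesis unfolding \<tau>_def \<tau>'_def
          by (rule DERIV_chain2[where f = g and g = "\<lambda>s. norm (y + s *\<^sub>R \<eta>)", OF d4 d3])
      qed
      have FR: "F (cvec y 0) = Rr y" if "y \<in> V" for y
      proof -
        have "norm (x + y - x0) \<le> a + 4 * \<nu>" using xy[of y] that by (simp add: V_def)
        then show ?thesis by (simp add: F_eq Rr_def init_def cutoff_1)
      qed
      have 0: "\<tau> y = 0" if "y \<notin> cball 0 (a + 2 * \<nu>)" for y using that by (simp add: \<tau>_def g(5))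
      have 1: "cvec y ((\<theta> * \<tau> y) *\<^sub>R \<eta>) \<in> W" if "y \<in> V" "0 \<le> \<theta>" "\<theta> \<le> 1" for y \<theta>
        using rad[OF that] that(2) g(6)[of "norm y"] \<nu> by (simp add: W_def diamond_def abs_mult \<tau>_def)
      show "integrable lborel N" unfolding N_def[abs_def]
        by (rule integral_complex_shift(1)[OF W V cl sub order_refl holF Rri FR c1 c2 0 dt 1])
      show "(\<integral>y. N y \<partial>lborel) = (\<integral>y. Rr y \<partial>lborel)" unfolding N_def[abs_def]
        by (rule integral_complex_shift(2)[OF W V cl sub order_refl holF Rri FR c1 c2 0 dt 1])
    qed
    \<comment> \<open>The remaining imaginary part is at most \<open>\<kappa> * norm y\<close>: on
      \<open>V\<close> by the choice of the profile, and outside, where nothing is shifted, because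
      \<open>norm y\<close> exceeds \<open>a + \<nu>\<close>.\<close>
    have N_far: "cmod (N y) \<le> K1 * gs t * indicator (cball 0 (a + 7 * \<nu>)) y" if y: "norm y \<ge> \<delta>" for y
    proof (cases "y \<in> V")
      case True
      let ?q = "\<eta> - \<tau> y *\<^sub>R \<eta>"
      have "norm ?q = (1 - g (norm y)) * norm \<eta>"
      proof -
        have "?q = (1 - g (norm y)) *\<^sub>R \<eta>" by (simp add: \<tau>_def algebra_simps)
        then show ?thesis using g(7)[of "norm y"] by simp
      qed
      also have "\<dots> \<le> (1 - g (norm y)) * a" using x g(7)[of "norm y"] by (intro mult_left_mono) auto
      also have "\<dots> \<le> \<kappa> * norm y" using g(9)[of "norm y"] by (simp add: \<kappa>_def)
      finally have k: "cmod (hkc t (cvec (- y) ?q)) \<le> gs t" by (rule far[OF t y])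
      have "norm (x + y - x0) + norm (\<tau> y *\<^sub>R \<eta>) \<le> a + 4 * \<nu>"
        using rad[OF True, of 1] xy[of y] g(6)[of "norm y"] by (simp add: \<tau>_def)
      then have u: "cmod (U0 (cvec (x + y) (\<tau> y *\<^sub>R \<eta>))) \<le> M0" by (intro M0) (simp add: S_iff)
      have "\<bar>\<tau>' y\<bar> \<le> L * a"
      proof -
        have "\<bar>(y \<bullet> \<eta>) / norm y\<bar> \<le> norm \<eta>"
          using Cauchy_Schwarz_ineq2[of y \<eta>] by (cases "y = 0") (auto simp: abs_divide divide_le_eq mult.commute)
        then show ?thesis unfolding \<tau>'_def abs_mult using g(8)[of "norm y"] x L0 by (intro mult_mono) auto
      qed
      then have j: "cmod (1 + \<i> * of_real (\<tau>' y)) \<le> 1 + L * a"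
        by (intro order_trans[OF norm_triangle_ineq]) (simp add: norm_mult)
      have "cmod (N y) = cmod (U0 (cvec (x + y) (\<tau> y *\<^sub>R \<eta>))) * cmod (hkc t (cvec (- y) ?q)) * cmod (1 + \<i> * of_real (\<tau>' y))"
        using True by (simp add: N_def F_eq norm_mult)
      also have "\<dots> \<le> M0 * gs t * (1 + L * a)"
        using M0(1) order_trans[OF norm_ge_zero k] by (intro mult_mono u k j) auto
      also have "\<dots> = (M0 * (1 + L * a)) * gs t" by simp
      also have "\<dots> \<le> K1 * gs t" unfolding K1_def using order_trans[OF norm_ge_zero k] by (intro mult_right_mono) auto
      finally show ?thesis using True \<nu> by (simp add: V_def)
    next
      case False
      then have y3: "norm y \<ge> a + 3 * \<nu>" by (simp add: V_def)
      show ?thesis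
      proof (cases "norm y \<le> a + 7 * \<nu>")
        case True
        have "norm \<eta> \<le> \<kappa> * (a + \<nu>)" using x a \<nu> by (simp add: \<kappa>_def)
        also have "\<dots> \<le> \<kappa> * norm y" using \<kappa> y3 \<nu> by (intro mult_left_mono) auto
        finally have k: "cmod (hkc t (cvec (- y) \<eta>)) \<le> gs t" by (rule far[OF t y])
        have "cmod (N y) = cmod (init (x + y)) * cmod (hkc t (cvec (- y) \<eta>))" using False by (simp add: N_def Rr_def norm_mult)
        also have "\<dots> \<le> Mi * gs t" using Mi by (intro mult_mono k) auto
        also have "\<dots> \<le> K1 * gs t" unfolding K1_def using order_trans[OF norm_ge_zero k] by (intro mult_right_mono) auto
        finally show ?thesis using True by simp
      next
        case far': False
        then show ?thesis using False Rr0[of y] by (simp add: N_def)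
      qed
    qed
    \<comment> \<open>Truncation by 0 gives a globally bounded function; the approximation lemma
      asks for closeness to \<open>U0 z\<close> only near 0.\<close>
    define gg where "gg y = (if norm y < \<delta> then U0 (cvec (x + y) \<eta>) else 0)" for y
    have gg_S: "cvec (x + y) \<eta> \<in> S" if "norm y < \<delta>" for y
      using xy[of y] that x \<nu> by (simp add: S_iff \<delta>_def)
    have zS: "z \<in> S" using gg_S[of 0] \<delta> by (simp add: x)
    \<comment> \<open>Near 0 the shift is by the full \<open>\<eta>\<close>, so the imaginary parts
      cancel in the kernel and the Jacobian factor is 1.\<close>
    have near: "indicator (ball 0 \<delta>) y * N y = of_real (hk t y) * gg y" for y
    proof (cases "norm y < \<delta>")
      case True
      then have "y \<in> V" "\<tau> y = 1" "\<tau>' y = 0" using a \<nu> by (auto simp: V_def \<delta>_def \<tau>_def \<tau>'_def g(3,4))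
      then show ?thesis using True by (simp add: N_def F_eq gg_def hkc_cvec_0 hk_def)
    qed (simp add: gg_def)
    have gg_m: "gg \<in> borel_measurable borel"
    proof -
      have "continuous_on (ball 0 \<delta>) (\<lambda>y. U0 (cvec (x + y) \<eta>))"
        using gg_S by (intro continuous_on_compose2[OF cS(2)] continuous_on_cvec continuous_intros) auto
      then have "(\<lambda>y. indicator (ball 0 \<delta>) y *\<^sub>R U0 (cvec (x + y) \<eta>)) \<in> borel_measurable borel"
        by (intro borel_measurable_continuous_on_indicator) auto
      moreover have "(\<lambda>y. indicator (ball 0 \<delta>) y *\<^sub>R U0 (cvec (x + y) \<eta>)) = gg"
        by (auto simp: gg_def indicator_def fun_eq_iff)
      ultimately show ?thesis by simp
    qed
    have gauss: "cmod ((\<integral>y. of_real (hk t y) * gg y \<partial>lborel) - U0 z) \<le> e0 / 4 + tl t"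
    proof -
      have "cmod ((\<integral>y. of_real (hk t y) * gg y \<partial>lborel) - U0 z) \<le> e0 / 4 + (2 * M0) * (sqrt 2 ^ DIM(real ^ 'n) * exp (- d'\<^sup>2 / (8 * t)))"
      proof (rule integral_hk_approx(2)[OF t d'(1) gg_m])
        show "cmod (gg y - U0 z) \<le> 2 * M0" for y
          using norm_triangle_ineq4[of "gg y" "U0 z"] M0(2)[OF zS] M0(2)[OF gg_S, of y] M0(1) by (auto simp: gg_def)
        show "cmod (gg y - U0 z) \<le> e0 / 4" if y: "norm y < d'" for y
        proof -
          have y': "norm y < \<delta>" using y d' by simp
          have "dist (cvec (x + y) \<eta>) z = norm (cvec y (0 :: real ^ 'n))" by (simp add: dist_norm x cvec_diff)
          also have "\<dots> = norm y" by (simp add: norm_vec_def cvec_nth L2_set_def cmod_def)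
          also have "\<dots> < d" using y d' by simp
          finally have "dist (U0 (cvec (x + y) \<eta>)) (U0 z) < e0 / 4" by (intro d(2) gg_S y' zS)
          then show ?thesis using y' by (simp add: gg_def dist_norm)
        qed
      qed
      then show ?thesis by (simp add: tl_def)
    qed
    have iN: "integrable lborel (\<lambda>y. indicator (ball 0 \<delta>) y * N y)"
    proof -
      have "integrable lborel (\<lambda>y. N y * indicator (ball 0 \<delta>) y)"
        by (rule integrable_mult_bounded[OF N_int, of _ 1]) (auto simp: indicator_def)
      then show ?thesis by (simp only: mult.commute)
    qed
    have "cmod (\<integral>y. N y - indicator (ball 0 \<delta>) y * N y \<partial>lborel) \<le> (\<integral>y. K1 * gs t * indicator (cball (0 :: real ^ 'n) (a + 7 * \<nu>)) y \<partial>lborel)"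
    proof (rule Bochner_Integration.integral_norm_bound_integral)
      show "integrable lborel (\<lambda>y. N y - indicator (ball 0 \<delta>) y * N y)" using N_int iN by simp
      show "integrable lborel (\<lambda>y. K1 * gs t * indicator (cball (0 :: real ^ 'n) (a + 7 * \<nu>)) y)"
        by (intro integrable_mult_right integrable_real_indicator)
           (auto intro!: emeasure_bounded_finite[unfolded infinity_ennreal_def] bounded_cball)
      show "norm (N y - indicator (ball 0 \<delta>) y * N y) \<le> K1 * gs t * indicator (cball 0 (a + 7 * \<nu>)) y" for y
      proof (cases "norm y < \<delta>")
        case True
        then show ?thesis using K1 gcoef_pos[OF t, of "CARD('n)"] by (simp add: gs_def)
      next
        case False
        then show ?thesis using N_far[of y] by simp
      qed
    qed
    also have "\<dots> = K1 * gs t * vol" by (simp add: vol_def)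
    finally have rest: "cmod (\<integral>y. N y - indicator (ball 0 \<delta>) y * N y \<partial>lborel) \<le> K1 * gs t * vol" .
    have "G t z = (\<integral>y. N y - indicator (ball 0 \<delta>) y * N y \<partial>lborel) + (\<integral>y. indicator (ball 0 \<delta>) y * N y \<partial>lborel)"
      using N_int iN by (simp add: GR N_eq)
    then have "G t z - U0 z = (\<integral>y. N y - indicator (ball 0 \<delta>) y * N y \<partial>lborel) + ((\<integral>y. of_real (hk t y) * gg y \<partial>lborel) - U0 z)"
      unfolding near by simp
    then have "cmod (G t z - U0 z) \<le> K1 * gs t * vol + (e0 / 4 + tl t)"
      using norm_triangle_mono[OF rest gauss] by (simp only: near)
    then show ?thesis by (simp add: dist_norm)
  qed
  have "(tl \<longlongrightarrow> 0) (at_right 0)"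
  proof -
    have "((\<lambda>s. exp (- (d'\<^sup>2 / 8) * inverse s)) \<longlongrightarrow> 0) (at_right 0)"
      using d' by (intro filterlim_compose[OF exp_at_bot]
          filterlim_tendsto_neg_mult_at_bot[OF tendsto_const _ filterlim_inverse_at_top_right]) auto
    then have "((\<lambda>t. 2 * M0 * (sqrt 2 ^ CARD('n) * exp (- (d'\<^sup>2 / 8) * inverse t))) \<longlongrightarrow> 0) (at_right 0)"
      by (intro tendsto_mult_right_zero)
    moreover have "2 * M0 * (sqrt 2 ^ CARD('n) * exp (- (d'\<^sup>2 / 8) * inverse t)) = tl t" for t
    proof -
      have "- (d'\<^sup>2 / 8) * inverse t = - d'\<^sup>2 / (8 * t)" by (simp add: field_simps)
      then show ?thesis by (simp only: tl_def)
    qed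
    ultimately show ?thesis by simp
  qed
  then have t1: "\<forall>\<^sub>F t in at_right 0. tl t < e0 / 4" using e0 by (intro order_tendstoD(2)) auto
  have "(gs \<longlongrightarrow> 0) (at_right 0)"
    using gcoef_exp_tendsto_0[of "c * \<delta>\<^sup>2" 0 "CARD('n)"] c \<delta> by (simp add: gs_def[abs_def])
  then have "((\<lambda>t. K1 * gs t * vol) \<longlongrightarrow> 0) (at_right 0)"
    by (intro tendsto_mult_left_zero tendsto_mult_right_zero)
  then have t2: "\<forall>\<^sub>F t in at_right 0. K1 * gs t * vol < e0 / 4" using e0 by (intro order_tendstoD(2)) auto
  show "\<forall>\<^sub>F t in at_right 0. \<forall>z\<in>C. dist (G t z) (U0 z) < e0"
    using t1 t2 eventually_at_right_less[of 0]
  proof eventually_elim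
    case (elim t)
    show ?case
    proof
      fix z assume "z \<in> C"
      from est[OF elim(3) this] show "dist (G t z) (U0 z) < e0" using elim e0 by linarith
    qed
  qed
qed

lemma R_uniform_limit: "uniform_limit C R U0 (at_right 0)"
proof -
  have "uniform_limit C (\<lambda>t z. G t z + Bt t z) (\<lambda>z. U0 z + 0) (at_right 0)"
    by (rule uniform_limit_add[OF G_uniform_limit Bt_uniform_limit])
  then show ?thesis by (simp add: R_def[abs_def])
qed

end

section \<open>Gluing the local representations\<close>

text \<open>A ball is connected, so if it left \<open>\<Omega>\<close> it would contain a frontier
  point nearer to \<open>x\<close> than the frontier is.\<close>

lemma ball_infdist_frontier_subset:
  fixes x :: "'a::euclidean_space"
  assumes "x \<in> \<Omega>"
  shows "ball x (infdist x (frontier \<Omega>)) \<subseteq> \<Omega>"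
proof
  fix y assume y: "y \<in> ball x (infdist x (frontier \<Omega>))"
  show "y \<in> \<Omega>"
  proof (rule ccontr)
    assume "y \<notin> \<Omega>"
    let ?B = "ball x (infdist x (frontier \<Omega>))"
    have "x \<in> ?B" using y by (auto intro: order_le_less_trans[OF zero_le_dist])
    then have "?B \<inter> frontier \<Omega> \<noteq> {}"
    proof (intro connected_Int_frontier)
      show "?B \<inter> \<Omega> \<noteq> {}" using assms \<open>x \<in> ?B\<close> by blast
      show "?B - \<Omega> \<noteq> {}" using y \<open>y \<notin> \<Omega>\<close> by blast
    qed simp
    then obtain p where "p \<in> frontier \<Omega>" "dist x p < infdist x (frontier \<Omega>)" by auto
    then show False using infdist_le[of p "frontier \<Omega>" x] by simp
  qed
qed

text \<open>The distance to the frontier is 1-Lipschitz, so moving the real part lowers the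
  admissible height by at most the displacement.\<close>

lemma diamond_subset_tube:
  assumes "x \<in> \<Omega>"
  shows "diamond x (infdist x (frontier \<Omega>)) \<subseteq> tube \<Omega>"
proof
  fix z assume z: "z \<in> diamond x (infdist x (frontier \<Omega>))"
  have d: "dist x (Rev z) + norm (Imv z) < infdist x (frontier \<Omega>)"
    using z by (simp add: diamond_def dist_norm norm_minus_commute)
  then have "Rev z \<in> ball x (infdist x (frontier \<Omega>))" using norm_ge_zero[of "Imv z"] by (simp del: norm_ge_zero)
  then have "Rev z \<in> \<Omega>" using ball_infdist_frontier_subset[OF assms] by blast
  moreover have "norm (Imv z) < infdist (Rev z) (frontier \<Omega>)"
    using infdist_triangle[of x "frontier \<Omega>" "Rev z"] d by linarith
  ultimately show "z \<in> tube \<Omega>"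
    unfolding tube_def by (metis (mono_tags, lifting) cvec_Rev_Imv mem_Collect_eq)
qed

text \<open>Boundedness makes the frontier nonempty; \<open>infdist\<close> to the empty set would
  be 0.\<close>

lemma infdist_frontier_pos:
  fixes \<Omega> :: "'a::euclidean_space set"
  assumes "open \<Omega>" "bounded \<Omega>" "x \<in> \<Omega>"
  shows "infdist x (frontier \<Omega>) > 0"
proof -
  have "frontier \<Omega> \<noteq> {}" using assms not_bounded_UNIV by (auto simp: frontier_eq_empty)
  moreover have "x \<notin> frontier \<Omega>" using assms by (simp add: frontier_def interior_open)
  ultimately show ?thesis by (simp add: infdist_pos_not_in_closed)
qed

text \<open>A nonzero value persists on a relatively open set, which would contain a nonempty open
  set of measure 0.\<close>

lemma AE_continuous_eq_0:
  fixes h :: "real \<times> 'a::euclidean_space \<Rightarrow> complex"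
  assumes h: "continuous_on ({0<..T} \<times> B) h" and B: "open B"
    and ae: "AE z in lborel. z \<in> {0<..<T} \<times> B \<longrightarrow> h z = 0" and t: "t \<in> {0<..T}" and x: "x \<in> B"
  shows "h (t, x) = 0"
proof (rule ccontr)
  assume ne: "h (t, x) \<noteq> 0"
  have "openin (top_of_set ({0<..T} \<times> B)) (({0<..T} \<times> B) \<inter> h -` (- {0}))"
    by (rule continuous_openin_preimage_gen[OF h]) auto
  then obtain W where W: "open W" "({0<..T} \<times> B) \<inter> h -` (- {0}) = ({0<..T} \<times> B) \<inter> W"
    unfolding openin_open by blast
  then have "(t, x) \<in> W" using ne t x by auto
  then obtain e where e: "e > 0" "ball (t, x) e \<subseteq> W" using W(1) openE by blast
  \<comment> \<open>For \<open>t = T\<close> every neighbourhood leaves the open time interval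
    covered by the hypothesis; a slightly earlier positive time avoids this.\<close>
  define s where "s = max (t / 2) (t - e / 2)"
  have s: "0 < s" "s < T" "s < t" "\<bar>t - s\<bar> < e" using t e by (auto simp: s_def max_def)
  have "dist (t, x) (s, x) < e" using s by (simp add: dist_Pair_Pair dist_real_def)
  then have sW: "(s, x) \<in> W" using e by auto
  define O' where "O' = ({0<..<T} \<times> B) \<inter> W"
  have "open O'" unfolding O'_def by (intro open_Int open_Times open_greaterThanLessThan W(1) B)
  moreover have "(s, x) \<in> O'" using sW s x by (simp add: O'_def)
  ultimately have O': "open O'" "O' \<noteq> {}" by auto
  have "AE z in lborel. z \<notin> O'"
    using ae
  proof eventually_elim
    case (elim z)
    show ?case
    proof
      assume z: "z \<in> O'"
      then have "z \<in> ({0<..T} \<times> B) \<inter> W" by (auto simp: O'_def)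
      then have "h z \<noteq> 0" using W(2) by blast
      then show False using elim z by (auto simp: O'_def)
    qed
  qed
  moreover have "O' \<in> sets lborel" using O' by simp
  ultimately have "O' \<in> null_sets lborel" by (simp add: AE_iff_null_sets)
  then have "negligible O'" by (simp add: negligible_iff_null_sets null_sets_completionI)
  then show False using O' open_not_negligible by blast
qed

text \<open>The properties that gluing requires: continuity and agreement with \<open>u\<close>
  almost everywhere identify any two such functions at real points, and holomorphy carries this to
  complex points. Continuity is asked for all positive times so as to include the final time
  \<open>T\<close>.\<close>

definition local_solution ::
    "real \<Rightarrow> (real \<times> (real ^ 'n) \<Rightarrow> complex) \<Rightarrow> (complex ^ 'n \<Rightarrow> complex) \<Rightarrow> real ^ 'n \<Rightarrow> real \<Rightarrow> real
      \<Rightarrow> (real \<Rightarrow> complex ^ 'n \<Rightarrow> complex) \<Rightarrow> bool" where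
  "local_solution T u U0 x0 \<rho> a F \<longleftrightarrow>
     (\<forall>t>0. holomorphic_several_on (F t) (cylinder x0 \<rho> a)) \<and>
     continuous_on ({0<..} \<times> ball x0 \<rho>) (\<lambda>p. F (fst p) (cvec (snd p) 0)) \<and>
     (AE z in lborel. z \<in> {0<..<T} \<times> ball x0 \<rho> \<longrightarrow> F (fst z) (cvec (snd z) 0) = u z) \<and>
     uniform_limit (cylinder x0 \<rho> a) F U0 (at_right 0)"

lemma local_solution_exists:
  fixes \<Omega> :: "(real ^ 'n) set"
  assumes \<Omega>: "open \<Omega>" and int: "set_integrable lborel ({0<..<T} \<times> \<Omega>) u"
    and heat: "heat_equation T \<Omega> u" and init: "initial_value T \<Omega> u u0"
    and ext: "holomorphic_extension \<Omega> u0 U0"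
    and x0: "x0 \<in> \<Omega>" and a: "0 < a" "a < infdist x0 (frontier \<Omega>)"
  shows "\<exists>\<rho> F. 0 < \<rho> \<and> ball x0 \<rho> \<subseteq> \<Omega> \<and> cylinder x0 \<rho> a \<subseteq> tube \<Omega> \<and> local_solution T u U0 x0 \<rho> a F"
proof -
  define D where "D = infdist x0 (frontier \<Omega>)"
  define \<nu> where "\<nu> = (D - a) / 8"
  have D\<nu>: "\<nu> > 0" "a + 8 * \<nu> = D" using a by (simp_all add: \<nu>_def D_def field_simps)
  have B: "ball x0 D \<subseteq> \<Omega>" unfolding D_def by (rule ball_infdist_frontier_subset[OF x0])
  have dt: "diamond x0 D \<subseteq> tube \<Omega>" unfolding D_def by (rule diamond_subset_tube[OF x0])
  define U where "U z = indicator ({0<..<T} \<times> \<Omega>) z *\<^sub>R u z" for z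
  have U: "integrable lborel U" using int by (simp add: U_def[abs_def] set_integrable_def)
  have U_0: "U z = 0" if "fst z \<le> 0" for z using that by (cases z) (simp add: U_def)
  have U0: "holomorphic_several_on U0 (diamond x0 (a + 8 * \<nu>))"
    using ext dt D\<nu> holomorphic_several_subset unfolding holomorphic_extension_def by metis
  interpret local_heat U U0 x0 a \<nu>
    by unfold_locales (use a D\<nu> U U_0 U0 in auto)
  let ?K = "ball x0 (a + 7 * \<nu>)"
  \<comment> \<open>The data at real points, truncated to a compact ball inside the diamond to make
    them integrable; on the supports of the test functions they coincide with
    \<open>u0\<close>.\<close>
  define v where "v y = indicator (cball x0 (a + 7 * \<nu>)) y *\<^sub>R U0 (cvec y 0)" for y
  have v: "integrable lborel v" unfolding v_def[abs_def]
  proof (rule borel_integrable_compact)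
    show "continuous_on (cball x0 (a + 7 * \<nu>)) (\<lambda>y. U0 (cvec y 0))"
      by (intro continuous_on_compose2[OF holomorphic_several_imp_continuous[OF U0]] continuous_on_cvec continuous_intros)
         (use D\<nu> in \<open>auto simp: diamond_def dist_norm norm_minus_commute\<close>)
  qed simp
  have "?K \<subseteq> ball x0 D" using D\<nu> by (intro subset_ball) linarith
  then have K\<Omega>: "?K \<subseteq> \<Omega>" using B by blast
  have "ball x0 \<nu> \<subseteq> ball x0 D" using D\<nu> a by (intro subset_ball) linarith
  then have \<nu>\<Omega>: "ball x0 \<nu> \<subseteq> \<Omega>" using B by blast
  have star: "AE s in lborel. s \<in> {0<..<T} \<longrightarrow> (\<forall>\<phi>. test_function ?K \<phi> \<longrightarrow>
    (\<integral>y. U (s, y) * \<phi> y \<partial>lborel) = (\<integral>y. v y * \<phi> y \<partial>lborel)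
      + (\<integral>z. U z * (indicator {0<..<s} (fst z) * lap \<phi> (snd z)) \<partial>lborel))"
    using heat_equation_integrated[OF \<Omega> heat init int]
  proof (eventually_elim, intro impI allI)
    fix s \<phi>
    assume s: "s \<in> {0<..<T} \<longrightarrow> (\<forall>\<psi>. test_function \<Omega> \<psi> \<longrightarrow>
      (\<integral>y. indicator ({0<..<T} \<times> \<Omega>) (s, y) *\<^sub>R u (s, y) * \<psi> y \<partial>lborel) = (LINT x:\<Omega>|lborel. u0 x * \<psi> x)
      + (\<integral>z. indicator ({0<..<T} \<times> \<Omega>) z *\<^sub>R u z * (indicator {0<..<s} (fst z) * lap \<psi> (snd z)) \<partial>lborel))"
      and sT: "s \<in> {0<..<T}" and \<phi>: "test_function ?K \<phi>"
    have "test_function \<Omega> \<phi>" using \<phi> K\<Omega> unfolding test_function_def by blast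
    moreover have "(LINT x:\<Omega>|lborel. u0 x * \<phi> x) = (\<integral>y. v y * \<phi> y \<partial>lborel)"
      unfolding set_lebesgue_integral_def
    proof (intro Bochner_Integration.integral_cong refl)
      fix y
      show "indicator \<Omega> y *\<^sub>R (u0 y * \<phi> y) = v y * \<phi> y"
      proof (cases "\<phi> y = 0")
        case False
        then have y: "y \<in> ?K" using test_function_nonzero[OF \<phi>] by blast
        then have "U0 (cvec y 0) = u0 y" using ext K\<Omega> unfolding holomorphic_extension_def by blast
        then show ?thesis using y K\<Omega> by (auto simp: v_def)
      qed simp
    qed
    ultimately show "(\<integral>y. U (s, y) * \<phi> y \<partial>lborel) = (\<integral>y. v y * \<phi> y \<partial>lborel)
      + (\<integral>z. U z * (indicator {0<..<s} (fst z) * lap \<phi> (snd z)) \<partial>lborel)"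
      using s sT by (simp add: U_def)
  qed
  \<comment> \<open>The cutoff vanishes before the truncation of \<open>v\<close> takes
    effect.\<close>
  have vc: "v y * (cutoff y * w) = local.init y * w" for y w
    using cutoff_0[of y] D\<nu> by (cases "y \<in> cball x0 (a + 7 * \<nu>)")
      (auto simp: v_def init_def dist_norm norm_minus_commute)
  have rep: "AE t in lborel. t \<in> {0<..<T} \<longrightarrow> (AE x in lborel. x \<in> ball x0 \<nu> \<longrightarrow> U (t, x) = R t (cvec x 0))"
    by (rule R_eq_U_AE, unfold vc[symmetric], rule heat_kernel_representation[OF U(1) U(2) v star test_cutoff])
  have ae: "AE z in lborel. z \<in> {0<..<T} \<times> ball x0 \<nu> \<longrightarrow> R (fst z) (cvec (snd z) 0) = u z"
  proof -
    \<comment> \<open>Passing from almost every \<open>t\<close> and almost every \<open>x\<close>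
      to almost every pair needs a measurable exceptional set, hence a Borel function in place of
      \<open>R\<close>, whose continuity is known only on the strip.\<close>
    define g where "g z = indicator ({0<..} \<times> ball x0 \<nu>) z *\<^sub>R R (fst z) (cvec (snd z) 0)" for z
    have [measurable]: "g \<in> borel_measurable borel" unfolding g_def[abs_def]
      by (rule borel_measurable_continuous_on_indicator[OF _ continuous_R], intro borel_open open_Times) auto
    have [measurable]: "U \<in> borel_measurable borel" using U by auto
    have [measurable]: "{0<..<T} \<times> ball x0 \<nu> \<in> sets borel" by (intro borel_open open_Times) auto
    have "AE z in lborel \<Otimes>\<^sub>M lborel. z \<in> {0<..<T} \<times> ball x0 \<nu> \<longrightarrow> U z = g z"
    proof (rule lborel_pair.AE_pair_measure)
      have "{z \<in> space borel. z \<in> {0<..<T} \<times> ball x0 \<nu> \<longrightarrow> U z = g z} \<in> sets borel" by measurable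
      then show "{z \<in> space (lborel \<Otimes>\<^sub>M lborel). z \<in> {0<..<T} \<times> ball x0 \<nu> \<longrightarrow> U z = g z} \<in> sets (lborel \<Otimes>\<^sub>M lborel)"
        unfolding lborel_prod by simp
      show "AE t in lborel. AE x in lborel. (t, x) \<in> {0<..<T} \<times> ball x0 \<nu> \<longrightarrow> U (t, x) = g (t, x)"
        using rep
      proof eventually_elim
        case (elim t)
        show ?case
        proof (cases "t \<in> {0<..<T}")
          case True
          then have "AE x in lborel. x \<in> ball x0 \<nu> \<longrightarrow> U (t, x) = R t (cvec x 0)" using elim by blast
          then show ?thesis by eventually_elim (use True in \<open>auto simp: g_def\<close>)
        next
          case False
          then show ?thesis by (intro AE_I2) auto
        qed
      qed
    qed
    then have "AE z in lborel. z \<in> {0<..<T} \<times> ball x0 \<nu> \<longrightarrow> U z = g z" unfolding lborel_prod .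
    then show ?thesis
    proof eventually_elim
      case (elim z)
      show ?case using elim \<nu>\<Omega> by (cases z) (auto simp: U_def g_def)
    qed
  qed
  have "local_solution T u U0 x0 \<nu> a R"
    unfolding local_solution_def
    using holomorphic_R continuous_R ae R_uniform_limit by (simp add: C_def)
  moreover have "cylinder x0 \<nu> a \<subseteq> tube \<Omega>" using dt D\<nu> by (force simp: cylinder_def diamond_def)
  ultimately show ?thesis using D\<nu>(1) \<nu>\<Omega> by blast
qed

text \<open>On the common part of the two balls both functions are continuous and equal
  \<open>u\<close> almost everywhere.\<close>

lemma local_solution_unique_real:
  assumes 1: "local_solution T u U0 x1 \<rho>1 a1 F1" and 2: "local_solution T u U0 x2 \<rho>2 a2 F2"
    and t: "t \<in> {0<..T}" and x: "x \<in> ball x1 \<rho>1" "x \<in> ball x2 \<rho>2"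
  shows "F1 t (cvec x 0) = F2 t (cvec x 0)"
proof -
  let ?B = "ball x1 \<rho>1 \<inter> ball x2 \<rho>2"
  let ?h = "\<lambda>p. F1 (fst p) (cvec (snd p) 0) - F2 (fst p) (cvec (snd p) 0)"
  have "?h (t, x) = 0"
  proof (rule AE_continuous_eq_0[of T ?B])
    show "continuous_on ({0<..T} \<times> ?B) ?h"
      using 1 2 unfolding local_solution_def
      by (intro continuous_on_diff) (auto elim!: continuous_on_subset)
    have "AE z in lborel. z \<in> {0<..<T} \<times> ball x1 \<rho>1 \<longrightarrow> F1 (fst z) (cvec (snd z) 0) = u z"
      "AE z in lborel. z \<in> {0<..<T} \<times> ball x2 \<rho>2 \<longrightarrow> F2 (fst z) (cvec (snd z) 0) = u z"
      using 1 2 unfolding local_solution_def by blast+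
    then show "AE z in lborel. z \<in> {0<..<T} \<times> ?B \<longrightarrow> ?h z = 0"
      by eventually_elim auto
  qed (use t x in auto)
  then show ?thesis by simp
qed

text \<open>The intersection of two cylinders is convex and contains with \<open>z\<close> its real
  part, so agreement at real points propagates to \<open>z\<close>.\<close>

lemma local_solution_unique:
  assumes 1: "local_solution T u U0 x1 \<rho>1 a1 F1" and 2: "local_solution T u U0 x2 \<rho>2 a2 F2"
    and t: "t \<in> {0<..T}" and z: "z \<in> cylinder x1 \<rho>1 a1" "z \<in> cylinder x2 \<rho>2 a2"
  shows "F1 t z = F2 t z"
proof -
  let ?S = "cylinder x1 \<rho>1 a1 \<inter> cylinder x2 \<rho>2 a2"
  have real: "cvec x 0 \<in> cylinder y \<rho> a \<Longrightarrow> x \<in> ball y \<rho>" for x y :: "real ^ 'a" and \<rho> a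
    by (simp add: cylinder_def dist_norm norm_minus_commute)
  have "F1 t (cvec (Rev z) (Imv z)) = F2 t (cvec (Rev z) (Imv z))"
  proof (rule holomorphic_several_eq_on_real[of ?S])
    show "open ?S" "convex ?S" by (simp_all add: open_Int open_cylinder convex_Int convex_cylinder)
    show "cvec (Rev z) (Imv z) \<in> ?S" using z by simp
    show "cvec (Rev z) 0 \<in> ?S"
      using z norm_ge_zero[of "Imv z"] by (auto simp: cylinder_def simp del: norm_ge_zero)
    show "holomorphic_several_on (F1 t) ?S" "holomorphic_several_on (F2 t) ?S"
      using 1 2 t unfolding local_solution_def
      by (auto intro: holomorphic_several_subset)
    show "F1 t (cvec x 0) = F2 t (cvec x 0)" if "cvec x 0 \<in> ?S" for x
      using that by (intro local_solution_unique_real[OF 1 2 t] real[of x _ _ a1] real[of x _ _ a2]) auto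
  qed
  then show ?thesis by simp
qed

text \<open>The solution is a class, so its values at single times are those of a continuous
  representative \<open>u'\<close>. Continuity determines \<open>u'\<close> on its domain and the
  identity theorem determines each \<open>v t\<close> on the tube, so the existential quantifiers
  leave no choice there.\<close>

theorem theorem2:
  fixes \<Omega> :: "(real ^ 'n) set" and T :: real
    and u h :: "real \<times> (real ^ 'n) \<Rightarrow> complex"
    and u0 :: "real ^ 'n \<Rightarrow> complex" and U0 :: "complex ^ 'n \<Rightarrow> complex"
  assumes "bounded_lipschitz_domain \<Omega>" and "T > 0"
    and "u \<in> HQ T \<Omega>" and "h \<in> HSigma T \<Omega>"
    and "u0 \<in> H1_0 \<Omega>" and "holomorphic_extension \<Omega> u0 U0"
    and "heat_equation T \<Omega> u"
    and "initial_value T \<Omega> u u0"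
    and "has_trace T \<Omega> u h"
  shows "\<exists>u' v.
    continuous_on ({0<..T} \<times> \<Omega>) u' \<and>
    (AE z in lborel. z \<in> {0<..<T} \<times> \<Omega> \<longrightarrow> u' z = u z) \<and>
    (\<forall>t\<in>{0<..T}. holomorphic_extension \<Omega> (\<lambda>x. u' (t, x)) (v t)) \<and>
    (\<forall>K. compact K \<longrightarrow> K \<subseteq> tube \<Omega> \<longrightarrow> uniform_limit K v U0 (at_right 0))"
proof -
  have \<Omega>: "open \<Omega>" "bounded \<Omega>" using assms(1) by (auto simp: bounded_lipschitz_domain_def)
  have int: "set_integrable lborel ({0<..<T} \<times> \<Omega>) u" by (rule HQ_set_integrable[OF assms(3) \<Omega>(2,1)])
  \<comment> \<open>The mean of the height of \<open>z\<close> and the admissible height: the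
    cylinder then contains \<open>z\<close>, and a margin to the frontier remains.\<close>
  define \<alpha> where "\<alpha> z = (norm (Imv z) + infdist (Rev z) (frontier \<Omega>)) / 2" for z :: "complex ^ 'n"
  have tubeD: "Rev z \<in> \<Omega>" "norm (Imv z) < infdist (Rev z) (frontier \<Omega>)" if "z \<in> tube \<Omega>" for z
    using that by (auto simp: tube_def)
  have real_tube: "cvec x 0 \<in> tube \<Omega>" if "x \<in> \<Omega>" for x
    using infdist_frontier_pos[OF \<Omega> that] that unfolding tube_def
    by (intro CollectI exI[of _ x] exI[of _ 0]) simp
  have \<alpha>: "0 < \<alpha> z" "norm (Imv z) < \<alpha> z" "\<alpha> z < infdist (Rev z) (frontier \<Omega>)" if "z \<in> tube \<Omega>" for z
    using tubeD(2)[OF that] norm_ge_zero[of "Imv z"] by (simp_all add: \<alpha>_def del: norm_ge_zero)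
  have "\<forall>z\<in>tube \<Omega>. \<exists>\<rho> F. 0 < \<rho> \<and> ball (Rev z) \<rho> \<subseteq> \<Omega> \<and> cylinder (Rev z) \<rho> (\<alpha> z) \<subseteq> tube \<Omega> \<and>
      local_solution T u U0 (Rev z) \<rho> (\<alpha> z) F"
    using local_solution_exists[OF \<Omega>(1) int assms(7,8,6)] tubeD \<alpha> by blast
  then obtain \<rho> F where F: "\<And>z. z \<in> tube \<Omega> \<Longrightarrow> 0 < \<rho> z" "\<And>z. z \<in> tube \<Omega> \<Longrightarrow> ball (Rev z) (\<rho> z) \<subseteq> \<Omega>"
      "\<And>z. z \<in> tube \<Omega> \<Longrightarrow> cylinder (Rev z) (\<rho> z) (\<alpha> z) \<subseteq> tube \<Omega>"
      "\<And>z. z \<in> tube \<Omega> \<Longrightarrow> local_solution T u U0 (Rev z) (\<rho> z) (\<alpha> z) (F z)"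
    by metis
  \<comment> \<open>Each point uses the local solution chosen for it; \<open>vF\<close> shows that
    any other one whose cylinder contains the point gives the same value.\<close>
  define v where "v t z = F z t z" for t z
  define u' where "u' p = v (fst p) (cvec (snd p) 0)" for p
  have in_cyl: "z \<in> cylinder (Rev z) (\<rho> z) (\<alpha> z)" if "z \<in> tube \<Omega>" for z
    using F(1) \<alpha>(2) that by (simp add: cylinder_def)
  have vF: "v t w = F z t w" if "z \<in> tube \<Omega>" "w \<in> cylinder (Rev z) (\<rho> z) (\<alpha> z)" "t \<in> {0<..T}" for t z w
  proof -
    have w: "w \<in> tube \<Omega>" using F(3) that by blast
    show ?thesis unfolding v_def
      by (rule local_solution_unique[OF F(4)[OF w] F(4)[OF that(1)] that(3) in_cyl[OF w] that(2)])
  qed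
  have u'F: "u' p = F (cvec x 0) (fst p) (cvec (snd p) 0)"
    if "x \<in> \<Omega>" "snd p \<in> ball x (\<rho> (cvec x 0))" "fst p \<in> {0<..T}" for x p
    unfolding u'_def
    using that \<alpha>(1)[OF real_tube[OF that(1)]]
    by (intro vF real_tube) (auto simp: cylinder_def dist_norm norm_minus_commute)
  have u'_cont: "continuous_on ({0<..T} \<times> \<Omega>) u'"
    unfolding continuous_on_eq_continuous_within
  proof
    fix q assume q: "q \<in> {0<..T} \<times> \<Omega>"
    define x where "x = snd q"
    have x: "x \<in> \<Omega>" using q by (auto simp: x_def)
    note Fx = F[OF real_tube[OF x]]
    let ?B = "ball x (\<rho> (cvec x 0))"
    have "continuous_on ({0<..T} \<times> ?B) (\<lambda>p. F (cvec x 0) (fst p) (cvec (snd p) 0))"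
      using Fx(4) unfolding local_solution_def by (auto elim!: continuous_on_subset)
    then have c: "continuous_on ({0<..T} \<times> ?B) u'"
      by (rule continuous_on_eq) (use u'F[OF x] in auto)
    have "q \<in> {0<..T} \<times> ?B" using q Fx(1) by (auto simp: x_def)
    then have "continuous (at q within {0<..T} \<times> ?B) u'"
      using c unfolding continuous_on_eq_continuous_within by blast
    moreover have "at q within {0<..T} \<times> ?B = at q within {0<..T} \<times> \<Omega>"
    proof (rule at_within_nhd)
      show "q \<in> UNIV \<times> ?B" using Fx(1) by (cases q) (simp add: x_def)
      show "open (UNIV \<times> ?B)" by (intro open_Times) auto
      show "({0<..T} \<times> ?B) \<inter> (UNIV \<times> ?B) - {q} = ({0<..T} \<times> \<Omega>) \<inter> (UNIV \<times> ?B) - {q}"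
        using Fx(2) by auto
    qed
    ultimately show "continuous (at q within {0<..T} \<times> \<Omega>) u'" by simp
  qed
  have u'_ae: "AE z in lborel. z \<in> {0<..<T} \<times> \<Omega> \<longrightarrow> u' z = u z"
  proof -
    \<comment> \<open>Only countably many exceptional sets may be united, so a countable subcover of
      the balls is extracted.\<close>
    define \<F> where "\<F> = (\<lambda>x. ball x (\<rho> (cvec x 0))) ` \<Omega>"
    obtain \<F>' where \<F>': "\<F>' \<subseteq> \<F>" "countable \<F>'" "\<Union>\<F>' = \<Union>\<F>"
      using Lindelof[of \<F>] by (auto simp: \<F>_def)
    have "AE z in lborel. \<forall>B\<in>\<F>'. z \<in> {0<..<T} \<times> B \<longrightarrow> u' z = u z"
    proof (rule AE_ball_countable'[OF _ \<F>'(2)])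
      fix B assume "B \<in> \<F>'"
      then obtain x where x: "x \<in> \<Omega>" "B = ball x (\<rho> (cvec x 0))" using \<F>'(1) by (auto simp: \<F>_def)
      have "AE z in lborel. z \<in> {0<..<T} \<times> B \<longrightarrow> F (cvec x 0) (fst z) (cvec (snd z) 0) = u z"
        using F(4)[OF real_tube[OF x(1)]] unfolding local_solution_def by (simp add: x(2))
      then show "AE z in lborel. z \<in> {0<..<T} \<times> B \<longrightarrow> u' z = u z"
        by eventually_elim (use u'F[OF x(1)] x(2) in auto)
    qed
    then show ?thesis
    proof eventually_elim
      case (elim z)
      show ?case
      proof
        assume z: "z \<in> {0<..<T} \<times> \<Omega>"
        then have "snd z \<in> \<Union>\<F>" using F(1)[OF real_tube] by (auto simp: \<F>_def intro!: bexI[of _ "snd z"])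
        then obtain B where "B \<in> \<F>'" "snd z \<in> B" using \<F>'(3) by blast
        then show "u' z = u z" using elim z by auto
      qed
    qed
  qed
  have v_ext: "holomorphic_extension \<Omega> (\<lambda>x. u' (t, x)) (v t)" if t: "t \<in> {0<..T}" for t
    unfolding holomorphic_extension_def
  proof
    show "holomorphic_several_on (v t) (tube \<Omega>)"
      unfolding holomorphic_several_on_def
    proof
      fix z assume z: "z \<in> tube \<Omega>"
      have "holomorphic_several_on (F z t) (cylinder (Rev z) (\<rho> z) (\<alpha> z))"
        using F(4)[OF z] t unfolding local_solution_def by simp
      then have "holomorphic_several_on (v t) (cylinder (Rev z) (\<rho> z) (\<alpha> z))"
        by (rule holomorphic_several_transform[OF _ open_cylinder]) (use vF[OF z _ t] in simp)
      then show "\<exists>L. (v t has_derivative L) (at z) \<and> (\<forall>c w. L (c *s w) = c * L w)"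
        using in_cyl[OF z] unfolding holomorphic_several_on_def by blast
    qed
  qed (simp add: u'_def)
  have v_lim: "uniform_limit K v U0 (at_right 0)" if K: "compact K" "K \<subseteq> tube \<Omega>" for K
  proof -
    let ?C = "\<lambda>z. cylinder (Rev z) (\<rho> z) (\<alpha> z)"
    \<comment> \<open>Convergence is uniform on each cylinder, and compactness leaves finitely many
      of them.\<close>
    have "K \<subseteq> (\<Union>z\<in>K. ?C z)" using in_cyl K(2) by blast
    then obtain J where J: "J \<subseteq> K" "finite J" "K \<subseteq> (\<Union>z\<in>J. ?C z)"
      using compactE_image[OF K(1), of K ?C] open_cylinder by metis
    have "uniform_limit (\<Union>(?C ` J)) v U0 (at_right 0)"
    proof (rule uniform_limit_on_Union)
      fix S assume "S \<in> ?C ` J"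
      then obtain z where z: "z \<in> tube \<Omega>" "S = ?C z" using J(1) K(2) by blast
      have "\<forall>\<^sub>F t in at_right 0. t < T" using assms(2) by (auto simp: eventually_at_right_field)
      then have "\<forall>\<^sub>F t in at_right 0. \<forall>w\<in>S. v t w = F z t w"
        using eventually_at_right_less[of 0] by eventually_elim (use vF[OF z(1)] z(2) in auto)
      moreover have "uniform_limit S (F z) U0 (at_right 0)"
        using F(4)[OF z(1)] unfolding local_solution_def z(2) by simp
      ultimately show "uniform_limit S v U0 (at_right 0)"
        by (subst uniform_limit_cong) auto
    qed (use J(2) in simp)
    then show ?thesis by (rule uniform_limit_on_subset) (use J(3) in simp)
  qed
  show ?thesis using u'_cont u'_ae v_ext v_lim by blast
qed

end
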